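(* Let $K$ be a pre-cubical set with no loops. For every equivalence system $\mathfrak{F}$: (a) $\{U_c\}_{c\in\bigcup_n K[n]}$ is a stable total $\mathfrak{F}$-component system on $|K|$; (b) $\{V^+_v\}_{v\in K[0]}$ is a stable future $\mathfrak{F}$-component system on $|K|$; (c) $\{V^-_v\}_{v\in K[0]}$ is a stable past $\mathfrak{F}$-component system on $|K|$.
   Context: **d-spaces.** A d-space is a topological space $X$ with a set $\vec{P}_X$ of continuous paths $[0,1]\to X$ (called d-paths; topologized as a subspace of the path space with the compact-open topology) containing all constant paths $\sigma_x$, closed under concatenation $\alpha*\beta$ (for $\alpha(1)=\beta(0)$) and under precomposition with non-decreasing continuous maps $[0,1]\to[0,1]$. For $A\subseteq X$, $\vec{P}_A$ is the set of d-paths with image in $A$; $\vec{P}_A(B,C)=\{\alpha\in\vec{P}_A : \alpha(0)\in B,\ \alpha(1)\in C\}$ (points are written for singletons). Write $x\le y$ if $\vec{P}_X(x,y)\ne\emptyset$. $X$ has no loops if $\vec{P}_X(x,x)=\{\sigma_x\}$ for all $x$. $A_{\ge x}=\{y\in A: y\ge x\}$, $A_{\le x}=\{y\in A: y\le x\}$. For d-paths $\alpha,\beta$, $\vec{P}(\alpha,\beta):\vec{P}_X(\alpha(1),\beta(0))\to\vec{P}_X(\alpha(0),\beta(1))$ is the map $\omega\mapsto\alpha*\omega*\beta$. **Equivalence systems.** A family $\mathfrak{F}$ of morphisms of the category of topological spaces is an equivalence system if: (a) it satisfies 2-out-of-3; (b) if $f,g$ are homotopic then both or neither lie in $\mathfrak{F}$;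 (c) it contains all weak homotopy equivalences; (d) $f\in\mathfrak{F}$ implies $\pi_0(f)$ is a bijection; (e) for a finite family of maps $f_i$, $\coprod f_i\in\mathfrak{F}$ iff all $f_i\in\mathfrak{F}$; (f) $f,g\in\mathfrak{F}$ implies $f\times g\in\mathfrak{F}$. Members of $\mathfrak{F}$ are $\mathfrak{F}$-equivalences; two spaces are $\mathfrak{F}$-equivalent if connected by a zig-zag of $\mathfrak{F}$-equivalences; a space $Y$ is $\mathfrak{F}$-contractible if $Y\to\{*\}$ is in $\mathfrak{F}$. **Stability.** $A\subseteq X$ is d-convex if $\vec{P}_A(A,A)=\vec{P}_X(A,A)$; future connected if for all $x,y\in A$ there is $z\in A$ with $\vec{P}_A(x,z)\ne\emptyset\ne\vec{P}_A(y,z)$; past connected if for all $x,y\in A$ there is $z\in A$ with $\vec{P}_A(z,x)\ne\emptyset\ne\vec{P}_A(z,y)$. For $\alpha\in\vec{P}_X$ and $A$ future connected, $\mathrm{St}^+_{\mathfrak{F}}(\alpha;A)$ is the set of $z\in A$ such that $\vec{P}(\alpha,\beta)\in\mathfrak{F}$ for every $\beta\in\vec{P}_{A_{\ge z}}$; for $A$ past connected, $\mathrm{St}^-_{\mathfrak{F}}(A;\alpha)$ is the set of $z\in A$ such that $\vec{P}(\beta,\alpha)\in\mathfrak{F}$ for every $\beta\in\vec{P}_{A_{\le z}}$. For a point $x$ these are taken with $\alpha=\sigma_x$. For future connected $A,B$ the pair $(A,B)$ is future $\mathfrak{F}$-stable if $\mathrm{St}^+_{\mathfrak{F}}(\alpha;B)\ne\emptyset$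 for all $\alpha\in\vec{P}_A$; for past connected $A,B$ it is past $\mathfrak{F}$-stable if $\mathrm{St}^-_{\mathfrak{F}}(A;\beta)\ne\emptyset$ for all $\beta\in\vec{P}_B$. It is totally $\mathfrak{F}$-stable if it is future and past $\mathfrak{F}$-stable and there are $a\in A$, $b\in B$ with $b\in\mathrm{St}^+_{\mathfrak{F}}(a;B)$ and $a\in\mathrm{St}^-_{\mathfrak{F}}(A;b)$. If $(A,B)$ is future $\mathfrak{F}$-stable, $\mathrm{S}\vec{\mathrm{P}}^+_{\mathfrak{F}}(A,B):=\vec{P}_X(a,z)$ for any $a\in A$, $z\in\mathrm{St}^+_{\mathfrak{F}}(a;B)$ (well defined up to $\mathfrak{F}$-equivalence); if past $\mathfrak{F}$-stable, $\mathrm{S}\vec{\mathrm{P}}^-_{\mathfrak{F}}(A,B):=\vec{P}_X(z,b)$ for any $b\in B$, $z\in\mathrm{St}^-_{\mathfrak{F}}(A;b)$. **Component systems.** A future (past) connected $A$ is future (past) $\mathfrak{F}$-trivial if $(A,A)$ is future (past) $\mathfrak{F}$-stable and $\mathrm{S}\vec{\mathrm{P}}^{+}_{\mathfrak{F}}(A,A)$ (resp. $\mathrm{S}\vec{\mathrm{P}}^{-}_{\mathfrak{F}}(A,A)$) is $\mathfrak{F}$-contractible. A family $\{A_i\}_{i\in I}$ of pairwise disjoint subsets covering $X$ is a stable future (past) $\mathfrak{F}$-component system if every $A_i$ is d-convex, future (past) connected and future (past) $\mathfrak{F}$-trivial, and every pair $(A_i,A_j)$ is future (past) $\mathfrak{F}$-stable.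 A stable total $\mathfrak{F}$-component system is a family that is both a stable future and a stable past $\mathfrak{F}$-component system and such that every pair $(A_i,A_j)$ is totally $\mathfrak{F}$-stable. **Pre-cubical sets.** A pre-cubical set $K$ is a sequence of disjoint sets $(K[n])_{n\ge0}$ with face maps $d^\varepsilon_i:K[n]\to K[n-1]$, $1\le i\le n$, $\varepsilon\in\{0,1\}$, satisfying $d^\varepsilon_i d^\eta_j=d^\eta_{j-1}d^\varepsilon_i$ for $i<j$. Elements of $K[n]$ are $n$-cubes. Let $\vec{I}^n=[0,1]^n$ with d-paths the paths non-decreasing in each coordinate. The geometric realization $|K|$ is the quotient d-space of $\coprod_n K[n]\times\vec{I}^n$ by the equivalence relation generated by $[d^\varepsilon_i(c),(t_1,\dots,t_{n-1})]\sim[c,(t_1,\dots,t_{i-1},\varepsilon,t_i,\dots,t_{n-1})]$ (with the smallest d-structure making the projection map d-paths to d-paths). For $c\in K[n]$, $d^0(c)=(d^0_1)^n(c)$ and $d^1(c)=(d^1_1)^n(c)$ are its initial and final vertices in $K[0]$. $K$ has no loops if there is no non-empty sequence of $1$-cubes $e_1,\dots,e_n$ with $d^1(e_n)=d^0(e_1)$ and $d^1(e_i)=d^0(e_{i+1})$ for $1\le i<n$; equivalently, $|K|$ has no loops. For $c\in K[n]$, $U_c=\{[c;(t_1,\dots,t_n)] : 0<t_i<1 \text{ for all } i\}\subseteq|K|$. For $v\in K[0]$, $V^+_v=\bigcup_{c:\,d^1(c)=v}U_c$ and $V^-_v=\bigcup_{c:\,d^0(c)=v}U_c$, the unions being over all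 cubes $c$ of all dimensions. *)

theory Defs
  imports "HOL-Analysis.Analysis"
begin

section \<open>Cubes, quotients, compact-open topology\<close>

abbreviation unit_interval :: "real topology" where
  "unit_interval \<equiv> top_of_set {0..1}"

text \<open>The cube $[0,1]^n$; a point is a function that is \<^term>\<open>undefined\<close> outside \<open>{1..n}\<close>,
  so that every point has exactly one representation.\<close>

definition cube_topology :: "nat \<Rightarrow> (nat \<Rightarrow> real) topology" where
  "cube_topology n = product_topology (\<lambda>_. unit_interval) {1..n}"

definition quotient_topology :: "'a topology \<Rightarrow> ('a \<Rightarrow> 'b) \<Rightarrow> 'b topology" where
  "quotient_topology X q =
     topology (\<lambda>U. U \<subseteq> q ` topspace X \<and> openin X {x \<in> topspace X. q x \<in> U})"

lemma openin_quotient_topology: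
  "openin (quotient_topology X q) U \<longleftrightarrow>
     U \<subseteq> q ` topspace X \<and> openin X {x \<in> topspace X. q x \<in> U}"
proof -
  have *: "{x \<in> topspace X. q x \<in> S \<inter> T} = {x \<in> topspace X. q x \<in> S} \<inter> {x \<in> topspace X. q x \<in> T}" for S T
    by blast
  have **: "{x \<in> topspace X. q x \<in> \<Union>\<K>} = (\<Union>K\<in>\<K>. {x \<in> topspace X. q x \<in> K})" for \<K>
    by blast
  have "istopology (\<lambda>U. U \<subseteq> q ` topspace X \<and> openin X {x \<in> topspace X. q x \<in> U})"
    unfolding istopology_def * ** by blast
  then show ?thesis
    by (simp add: quotient_topology_def)
qed

lemma topspace_quotient_topology [simp]: "topspace (quotient_topology X q) = q ` topspace X"
proof
  have "{x \<in> topspace X. q x \<in> q ` topspace X} = topspace X" by blast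
  then have "openin (quotient_topology X q) (q ` topspace X)"
    by (simp add: openin_quotient_topology)
  then show "q ` topspace X \<subseteq> topspace (quotient_topology X q)"
    by (rule openin_subset)
qed (metis openin_quotient_topology openin_topspace)

lemma quotient_map_quotient_topology: "quotient_map X (quotient_topology X q) q"
  by (auto simp: quotient_map_def openin_quotient_topology)

text \<open>Continuous maps are represented by functions that are \<^term>\<open>undefined\<close> outside the domain,
  so that distinct points of a mapping space are distinct maps.\<close>

definition mapping_space :: "'a topology \<Rightarrow> 'b topology \<Rightarrow> ('a \<Rightarrow> 'b) set" where
  "mapping_space X Y = {f \<in> extensional (topspace X). continuous_map X Y f}"

definition compact_open_topology :: "'a topology \<Rightarrow> 'b topology \<Rightarrow> ('a \<Rightarrow> 'b) topology" where
  "compact_open_topology X Y =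
     topology_generated_by
       {{f \<in> mapping_space X Y. f ` C \<subseteq> U} | C U. compactin X C \<and> openin Y U}"

lemma topspace_compact_open_topology [simp]:
  "topspace (compact_open_topology X Y) = mapping_space X Y"
proof -
  have "{f \<in> mapping_space X Y. f ` {} \<subseteq> {}} \<in>
      {{f \<in> mapping_space X Y. f ` C \<subseteq> U} | C U. compactin X C \<and> openin Y U}"
    by (intro CollectI exI[of _ "{}"]) auto
  then show ?thesis
    unfolding compact_open_topology_def topology_generated_by_topspace by auto
qed

section \<open>d-spaces\<close>

record 'a dspace =
  dtop :: "'a topology"
  dpaths :: "(real \<Rightarrow> 'a) set"

definition const_path :: "'a \<Rightarrow> real \<Rightarrow> 'a" where
  "const_path x = restrict (\<lambda>_. x) {0..1}"

definition path_concat :: "(real \<Rightarrow> 'a) \<Rightarrow> (real \<Rightarrow> 'a) \<Rightarrow> real \<Rightarrow> 'a" where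
  "path_concat \<alpha> \<beta> = restrict (\<lambda>t. if t \<le> 1/2 then \<alpha> (2 * t) else \<beta> (2 * t - 1)) {0..1}"

definition d_structure :: "'a topology \<Rightarrow> (real \<Rightarrow> 'a) set \<Rightarrow> bool" where
  "d_structure X P \<longleftrightarrow>
     P \<subseteq> mapping_space unit_interval X \<and>
     (\<forall>x\<in>topspace X. const_path x \<in> P) \<and>
     (\<forall>\<alpha>\<in>P. \<forall>\<beta>\<in>P. \<alpha> 1 = \<beta> 0 \<longrightarrow> path_concat \<alpha> \<beta> \<in> P) \<and>
     (\<forall>\<alpha>\<in>P. \<forall>\<phi>. continuous_on {0..1} \<phi> \<and> \<phi> ` {0..1} \<subseteq> {0..1} \<and> mono_on {0..1} \<phi> \<longrightarrow>
        restrict (\<alpha> \<circ> \<phi>) {0..1} \<in> P)"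

definition is_dspace :: "'a dspace \<Rightarrow> bool" where
  "is_dspace X \<longleftrightarrow> d_structure (dtop X) (dpaths X)"

definition dpaths_in :: "'a dspace \<Rightarrow> 'a set \<Rightarrow> (real \<Rightarrow> 'a) set" where
  "dpaths_in X A = {\<alpha> \<in> dpaths X. \<alpha> ` {0..1} \<subseteq> A}"

definition dpaths_between :: "'a dspace \<Rightarrow> 'a set \<Rightarrow> 'a set \<Rightarrow> 'a set \<Rightarrow> (real \<Rightarrow> 'a) set" where
  "dpaths_between X A B C = {\<alpha> \<in> dpaths_in X A. \<alpha> 0 \<in> B \<and> \<alpha> 1 \<in> C}"

definition path_space :: "'a dspace \<Rightarrow> 'a \<Rightarrow> 'a \<Rightarrow> (real \<Rightarrow> 'a) topology" where
  "path_space X x y =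
     subtopology (compact_open_topology unit_interval (dtop X))
       (dpaths_between X (topspace (dtop X)) {x} {y})"

definition reachable :: "'a dspace \<Rightarrow> 'a \<Rightarrow> 'a \<Rightarrow> bool" where
  "reachable X x y \<longleftrightarrow> dpaths_between X (topspace (dtop X)) {x} {y} \<noteq> {}"

definition up_part :: "'a dspace \<Rightarrow> 'a set \<Rightarrow> 'a \<Rightarrow> 'a set" where
  "up_part X A x = {y \<in> A. reachable X x y}"

definition down_part :: "'a dspace \<Rightarrow> 'a set \<Rightarrow> 'a \<Rightarrow> 'a set" where
  "down_part X A x = {y \<in> A. reachable X y x}"

text \<open>The map $\vec P(\alpha,\beta)$. The bracketing of the threefold concatenation is immaterial,
  since equivalence systems are invariant under homotopy.\<close>

definition path_ext :: "(real \<Rightarrow> 'a) \<Rightarrow> (real \<Rightarrow> 'a) \<Rightarrow> (real \<Rightarrow> 'a) \<Rightarrow> real \<Rightarrow> 'a" where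
  "path_ext \<alpha> \<beta> \<omega> = path_concat (path_concat \<alpha> \<omega>) \<beta>"

section \<open>Weak homotopy equivalences\<close>

definition pi0_map :: "'a topology \<Rightarrow> 'b topology \<Rightarrow> ('a \<Rightarrow> 'b) \<Rightarrow> 'a set \<Rightarrow> 'b set" where
  "pi0_map X Y f C = (\<Union>x\<in>C. path_component_of_set Y (f x))"

definition pi0_bijective :: "'a topology \<Rightarrow> 'b topology \<Rightarrow> ('a \<Rightarrow> 'b) \<Rightarrow> bool" where
  "pi0_bijective X Y f \<longleftrightarrow>
     bij_betw (pi0_map X Y f) (path_components_of X) (path_components_of Y)"

definition cube_boundary :: "nat \<Rightarrow> (nat \<Rightarrow> real) set" where
  "cube_boundary n = {t \<in> topspace (cube_topology n). \<exists>k\<in>{1..n}. t k = 0 \<or> t k = 1}"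

definition based_cubes :: "nat \<Rightarrow> 'a topology \<Rightarrow> 'a \<Rightarrow> ((nat \<Rightarrow> real) \<Rightarrow> 'a) set" where
  "based_cubes n X x =
     {g. continuous_map (cube_topology n) X g \<and> (\<forall>t\<in>cube_boundary n. g t = x)}"

definition based_homotopy ::
  "nat \<Rightarrow> 'a topology \<Rightarrow> 'a \<Rightarrow> (((nat \<Rightarrow> real) \<Rightarrow> 'a) \<times> ((nat \<Rightarrow> real) \<Rightarrow> 'a)) set" where
  "based_homotopy n X x =
     {(g, h). homotopic_with (\<lambda>k. \<forall>t\<in>cube_boundary n. k t = x) (cube_topology n) X g h}"

definition homotopy_classes ::
  "nat \<Rightarrow> 'a topology \<Rightarrow> 'a \<Rightarrow> ((nat \<Rightarrow> real) \<Rightarrow> 'a) set set" where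
  "homotopy_classes n X x = based_cubes n X x // based_homotopy n X x"

definition pi_map ::
  "nat \<Rightarrow> 'b topology \<Rightarrow> ('a \<Rightarrow> 'b) \<Rightarrow> 'a \<Rightarrow>
     ((nat \<Rightarrow> real) \<Rightarrow> 'a) set \<Rightarrow> ((nat \<Rightarrow> real) \<Rightarrow> 'b) set" where
  "pi_map n Y f x C = (\<Union>g\<in>C. based_homotopy n Y (f x) `` {f \<circ> g})"

text \<open>The map induced on $\pi_n$ $(n\ge 1)$ is always a group homomorphism, so that it is an
  isomorphism iff it is a bijection of the underlying sets; the group structure itself is
  therefore not needed.\<close>

definition weak_homotopy_equivalence :: "'a topology \<Rightarrow> 'b topology \<Rightarrow> ('a \<Rightarrow> 'b) \<Rightarrow> bool" where
  "weak_homotopy_equivalence X Y f \<longleftrightarrow>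
     continuous_map X Y f \<and>
     pi0_bijective X Y f \<and>
     (\<forall>n\<ge>1. \<forall>x\<in>topspace X.
        bij_betw (pi_map n Y f x) (homotopy_classes n X x) (homotopy_classes n Y (f x)))"

lemma pi0_map_component:
  assumes f: "continuous_map X Y f" and x: "x \<in> topspace X"
  shows "pi0_map X Y f (path_component_of_set X x) = path_component_of_set Y (f x)"
proof -
  have "path_component_of Y (f x) (f z)" if "path_component_of X x z" for z
    using that f unfolding path_component_of_def
    by (metis comp_apply pathin_compose)
  then have "path_component_of_set Y (f z) = path_component_of_set Y (f x)"
    if "path_component_of X x z" for z
    using that path_component_of_equiv[of Y "f x" "f z"] by metis
  moreover have "path_component_of X x x"
    using x by (simp add: path_component_of_refl)
  ultimately show ?thesis
    unfolding pi0_map_def by blast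
qed

lemma equiv_based_homotopy: "equiv (based_cubes n X x) (based_homotopy n X x)"
proof (rule equivI)
  show "based_homotopy n X x \<subseteq> based_cubes n X x \<times> based_cubes n X x"
    unfolding based_homotopy_def based_cubes_def
    using homotopic_with_imp_continuous_maps homotopic_with_imp_property by blast
  show "refl_on (based_cubes n X x) (based_homotopy n X x)"
    by (auto simp: refl_on_def based_homotopy_def based_cubes_def)
  show "sym (based_homotopy n X x)"
    unfolding sym_def based_homotopy_def using homotopic_with_symD by fastforce
  show "trans (based_homotopy n X x)"
    unfolding trans_def based_homotopy_def using homotopic_with_trans by fastforce
qed

lemma pi_map_class:
  assumes f: "continuous_map X Y f" and g: "g \<in> based_cubes n X x"
  shows "pi_map n Y f x (based_homotopy n X x `` {g}) = based_homotopy n Y (f x) `` {f \<circ> g}"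
proof -
  have "(f \<circ> g, f \<circ> h) \<in> based_homotopy n Y (f x)" if "(g, h) \<in> based_homotopy n X x" for h
    using that homotopic_with_compose_continuous_map_left[OF _ f]
    unfolding based_homotopy_def by fastforce
  then have "based_homotopy n Y (f x) `` {f \<circ> h} = based_homotopy n Y (f x) `` {f \<circ> g}"
    if "(g, h) \<in> based_homotopy n X x" for h
    using that equiv_class_eq[OF equiv_based_homotopy] by metis
  moreover have "(g, g) \<in> based_homotopy n X x"
    using equiv_based_homotopy g by (metis equivE refl_onD)
  ultimately show ?thesis
    unfolding pi_map_def by blast
qed

lemma based_cubes_comp:
  "\<lbrakk>continuous_map X Y f; a \<in> based_cubes n X x\<rbrakk> \<Longrightarrow> f \<circ> a \<in> based_cubes n Y (f x)"
  by (auto simp: based_cubes_def intro: continuous_map_compose)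

lemma based_homotopy_class_cong:
  assumes a: "a \<in> based_cubes n X x" and eq: "\<And>u. u \<in> topspace X \<Longrightarrow> \<psi> (\<phi> u) = u"
  shows "based_homotopy n X x `` {\<psi> \<circ> (\<phi> \<circ> a)} = based_homotopy n X x `` {a}"
proof -
  have e: "(\<psi> \<circ> (\<phi> \<circ> a)) t = a t" if "t \<in> topspace (cube_topology n)" for t
    using that a eq by (auto simp: based_cubes_def continuous_map_def)
  have a': "continuous_map (cube_topology n) X a" "\<And>t. t \<in> cube_boundary n \<Longrightarrow> a t = x"
    using a by (auto simp: based_cubes_def)
  have "homotopic_with (\<lambda>k. \<forall>t\<in>cube_boundary n. k t = x) (cube_topology n) X a (\<psi> \<circ> (\<phi> \<circ> a))"
  proof (rule homotopic_with_equal)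
    show "\<forall>t\<in>cube_boundary n. (\<psi> \<circ> (\<phi> \<circ> a)) t = x"
    proof
      fix t assume t: "t \<in> cube_boundary n"
      then have "t \<in> topspace (cube_topology n)" by (simp add: cube_boundary_def)
      with t show "(\<psi> \<circ> (\<phi> \<circ> a)) t = x" using e a'(2) by metis
    qed
    show "\<And>t. t \<in> topspace (cube_topology n) \<Longrightarrow> a t = (\<psi> \<circ> (\<phi> \<circ> a)) t"
      using e by metis
  qed (use a' in auto)
  then have "(a, \<psi> \<circ> (\<phi> \<circ> a)) \<in> based_homotopy n X x"
    by (simp add: based_homotopy_def)
  then show ?thesis
    using equiv_class_eq[OF equiv_based_homotopy] by metis
qed

lemma homeomorphic_map_weak_homotopy_equivalence:
  assumes "homeomorphic_map X Y f"
  shows "weak_homotopy_equivalence X Y f"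
proof -
  obtain g where "homeomorphic_maps X Y f g"
    using assms homeomorphic_map_maps by blast
  then have f: "continuous_map X Y f" and g: "continuous_map Y X g"
    and gf: "\<And>x. x \<in> topspace X \<Longrightarrow> g (f x) = x" and fg: "\<And>y. y \<in> topspace Y \<Longrightarrow> f (g y) = y"
    by (auto simp: homeomorphic_maps_def)
  have fX: "f x \<in> topspace Y" if "x \<in> topspace X" for x
    using f that by (auto simp: continuous_map_def)
  have gY: "g y \<in> topspace X" if "y \<in> topspace Y" for y
    using g that by (auto simp: continuous_map_def)
  have "pi0_bijective X Y f"
    unfolding pi0_bijective_def
  proof (rule bij_betw_byWitness[where f' = "pi0_map Y X g"])
    have pf: "pi0_map X Y f (path_component_of_set X x) = path_component_of_set Y (f x)"
      if "x \<in> topspace X" for x using pi0_map_component[OF f that] .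
    have pg: "pi0_map Y X g (path_component_of_set Y y) = path_component_of_set X (g y)"
      if "y \<in> topspace Y" for y using pi0_map_component[OF g that] .
    have 1: "pi0_map Y X g (pi0_map X Y f (path_component_of_set X x)) = path_component_of_set X x"
      if "x \<in> topspace X" for x
      using pf[OF that] pg[OF fX[OF that]] gf[OF that] by argo
    have 2: "pi0_map X Y f (pi0_map Y X g (path_component_of_set Y y)) = path_component_of_set Y y"
      if "y \<in> topspace Y" for y
      using pg[OF that] pf[OF gY[OF that]] fg[OF that] by argo
    show "\<forall>C\<in>path_components_of X. pi0_map Y X g (pi0_map X Y f C) = C"
      unfolding path_components_of_def by (intro ballI, elim imageE, hypsubst, rule 1)
    show "\<forall>C\<in>path_components_of Y. pi0_map X Y f (pi0_map Y X g C) = C"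
      unfolding path_components_of_def by (intro ballI, elim imageE, hypsubst, rule 2)
    show "pi0_map X Y f ` path_components_of X \<subseteq> path_components_of Y"
      unfolding path_components_of_def
      by (intro image_subsetI, elim imageE, hypsubst, subst pf) (auto intro: fX)
    show "pi0_map Y X g ` path_components_of Y \<subseteq> path_components_of X"
      unfolding path_components_of_def
      by (intro image_subsetI, elim imageE, hypsubst, subst pg) (auto intro: gY)
  qed
  moreover have "bij_betw (pi_map n Y f x) (homotopy_classes n X x) (homotopy_classes n Y (f x))"
    if x: "x \<in> topspace X" for n x
  proof -
    let ?BX = "based_cubes n X x" and ?BY = "based_cubes n Y (f x)"
    let ?RX = "based_homotopy n X x" and ?RY = "based_homotopy n Y (f x)"
    have cf: "f \<circ> a \<in> ?BY" if "a \<in> ?BX" for a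
      using based_cubes_comp[OF f that] .
    have cg: "g \<circ> a \<in> ?BX" if "a \<in> ?BY" for a
      using based_cubes_comp[OF g that] by (simp only: gf[OF x])
    have pf: "pi_map n Y f x (?RX `` {a}) = ?RY `` {f \<circ> a}" if "a \<in> ?BX" for a
      using pi_map_class[OF f that] .
    have pg: "pi_map n X g (f x) (?RY `` {a}) = ?RX `` {g \<circ> a}" if "a \<in> ?BY" for a
      using pi_map_class[OF g that] by (simp only: gf[OF x])
    have gf': "?RX `` {g \<circ> (f \<circ> a)} = ?RX `` {a}" if "a \<in> ?BX" for a
      using based_homotopy_class_cong[OF that] gf by blast
    have fg': "?RY `` {f \<circ> (g \<circ> a)} = ?RY `` {a}" if "a \<in> ?BY" for a
      using based_homotopy_class_cong[OF that] fg by blast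
    show ?thesis
      unfolding homotopy_classes_def
    proof (rule bij_betw_byWitness[where f' = "pi_map n X g (f x)"])
      have 1: "pi_map n X g (f x) (pi_map n Y f x (?RX `` {a})) = ?RX `` {a}" if "a \<in> ?BX" for a
        using pf[OF that] pg[OF cf[OF that]] gf'[OF that] by argo
      have 2: "pi_map n Y f x (pi_map n X g (f x) (?RY `` {a})) = ?RY `` {a}" if "a \<in> ?BY" for a
        using pg[OF that] pf[OF cg[OF that]] fg'[OF that] by argo
      show "\<forall>C\<in>?BX // ?RX. pi_map n X g (f x) (pi_map n Y f x C) = C"
        by (intro ballI, elim quotientE, hypsubst, rule 1)
      show "\<forall>C\<in>?BY // ?RY. pi_map n Y f x (pi_map n X g (f x) C) = C"
        by (intro ballI, elim quotientE, hypsubst, rule 2)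
      show "pi_map n Y f x ` (?BX // ?RX) \<subseteq> ?BY // ?RY"
        by (intro image_subsetI, elim quotientE, hypsubst, subst pf) (auto intro: quotientI cf)
      show "pi_map n X g (f x) ` (?BY // ?RY) \<subseteq> ?BX // ?RX"
        by (intro image_subsetI, elim quotientE, hypsubst, subst pg) (auto intro: quotientI cg)
    qed
  qed
  ultimately show ?thesis
    using f by (simp add: weak_homotopy_equivalence_def)
qed

section \<open>Equivalence systems\<close>

text \<open>
  HOL has no type of all topological spaces. The category of spaces is represented by
  the spaces whose points lie in an arbitrary type \<open>'u\<close>, which serves as the universe; a family of
  morphisms is a predicate \<open>F X Y f\<close>. A map between spaces over other types (a path space, a
  product, a coproduct, a one-point space) belongs to the family if it is homeomorphic, as a
  map, to a member of \<open>F\<close>; for an equivalence system this does not depend on the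
  homeomorphic copies chosen and on \<open>'u\<close> itself it adds nothing: see
  \<open>equivalence_system_copy_iff\<close> and \<open>equivalence_system_in_family_iff\<close> below.
  The universe has to be large enough to contain copies of the spaces in question; for the path
  spaces of a d-space over \<open>'a\<close> it suffices that \<open>real \<Rightarrow> 'a\<close> injects into \<open>'u\<close>. An
  equivalence system on a larger universe restricts to one on any infinite smaller universe.
\<close>

type_synonym 'u family = "'u topology \<Rightarrow> 'u topology \<Rightarrow> ('u \<Rightarrow> 'u) \<Rightarrow> bool"

definition is_copy ::
  "'u topology \<Rightarrow> 'u topology \<Rightarrow> ('u \<Rightarrow> 'u) \<Rightarrow> 'a topology \<Rightarrow> 'b topology \<Rightarrow> ('a \<Rightarrow> 'b) \<Rightarrow> bool" where
  "is_copy X' Y' f' X Y f \<longleftrightarrow>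
     (\<exists>p q. homeomorphic_map X X' p \<and> homeomorphic_map Y Y' q \<and>
       (\<forall>x\<in>topspace X. f x \<in> topspace Y \<and> f' (p x) = q (f x)))"

definition in_family :: "'u family \<Rightarrow> 'a topology \<Rightarrow> 'b topology \<Rightarrow> ('a \<Rightarrow> 'b) \<Rightarrow> bool" where
  "in_family F X Y f \<longleftrightarrow> (\<exists>X' Y' f'. is_copy X' Y' f' X Y f \<and> F X' Y' f')"

definition two_out_of_three :: "'u family \<Rightarrow> bool" where
  "two_out_of_three F \<longleftrightarrow>
     (\<forall>X Y Z f g. continuous_map X Y f \<and> continuous_map Y Z g \<longrightarrow>
        (F X Y f \<and> F Y Z g \<longrightarrow> F X Z (g \<circ> f)) \<and>
        (F X Y f \<and> F X Z (g \<circ> f) \<longrightarrow> F Y Z g) \<and>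
        (F Y Z g \<and> F X Z (g \<circ> f) \<longrightarrow> F X Y f))"

definition equivalence_system :: "'u family \<Rightarrow> bool" where
  "equivalence_system F \<longleftrightarrow>
     (\<forall>X Y f. F X Y f \<longrightarrow> continuous_map X Y f) \<and>
     two_out_of_three F \<and>
     (\<forall>X Y f g. homotopic_with (\<lambda>_. True) X Y f g \<longrightarrow> (F X Y f \<longleftrightarrow> F X Y g)) \<and>
     (\<forall>X Y f. weak_homotopy_equivalence X Y f \<longrightarrow> F X Y f) \<and>
     (\<forall>X Y f. F X Y f \<longrightarrow> pi0_bijective X Y f) \<and>
     (\<forall>(I::nat set) X Y f. finite I \<and> (\<forall>i\<in>I. continuous_map (X i) (Y i) (f i)) \<longrightarrow>
        (in_family F (sum_topology X I) (sum_topology Y I) (\<lambda>(i, x). (i, f i x)) \<longleftrightarrow>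
         (\<forall>i\<in>I. F (X i) (Y i) (f i)))) \<and>
     (\<forall>X Y f X' Y' f'. F X Y f \<and> F X' Y' f' \<longrightarrow>
        in_family F (prod_topology X X') (prod_topology Y Y') (map_prod f f'))"

lemma equivalence_systemD:
  assumes "equivalence_system F"
  shows "F X Y f \<Longrightarrow> continuous_map X Y f"
    and "two_out_of_three F"
    and "homotopic_with (\<lambda>_. True) X Y f g \<Longrightarrow> F X Y f \<longleftrightarrow> F X Y g"
    and "weak_homotopy_equivalence X Y f \<Longrightarrow> F X Y f"
proof -
  note * = assms[unfolded equivalence_system_def]
  show "F X Y f \<Longrightarrow> continuous_map X Y f" using *[THEN conjunct1] by iprover
  show "two_out_of_three F" using * by (elim conjE)
  show "homotopic_with (\<lambda>_. True) X Y f g \<Longrightarrow> F X Y f \<longleftrightarrow> F X Y g"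
    using *[THEN conjunct2, THEN conjunct2, THEN conjunct1] by iprover
  show "weak_homotopy_equivalence X Y f \<Longrightarrow> F X Y f"
    using *[THEN conjunct2, THEN conjunct2, THEN conjunct2, THEN conjunct1] by iprover
qed

lemma equivalence_system_homeomorphic_map:
  "\<lbrakk>equivalence_system F; homeomorphic_map X Y f\<rbrakk> \<Longrightarrow> F X Y f"
  by (rule equivalence_systemD(4)[OF _ homeomorphic_map_weak_homotopy_equivalence])

lemma equivalence_system_copy_imp:
  assumes F: "equivalence_system F" and 1: "is_copy X1 Y1 f1 X Y f" and 2: "is_copy X2 Y2 f2 X Y f"
    and F1: "F X1 Y1 f1"
  shows "F X2 Y2 f2"
proof -
  obtain p1 q1 where pq1: "homeomorphic_map X X1 p1" "homeomorphic_map Y Y1 q1"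
    "\<And>x. x \<in> topspace X \<Longrightarrow> f x \<in> topspace Y \<and> f1 (p1 x) = q1 (f x)"
    using 1 unfolding is_copy_def by blast
  obtain p2 q2 where pq2: "homeomorphic_map X X2 p2" "homeomorphic_map Y Y2 q2"
    "\<And>x. x \<in> topspace X \<Longrightarrow> f2 (p2 x) = q2 (f x)"
    using 2 unfolding is_copy_def by blast
  obtain p1' where p1': "homeomorphic_maps X X1 p1 p1'" using pq1 homeomorphic_map_maps by blast
  obtain q1' where q1': "homeomorphic_maps Y Y1 q1 q1'" using pq1 homeomorphic_map_maps by blast
  obtain p2' where p2': "homeomorphic_maps X X2 p2 p2'" using pq2 homeomorphic_map_maps by blast
  let ?u = "p2 \<circ> p1'" and ?v = "q2 \<circ> q1'"
  have u: "homeomorphic_map X1 X2 ?u"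
    using p1' pq2(1) homeomorphic_map_compose homeomorphic_maps_map by blast
  have v: "homeomorphic_map Y1 Y2 ?v"
    using q1' pq2(2) homeomorphic_map_compose homeomorphic_maps_map by blast
  have Fu: "F X1 X2 ?u" and Fv: "F Y1 Y2 ?v"
    using equivalence_system_homeomorphic_map[OF F] u v by blast+
  have cu: "continuous_map X1 X2 ?u" and cv: "continuous_map Y1 Y2 ?v"
    using u v homeomorphic_imp_continuous_map by blast+
  have c1: "continuous_map X1 Y1 f1" using equivalence_systemD(1)[OF F F1] .
  have eq: "?v (f1 y) = f2 (?u y)" if "y \<in> topspace X1" for y
  proof -
    have x: "p1' y \<in> topspace X" "p1 (p1' y) = y"
      using p1' that by (auto simp: homeomorphic_maps_def continuous_map_def)
    have "f1 y = q1 (f (p1' y))" using pq1(3)[OF x(1)] x(2) by simp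
    moreover have "q1' (q1 (f (p1' y))) = f (p1' y)"
      using q1' pq1(3)[OF x(1)] by (auto simp: homeomorphic_maps_def)
    ultimately show ?thesis using pq2(3)[OF x(1)] by simp
  qed
  have cvf: "continuous_map X1 Y2 (?v \<circ> f1)" using c1 cv continuous_map_compose by blast
  have "continuous_map X2 Y2 ((?v \<circ> f1) \<circ> (p1 \<circ> p2'))"
    by (intro continuous_map_compose[OF _ cvf] continuous_map_compose[of _ X])
      (use p1' p2' in \<open>auto simp: homeomorphic_maps_def\<close>)
  then have c2: "continuous_map X2 Y2 f2"
  proof (rule continuous_map_eq)
    fix z assume z: "z \<in> topspace X2"
    have w: "p2' z \<in> topspace X" "p2 (p2' z) = z"
      using p2' z by (auto simp: homeomorphic_maps_def continuous_map_def)
    have "p1 (p2' z) \<in> topspace X1" "p1' (p1 (p2' z)) = p2' z"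
      using p1' w by (auto simp: homeomorphic_maps_def continuous_map_def)
    then show "((?v \<circ> f1) \<circ> (p1 \<circ> p2')) z = f2 z" using eq w by simp
  qed
  have tot: "two_out_of_three F" using equivalence_systemD(2)[OF F] .
  have "F X1 Y2 (?v \<circ> f1)"
    using tot c1 cv F1 Fv unfolding two_out_of_three_def by blast
  moreover have "homotopic_with (\<lambda>_. True) X1 Y2 (?v \<circ> f1) (f2 \<circ> ?u)"
    by (rule homotopic_with_equal) (use eq cvf in auto)
  ultimately have "F X1 Y2 (f2 \<circ> ?u)"
    using equivalence_systemD(3)[OF F] by blast
  then show ?thesis
    using tot cu c2 Fu unfolding two_out_of_three_def by blast
qed

lemma equivalence_system_copy_iff:
  assumes "equivalence_system F" "is_copy X1 Y1 f1 X Y f" "is_copy X2 Y2 f2 X Y f"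
  shows "F X1 Y1 f1 \<longleftrightarrow> F X2 Y2 f2"
  using assms equivalence_system_copy_imp by blast

lemma equivalence_system_in_family_iff:
  assumes F: "equivalence_system F"
  shows "in_family F X Y f \<longleftrightarrow> F X Y f"
proof
  assume "F X Y f"
  then have "continuous_map X Y f" by (rule equivalence_systemD(1)[OF F])
  then have "is_copy X Y f X Y f"
    unfolding is_copy_def by (intro exI[of _ id]) (auto simp: continuous_map_def)
  with \<open>F X Y f\<close> show "in_family F X Y f" unfolding in_family_def by blast
next
  assume "in_family F X Y f"
  then obtain X' Y' f' where *: "is_copy X' Y' f' X Y f" "F X' Y' f'"
    unfolding in_family_def by blast
  then have "is_copy X Y f X Y f"
    unfolding is_copy_def by (intro exI[of _ id]) auto
  with * show "F X Y f" using equivalence_system_copy_imp[OF F] by blast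
qed

definition F_contractible :: "'u family \<Rightarrow> 'a topology \<Rightarrow> bool" where
  "F_contractible F Y \<longleftrightarrow> in_family F Y (discrete_topology {()}) (\<lambda>_. ())"

section \<open>Stability and component systems\<close>

definition d_convex :: "'a dspace \<Rightarrow> 'a set \<Rightarrow> bool" where
  "d_convex X A \<longleftrightarrow> dpaths_between X A A A = dpaths_between X (topspace (dtop X)) A A"

definition future_connected :: "'a dspace \<Rightarrow> 'a set \<Rightarrow> bool" where
  "future_connected X A \<longleftrightarrow>
     (\<forall>x\<in>A. \<forall>y\<in>A. \<exists>z\<in>A. dpaths_between X A {x} {z} \<noteq> {} \<and> dpaths_between X A {y} {z} \<noteq> {})"

definition past_connected :: "'a dspace \<Rightarrow> 'a set \<Rightarrow> bool" where
  "past_connected X A \<longleftrightarrow>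
     (\<forall>x\<in>A. \<forall>y\<in>A. \<exists>z\<in>A. dpaths_between X A {z} {x} \<noteq> {} \<and> dpaths_between X A {z} {y} \<noteq> {})"

definition path_ext_in_family ::
  "'u family \<Rightarrow> 'a dspace \<Rightarrow> (real \<Rightarrow> 'a) \<Rightarrow> (real \<Rightarrow> 'a) \<Rightarrow> bool" where
  "path_ext_in_family F X \<alpha> \<beta> \<longleftrightarrow>
     in_family F (path_space X (\<alpha> 1) (\<beta> 0)) (path_space X (\<alpha> 0) (\<beta> 1)) (path_ext \<alpha> \<beta>)"

definition St_plus :: "'u family \<Rightarrow> 'a dspace \<Rightarrow> (real \<Rightarrow> 'a) \<Rightarrow> 'a set \<Rightarrow> 'a set" where
  "St_plus F X \<alpha> A = {z \<in> A. \<forall>\<beta>\<in>dpaths_in X (up_part X A z). path_ext_in_family F X \<alpha> \<beta>}"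

definition St_minus :: "'u family \<Rightarrow> 'a dspace \<Rightarrow> 'a set \<Rightarrow> (real \<Rightarrow> 'a) \<Rightarrow> 'a set" where
  "St_minus F X A \<alpha> = {z \<in> A. \<forall>\<beta>\<in>dpaths_in X (down_part X A z). path_ext_in_family F X \<beta> \<alpha>}"

definition future_stable :: "'u family \<Rightarrow> 'a dspace \<Rightarrow> 'a set \<Rightarrow> 'a set \<Rightarrow> bool" where
  "future_stable F X A B \<longleftrightarrow>
     future_connected X A \<and> future_connected X B \<and>
     (\<forall>\<alpha>\<in>dpaths_in X A. St_plus F X \<alpha> B \<noteq> {})"

definition past_stable :: "'u family \<Rightarrow> 'a dspace \<Rightarrow> 'a set \<Rightarrow> 'a set \<Rightarrow> bool" where
  "past_stable F X A B \<longleftrightarrow>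
     past_connected X A \<and> past_connected X B \<and>
     (\<forall>\<beta>\<in>dpaths_in X B. St_minus F X A \<beta> \<noteq> {})"

definition totally_stable :: "'u family \<Rightarrow> 'a dspace \<Rightarrow> 'a set \<Rightarrow> 'a set \<Rightarrow> bool" where
  "totally_stable F X A B \<longleftrightarrow>
     future_stable F X A B \<and> past_stable F X A B \<and>
     (\<exists>a\<in>A. \<exists>b\<in>B. b \<in> St_plus F X (const_path a) B \<and> a \<in> St_minus F X A (const_path b))"

text \<open>The stable path spaces are only defined up to \<open>F\<close>-equivalence, so we collect all the
  spaces that may be chosen; a property is required of every choice. For nonempty
  \<open>A\<close> and a stable pair there is at least one choice.\<close>

definition SP_plus :: "'u family \<Rightarrow> 'a dspace \<Rightarrow> 'a set \<Rightarrow> 'a set \<Rightarrow> (real \<Rightarrow> 'a) topology set" where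
  "SP_plus F X A B = {path_space X a z | a z. a \<in> A \<and> z \<in> St_plus F X (const_path a) B}"

definition SP_minus :: "'u family \<Rightarrow> 'a dspace \<Rightarrow> 'a set \<Rightarrow> 'a set \<Rightarrow> (real \<Rightarrow> 'a) topology set" where
  "SP_minus F X A B = {path_space X z b | z b. b \<in> B \<and> z \<in> St_minus F X A (const_path b)}"

definition future_trivial :: "'u family \<Rightarrow> 'a dspace \<Rightarrow> 'a set \<Rightarrow> bool" where
  "future_trivial F X A \<longleftrightarrow>
     future_stable F X A A \<and> (\<forall>Y\<in>SP_plus F X A A. F_contractible F Y)"

definition past_trivial :: "'u family \<Rightarrow> 'a dspace \<Rightarrow> 'a set \<Rightarrow> bool" where
  "past_trivial F X A \<longleftrightarrow>
     past_stable F X A A \<and> (\<forall>Y\<in>SP_minus F X A A. F_contractible F Y)"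

definition disjoint_cover :: "'a set \<Rightarrow> 'i set \<Rightarrow> ('i \<Rightarrow> 'a set) \<Rightarrow> bool" where
  "disjoint_cover S I A \<longleftrightarrow> disjoint_family_on A I \<and> (\<Union>i\<in>I. A i) = S"

definition stable_future_component_system ::
  "'u family \<Rightarrow> 'a dspace \<Rightarrow> 'i set \<Rightarrow> ('i \<Rightarrow> 'a set) \<Rightarrow> bool" where
  "stable_future_component_system F X I A \<longleftrightarrow>
     disjoint_cover (topspace (dtop X)) I A \<and>
     (\<forall>i\<in>I. d_convex X (A i) \<and> future_connected X (A i) \<and> future_trivial F X (A i)) \<and>
     (\<forall>i\<in>I. \<forall>j\<in>I. future_stable F X (A i) (A j))"

definition stable_past_component_system ::
  "'u family \<Rightarrow> 'a dspace \<Rightarrow> 'i set \<Rightarrow> ('i \<Rightarrow> 'a set) \<Rightarrow> bool" where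
  "stable_past_component_system F X I A \<longleftrightarrow>
     disjoint_cover (topspace (dtop X)) I A \<and>
     (\<forall>i\<in>I. d_convex X (A i) \<and> past_connected X (A i) \<and> past_trivial F X (A i)) \<and>
     (\<forall>i\<in>I. \<forall>j\<in>I. past_stable F X (A i) (A j))"

definition stable_total_component_system ::
  "'u family \<Rightarrow> 'a dspace \<Rightarrow> 'i set \<Rightarrow> ('i \<Rightarrow> 'a set) \<Rightarrow> bool" where
  "stable_total_component_system F X I A \<longleftrightarrow>
     stable_future_component_system F X I A \<and>
     stable_past_component_system F X I A \<and>
     (\<forall>i\<in>I. \<forall>j\<in>I. totally_stable F X (A i) (A j))"

section \<open>Pre-cubical sets and their realization\<close>

text \<open>\<open>face K \<epsilon> i\<close> is $d^\varepsilon_i$, where \<open>False\<close> stands for $\varepsilon=0$ and \<open>True\<close> for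
  $\varepsilon=1$. As the sets \<open>cells K n\<close> are disjoint, the dimension of the argument need not be
  recorded.\<close>

record 'c precubical =
  cells :: "nat \<Rightarrow> 'c set"
  face :: "bool \<Rightarrow> nat \<Rightarrow> 'c \<Rightarrow> 'c"

definition precubical_set :: "'c precubical \<Rightarrow> bool" where
  "precubical_set K \<longleftrightarrow>
     disjoint_family (cells K) \<and>
     (\<forall>n \<epsilon> i. \<forall>c\<in>cells K n. 1 \<le> i \<and> i \<le> n \<longrightarrow> face K \<epsilon> i c \<in> cells K (n - 1)) \<and>
     (\<forall>n \<epsilon> \<eta> i j. \<forall>c\<in>cells K n. 1 \<le> i \<and> i < j \<and> j \<le> n \<longrightarrow>
        face K \<epsilon> i (face K \<eta> j c) = face K \<eta> (j - 1) (face K \<epsilon> i c))"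

definition cubes :: "'c precubical \<Rightarrow> 'c set" where
  "cubes K = (\<Union>n. cells K n)"

definition cube_dim :: "'c precubical \<Rightarrow> 'c \<Rightarrow> nat" where
  "cube_dim K c = (THE n. c \<in> cells K n)"

definition extreme_vertex :: "'c precubical \<Rightarrow> bool \<Rightarrow> 'c \<Rightarrow> 'c" where
  "extreme_vertex K \<epsilon> c = (face K \<epsilon> 1 ^^ cube_dim K c) c"

definition precubical_no_loops :: "'c precubical \<Rightarrow> bool" where
  "precubical_no_loops K \<longleftrightarrow>
     \<not> (\<exists>es. es \<noteq> [] \<and> set es \<subseteq> cells K 1 \<and>
          extreme_vertex K True (last es) = extreme_vertex K False (hd es) \<and>
          (\<forall>i. Suc i < length es \<longrightarrow>
             extreme_vertex K True (es ! i) = extreme_vertex K False (es ! Suc i)))"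

definition directed_cube :: "nat \<Rightarrow> (nat \<Rightarrow> real) dspace" where
  "directed_cube n =
     \<lparr>dtop = cube_topology n,
      dpaths = {\<gamma> \<in> mapping_space unit_interval (cube_topology n).
                  \<forall>k\<in>{1..n}. mono_on {0..1} (\<lambda>s. \<gamma> s k)}\<rparr>"

text \<open>A path in a coproduct stays in one summand, so the d-paths of a coproduct are those of the
  summands.\<close>

definition sum_dspace :: "('i \<Rightarrow> 'a dspace) \<Rightarrow> 'i set \<Rightarrow> ('i \<times> 'a) dspace" where
  "sum_dspace X I =
     \<lparr>dtop = sum_topology (\<lambda>i. dtop (X i)) I,
      dpaths = {restrict (\<lambda>s. (i, \<gamma> s)) {0..1} | i \<gamma>. i \<in> I \<and> \<gamma> \<in> dpaths (X i)}\<rparr>"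

definition quotient_dspace :: "'a dspace \<Rightarrow> ('a \<Rightarrow> 'b) \<Rightarrow> 'b dspace" where
  "quotient_dspace X q =
     \<lparr>dtop = quotient_topology (dtop X) q,
      dpaths = \<Inter>{P. d_structure (quotient_topology (dtop X) q) P \<and>
                    (\<forall>\<gamma>\<in>dpaths X. restrict (q \<circ> \<gamma>) {0..1} \<in> P)}\<rparr>"

definition insert_coord :: "nat \<Rightarrow> nat \<Rightarrow> real \<Rightarrow> (nat \<Rightarrow> real) \<Rightarrow> nat \<Rightarrow> real" where
  "insert_coord n i e t =
     restrict (\<lambda>k. if k < i then t k else if k = i then e else t (k - 1)) {1..n}"

definition cube_sum :: "'c precubical \<Rightarrow> ('c \<times> (nat \<Rightarrow> real)) dspace" where
  "cube_sum K = sum_dspace (\<lambda>c. directed_cube (cube_dim K c)) (cubes K)"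

definition glue :: "'c precubical \<Rightarrow> 'c \<times> (nat \<Rightarrow> real) \<Rightarrow> 'c \<times> (nat \<Rightarrow> real) \<Rightarrow> bool" where
  "glue K p p' \<longleftrightarrow>
     (\<exists>n c i \<epsilon> t. c \<in> cells K n \<and> 1 \<le> i \<and> i \<le> n \<and> t \<in> topspace (cube_topology (n - 1)) \<and>
        p = (face K \<epsilon> i c, t) \<and> p' = (c, insert_coord n i (of_bool \<epsilon>) t))"

definition realization_class ::
  "'c precubical \<Rightarrow> 'c \<times> (nat \<Rightarrow> real) \<Rightarrow> ('c \<times> (nat \<Rightarrow> real)) set" where
  "realization_class K p = Collect (equivclp (glue K) p)"

definition realization :: "'c precubical \<Rightarrow> ('c \<times> (nat \<Rightarrow> real)) set dspace" where
  "realization K = quotient_dspace (cube_sum K) (realization_class K)"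

definition open_cell :: "'c precubical \<Rightarrow> 'c \<Rightarrow> ('c \<times> (nat \<Rightarrow> real)) set set" where
  "open_cell K c =
     {realization_class K (c, t) | t.
        t \<in> topspace (cube_topology (cube_dim K c)) \<and> (\<forall>k\<in>{1..cube_dim K c}. 0 < t k \<and> t k < 1)}"

definition V_plus :: "'c precubical \<Rightarrow> 'c \<Rightarrow> ('c \<times> (nat \<Rightarrow> real)) set set" where
  "V_plus K v = (\<Union>c\<in>{c \<in> cubes K. extreme_vertex K True c = v}. open_cell K c)"

definition V_minus :: "'c precubical \<Rightarrow> 'c \<Rightarrow> ('c \<times> (nat \<Rightarrow> real)) set set" where
  "V_minus K v = (\<Union>c\<in>{c \<in> cubes K. extreme_vertex K False c = v}. open_cell K c)"

lemma cube_dim_eq: "\<lbrakk>precubical_set K; c \<in> cells K n\<rbrakk> \<Longrightarrow> cube_dim K c = n"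
  unfolding cube_dim_def precubical_set_def disjoint_family_on_def
  by (intro the_equality) auto

lemma d_structure_mapping_space: "d_structure X (mapping_space unit_interval X)"
proof -
  have conc: "path_concat \<alpha> \<beta> \<in> mapping_space unit_interval X"
    if "\<alpha> \<in> mapping_space unit_interval X" "\<beta> \<in> mapping_space unit_interval X" "\<alpha> 1 = \<beta> 0"
    for \<alpha> \<beta>
  proof -
    have a: "continuous_map unit_interval X \<alpha>" and b: "continuous_map unit_interval X \<beta>"
      using that by (auto simp: mapping_space_def)
    have "continuous_map unit_interval X (\<lambda>t. if t \<le> 1/2 then \<alpha> (2 * t) else \<beta> (2 * t - 1))"
    proof (rule continuous_map_cases_le)
      show "continuous_map (subtopology unit_interval {x \<in> topspace unit_interval. x \<le> 1/2}) X (\<lambda>t. \<alpha> (2 * t))"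
        by (rule continuous_map_compose[OF _ a, unfolded o_def])
           (auto simp: continuous_map_in_subtopology subtopology_subtopology intro!: continuous_intros)
      show "continuous_map (subtopology unit_interval {x \<in> topspace unit_interval. 1/2 \<le> x}) X (\<lambda>t. \<beta> (2 * t - 1))"
        by (rule continuous_map_compose[OF _ b, unfolded o_def])
           (auto simp: continuous_map_in_subtopology subtopology_subtopology intro!: continuous_intros)
      show "\<alpha> (2 * t) = \<beta> (2 * t - 1)" if "t \<in> topspace unit_interval" "t = 1/2" for t
        unfolding that(2) using \<open>\<alpha> 1 = \<beta> 0\<close> by simp
    qed auto
    then have "continuous_map unit_interval X (path_concat \<alpha> \<beta>)"
      by (rule continuous_map_eq) (auto simp: path_concat_def)
    then show ?thesis
      by (auto simp: mapping_space_def path_concat_def)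
  qed
  have rep: "restrict (\<alpha> \<circ> \<phi>) {0..1} \<in> mapping_space unit_interval X"
    if "\<alpha> \<in> mapping_space unit_interval X" "continuous_on {0..1} \<phi>" "\<phi> ` {0..1} \<subseteq> {0..1}" for \<alpha> \<phi>
  proof -
    have "continuous_map unit_interval X (\<alpha> \<circ> \<phi>)"
      using that by (intro continuous_map_compose[of _ unit_interval])
        (auto simp: mapping_space_def image_subset_iff_funcset)
    then have "continuous_map unit_interval X (restrict (\<alpha> \<circ> \<phi>) {0..1})"
      by (rule continuous_map_eq) auto
    then show ?thesis by (auto simp: mapping_space_def)
  qed
  have cst: "const_path x \<in> mapping_space unit_interval X" if "x \<in> topspace X" for x
  proof -
    have "continuous_map unit_interval X (\<lambda>_. x)" using that by simp
    then have "continuous_map unit_interval X (const_path x)"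
      by (rule continuous_map_eq) (auto simp: const_path_def)
    then show ?thesis by (auto simp: mapping_space_def const_path_def)
  qed
  show ?thesis
    unfolding d_structure_def using conc rep cst by blast
qed

lemma is_dspace_quotient:
  assumes "is_dspace X"
  shows "is_dspace (quotient_dspace X q)"
proof -
  let ?T = "quotient_topology (dtop X) q"
  let ?S = "{P. d_structure ?T P \<and> (\<forall>\<gamma>\<in>dpaths X. restrict (q \<circ> \<gamma>) {0..1} \<in> P)}"
  have "restrict (q \<circ> \<gamma>) {0..1} \<in> mapping_space unit_interval ?T" if "\<gamma> \<in> dpaths X" for \<gamma>
  proof -
    have "continuous_map unit_interval (dtop X) \<gamma>"
      using that assms by (auto simp: is_dspace_def d_structure_def mapping_space_def)
    then have "continuous_map unit_interval ?T (q \<circ> \<gamma>)"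
      using quotient_imp_continuous_map[OF quotient_map_quotient_topology] continuous_map_compose by blast
    then have "continuous_map unit_interval ?T (restrict (q \<circ> \<gamma>) {0..1})"
      by (rule continuous_map_eq) auto
    then show ?thesis by (auto simp: mapping_space_def)
  qed
  then have "mapping_space unit_interval ?T \<in> ?S"
    using d_structure_mapping_space by blast
  then have 1: "\<Inter>?S \<subseteq> mapping_space unit_interval ?T" by blast
  have "d_structure ?T (\<Inter>?S)"
    unfolding d_structure_def[of _ "\<Inter>?S"]
  proof (intro conjI ballI allI impI 1 InterI)
  qed (auto simp: d_structure_def)
  then show ?thesis
    by (simp add: is_dspace_def quotient_dspace_def)
qed

lemma is_dspace_directed_cube: "is_dspace (directed_cube n)"
proof -
  let ?M = "mapping_space unit_interval (cube_topology n)"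
  have M: "d_structure (cube_topology n) ?M"
    by (rule d_structure_mapping_space)
  have "mono_on {0..1} (\<lambda>s. path_concat \<alpha> \<beta> s k)"
    if "mono_on {0..1} (\<lambda>s. \<alpha> s k)" "mono_on {0..1} (\<lambda>s. \<beta> s k)" "\<alpha> 1 = \<beta> 0"
    for \<alpha> \<beta> :: "real \<Rightarrow> nat \<Rightarrow> real" and k
  proof (rule mono_onI)
    fix r s :: real assume rs: "r \<in> {0..1}" "s \<in> {0..1}" "r \<le> s"
    have a: "\<alpha> x k \<le> \<alpha> y k" "\<beta> x k \<le> \<beta> y k" if "0 \<le> x" "x \<le> y" "y \<le> 1" for x y
      using mono_onD[OF \<open>mono_on {0..1} (\<lambda>s. \<alpha> s k)\<close>, of x y]
        mono_onD[OF \<open>mono_on {0..1} (\<lambda>s. \<beta> s k)\<close>, of x y] that by auto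
    have "\<alpha> (2 * r) k \<le> \<beta> (2 * s-1) k" if "r \<le> 1/2" "1/2 < s"
      using a(1)[of "2 * r" 1] a(2)[of 0 "2 * s-1"] that rs \<open>\<alpha> 1 = \<beta> 0\<close> by auto
    then show "path_concat \<alpha> \<beta> r k \<le> path_concat \<alpha> \<beta> s k"
      using rs a by (auto simp: path_concat_def)
  qed
  moreover have "mono_on {0..1} (\<lambda>s. restrict (\<alpha> \<circ> \<phi>) {0..1} s k)"
    if "mono_on {0..1} (\<lambda>s. \<alpha> s k)" "\<phi> ` {0..1} \<subseteq> {0..1}" "mono_on {0..1} \<phi>"
    for \<alpha> :: "real \<Rightarrow> nat \<Rightarrow> real" and \<phi> :: "real \<Rightarrow> real" and k
    using that unfolding mono_on_def by (auto simp: image_subset_iff)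
  moreover have "mono_on {0..1} (\<lambda>s. const_path x s k)" for x :: "nat \<Rightarrow> real" and k
    by (auto simp: mono_on_def const_path_def)
  ultimately show ?thesis
    using M unfolding is_dspace_def directed_cube_def d_structure_def by simp
qed

lemma is_dspace_sum:
  assumes "\<And>i. i \<in> I \<Longrightarrow> is_dspace (X i)"
  shows "is_dspace (sum_dspace X I)"
proof -
  have D: "d_structure (dtop (X i)) (dpaths (X i))" if "i \<in> I" for i
    using assms that by (simp add: is_dspace_def)
  let ?T = "sum_topology (\<lambda>i. dtop (X i)) I"
  let ?P = "{restrict (\<lambda>s. (i, \<gamma> s)) {0..1} | i \<gamma>. i \<in> I \<and> \<gamma> \<in> dpaths (X i)}"
  have "d_structure ?T ?P"
    unfolding d_structure_def[of _ ?P]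
  proof (intro conjI ballI allI impI subsetI; (elim conjE)?)
    fix \<alpha> assume "\<alpha> \<in> ?P"
    then obtain i \<gamma> where i: "i \<in> I" "\<gamma> \<in> dpaths (X i)" "\<alpha> = restrict (\<lambda>s. (i, \<gamma> s)) {0..1}" by blast
    have "continuous_map unit_interval (dtop (X i)) \<gamma>"
      using D[OF i(1)] i(2) by (auto simp: d_structure_def mapping_space_def)
    then have "continuous_map unit_interval ?T (Pair i \<circ> \<gamma>)"
      using continuous_map_compose continuous_map_component_injection[OF i(1), of "\<lambda>i. dtop (X i)"] by blast
    then have "continuous_map unit_interval ?T \<alpha>"
      by (rule continuous_map_eq) (auto simp: i)
    then show "\<alpha> \<in> mapping_space unit_interval ?T" by (auto simp: mapping_space_def i)
  next
    fix x assume "x \<in> topspace ?T"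
    then obtain i y where "i \<in> I" "y \<in> topspace (dtop (X i))" "x = (i, y)" by auto
    then show "const_path x \<in> ?P"
      using D[of i] by (intro CollectI exI[of _ i] exI[of _ "const_path y"])
        (auto simp: d_structure_def const_path_def)
  next
    fix \<alpha> \<beta> assume "\<alpha> \<in> ?P" "\<beta> \<in> ?P" "\<alpha> 1 = \<beta> 0"
    then obtain i \<gamma> \<delta> where i: "i \<in> I" "\<gamma> \<in> dpaths (X i)" "\<delta> \<in> dpaths (X i)"
      "\<alpha> = restrict (\<lambda>s. (i, \<gamma> s)) {0..1}" "\<beta> = restrict (\<lambda>s. (i, \<delta> s)) {0..1}" "\<gamma> 1 = \<delta> 0"
      by auto
    then show "path_concat \<alpha> \<beta> \<in> ?P"
      using D[of i] by (intro CollectI exI[of _ i] exI[of _ "path_concat \<gamma> \<delta>"])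
        (auto simp: d_structure_def path_concat_def)
  next
    fix \<alpha> and \<phi> :: "real \<Rightarrow> real"
    assume "\<alpha> \<in> ?P" and \<phi>: "continuous_on {0..1} \<phi>" "\<phi> ` {0..1} \<subseteq> {0..1}" "mono_on {0..1} \<phi>"
    then obtain i \<gamma> where i: "i \<in> I" "\<gamma> \<in> dpaths (X i)" "\<alpha> = restrict (\<lambda>s. (i, \<gamma> s)) {0..1}" by blast
    then show "restrict (\<alpha> \<circ> \<phi>) {0..1} \<in> ?P"
      using D[of i] \<phi> by (intro CollectI exI[of _ i] exI[of _ "restrict (\<gamma> \<circ> \<phi>) {0..1}"])
        (auto simp: d_structure_def fun_eq_iff restrict_def image_subset_iff)
  qed
  then show ?thesis by (simp add: is_dspace_def sum_dspace_def)
qed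

lemma is_dspace_realization: "is_dspace (realization K)"
  unfolding realization_def cube_sum_def
  by (intro is_dspace_quotient is_dspace_sum is_dspace_directed_cube)

end

theory Submission
  imports Defs
begin

text \<open>
  The proof moves the end points of directed paths without changing the homotopy type of the path
  spaces. A family of maps \<open>F s\<close> of the unit interval into itself that is continuous and monotone in
  both arguments and fixes 0 and 1 acts on every cube, coordinate by coordinate. This action commutes
  with the gluing, so it is a flow on the realization whose flow lines are d-paths.

  Let \<open>\<Theta>\<close> be such a flow with \<open>\<Theta> 0\<close> the identity, let \<open>\<alpha>\<close> be a d-path from \<open>x'\<close> to \<open>x\<close> whose ends
  satisfy \<open>\<Theta> 1 x' = \<Theta> 1 x\<close>, and let \<open>y\<close> be a fixed point of the flow. Then composition with \<open>\<alpha>\<close> is a homotopy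
  equivalence from the d-paths from \<open>x\<close> to \<open>y\<close> to those from \<open>x'\<close> to \<open>y\<close>; the inverse pushes a path
  forward by \<open>\<Theta> 1\<close> and starts with the flow line of \<open>x\<close>. This works because \<open>\<Theta> 1 \<circ> \<alpha>\<close> is a loop and
  hence constant, and because pairs of reparametrizations form a convex set, which provides the
  homotopies: see \<open>push_start_homotopy_equivalence\<close>. Reversing time gives the dual statement
  \<open>push_end_homotopy_equivalence\<close> for flows that end with the identity.

  The flow \<open>collapse_up\<close> collapses the coordinates in \<open>{m..M}\<close> to \<open>M\<close> and fixes those above
  \<open>M\<close>; \<open>collapse_down\<close> is its mirror image. If a d-path \<open>\<alpha>\<close> in an open cell has coordinates at most \<open>M\<close> and a
  d-path \<open>\<beta>\<close> in the same or another open cell has coordinates at least \<open>M\<close>, both flows apply, and extension by \<open>\<alpha>\<close> and \<open>\<beta>\<close>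
  is a homotopy equivalence (\<open>path_ext_separated_cells\<close>). Therefore the point of a cell all of whose
  coordinates are \<open>M\<close> is a stable point. For \<open>M = 1\<close> the same flow collapses the whole of
  \<open>V_plus K v\<close> to the vertex \<open>v\<close>, the only point of that set above \<open>v\<close>. The flows also contract
  the space of d-paths into the point of collapse, which gives triviality.

  That loops are constant and that the pieces are d-convex follows from a partial order on the
  points. Each point has a unique representative with coordinates strictly between 0 and 1. Rounding
  its coordinates down or up gives two vertices \<open>lo z\<close> and \<open>hi z\<close>; along a d-path both move along edges,
  and as long as neither moves, the path stays in one open cell and its coordinates increase
  (\<open>dpath_point_le\<close>). Without loops of edges this relation is antisymmetric.

  Homotopy equivalences belong to every equivalence system because they are weak homotopy
  equivalences (\<open>homotopy_equivalence_imp_weak\<close>); the proof is the classical change of base points.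
\<close>

section \<open>Homotopy equivalences are weak homotopy equivalences\<close>

abbreviation unit_cube :: "nat \<Rightarrow> (nat \<Rightarrow> real) set" where
  "unit_cube n \<equiv> topspace (cube_topology n)"

text \<open>The cube is expanded from its centre by the factor \<open>1 + u\<close> and then retracted to itself by clamping each
coordinate. The number \<open>spill n u t\<close> tells how far the expanded point lies outside the cube. The points
with positive spill form a collar of the boundary, which \<open>stretch\<close> sends into the boundary.\<close>

definition stretch :: "nat \<Rightarrow> real \<Rightarrow> (nat \<Rightarrow> real) \<Rightarrow> nat \<Rightarrow> real" where
  "stretch n u t = restrict (\<lambda>k. max 0 (min 1 ((1 + u) * t k - u / 2))) {1..n}"

definition spill :: "nat \<Rightarrow> real \<Rightarrow> (nat \<Rightarrow> real) \<Rightarrow> real" where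
  "spill n u t = (\<Sum>k\<in>{1..n}. \<bar>((1 + u) * t k - u / 2) - max 0 (min 1 ((1 + u) * t k - u / 2))\<bar>)"

text \<open>Its zeros in the cube are exactly the boundary points.\<close>

definition depth :: "nat \<Rightarrow> (nat \<Rightarrow> real) \<Rightarrow> real" where
  "depth n t = (\<Prod>k\<in>{1..n}. t k * (1 - t k))"

lemma topspace_cube_topology: "unit_cube n = PiE {1..n} (\<lambda>_. {0..1})"
  by (simp add: cube_topology_def)

lemma cube_boundary_subset: "t \<in> cube_boundary n \<Longrightarrow> t \<in> unit_cube n"
  by (simp add: cube_boundary_def)

lemma stretch_in_cube: "stretch n u t \<in> unit_cube n"
  by (auto simp: stretch_def topspace_cube_topology)

lemma stretch_0: "t \<in> unit_cube n \<Longrightarrow> stretch n 0 t = t"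
  by (rule ext) (auto simp: stretch_def topspace_cube_topology PiE_iff extensional_def)

lemma spill_0: "t \<in> unit_cube n \<Longrightarrow> spill n 0 t = 0"
  by (auto simp: spill_def topspace_cube_topology PiE_iff intro!: sum.neutral)

lemma spill_nonneg: "spill n u t \<ge> 0"
  by (simp add: spill_def sum_nonneg)

lemma depth_nonneg: "t \<in> unit_cube n \<Longrightarrow> depth n t \<ge> 0"
  by (auto simp: depth_def topspace_cube_topology PiE_iff intro!: prod_nonneg)

lemma depth_eq_0_iff: "t \<in> unit_cube n \<Longrightarrow> depth n t = 0 \<longleftrightarrow> t \<in> cube_boundary n"
  by (auto simp: depth_def cube_boundary_def)

lemma spill_pos_boundary: "spill n u t > 0 \<Longrightarrow> stretch n u t \<in> cube_boundary n"
proof -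
  assume "spill n u t > 0"
  then obtain k where "k \<in> {1..n}" "((1 + u) * t k - u / 2) \<noteq> max 0 (min 1 ((1 + u) * t k - u / 2))"
    unfolding spill_def by (metis (no_types, lifting) abs_eq_0 diff_self less_irrefl sum.neutral)
  then show ?thesis
    using stretch_in_cube[of n u t]
    by (auto simp: cube_boundary_def stretch_def max_def min_def split: if_splits intro!: bexI[of _ k])
qed

lemma
  assumes "t \<in> cube_boundary n" "0 \<le> u"
  shows stretch_boundary: "stretch n u t \<in> cube_boundary n"
    and spill_boundary: "u / 2 \<le> spill n u t"
proof -
  obtain k where k: "k \<in> {1..n}" "t k = 0 \<or> t k = 1"
    using assms by (auto simp: cube_boundary_def)
  have "stretch n u t k = 0 \<or> stretch n u t k = 1"
    using k assms(2) by (auto simp: stretch_def)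
  then show "stretch n u t \<in> cube_boundary n"
    using k(1) stretch_in_cube[of n u t] by (auto simp: cube_boundary_def)
  have "u / 2 \<le> \<bar>((1 + u) * t k - u / 2) - max 0 (min 1 ((1 + u) * t k - u / 2))\<bar>"
    using k assms(2) by auto
  also have "\<dots> \<le> spill n u t"
    unfolding spill_def by (rule member_le_sum) (use k in auto)
  finally show "u / 2 \<le> spill n u t" .
qed

text \<open>Off the collar the spill is zero and the depth nonnegative; on the collar the spill is positive and the
depth of the stretched point zero. This turns the case distinction on \<open>spill = 0\<close> into an inequality
between continuous functions, along which maps can be pasted.\<close>

lemma inside_iff:
  "spill n u t \<le> depth n (stretch n u t) \<longleftrightarrow> spill n u t = 0"
  using spill_pos_boundary[of n u t] depth_eq_0_iff[OF stretch_in_cube[of n u t]]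
    depth_nonneg[OF stretch_in_cube[of n u t]] spill_nonneg[of n u t] by linarith

lemma continuous_map_cube_coordinate:
  "\<lbrakk>continuous_map Z (cube_topology n) \<tau>; k \<in> {1..n}\<rbrakk> \<Longrightarrow> continuous_map Z euclideanreal (\<lambda>z. \<tau> z k)"
  by (auto simp: cube_topology_def continuous_map_componentwise continuous_map_in_subtopology)

lemma continuous_map_into_cube:
  assumes "\<And>z. z \<in> topspace Z \<Longrightarrow> \<tau> z \<in> unit_cube n"
    and "\<And>k. k \<in> {1..n} \<Longrightarrow> continuous_map Z euclideanreal (\<lambda>z. \<tau> z k)"
  shows "continuous_map Z (cube_topology n) \<tau>"
  using assms by (auto simp: cube_topology_def continuous_map_componentwise continuous_map_in_subtopology
     PiE_iff image_subset_iff)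

lemma
  assumes t: "continuous_map Z (cube_topology n) \<tau>" and u: "continuous_map Z euclideanreal u"
  shows continuous_map_stretch: "continuous_map Z (cube_topology n) (\<lambda>z. stretch n (u z) (\<tau> z))"
    and continuous_map_spill: "continuous_map Z euclideanreal (\<lambda>z. spill n (u z) (\<tau> z))"
proof -
  have c: "continuous_map Z euclideanreal (\<lambda>z. max 0 (min 1 ((1 + u z) * \<tau> z k - u z / 2)))"
    "continuous_map Z euclideanreal (\<lambda>z. ((1 + u z) * \<tau> z k - u z / 2))"
    if "k \<in> {1..n}" for k
    by (intro continuous_intros u continuous_map_cube_coordinate[OF t that]; simp)+
  show "continuous_map Z (cube_topology n) (\<lambda>z. stretch n (u z) (\<tau> z))"
  proof (rule continuous_map_into_cube)
    show "continuous_map Z euclideanreal (\<lambda>z. stretch n (u z) (\<tau> z) k)" if "k \<in> {1..n}" for k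
      using c(1)[OF that] that by (simp add: stretch_def)
  qed (rule stretch_in_cube)
  show "continuous_map Z euclideanreal (\<lambda>z. spill n (u z) (\<tau> z))"
  proof -
    have "continuous_map Z euclideanreal
        (\<lambda>z. \<bar>((1 + u z) * \<tau> z k - u z / 2) - max 0 (min 1 ((1 + u z) * \<tau> z k - u z / 2))\<bar>)"
      if "k \<in> {1..n}" for k
      using continuous_map_real_abs[OF continuous_map_diff[OF c(2)[OF that] c(1)[OF that]]] .
    then show ?thesis
      unfolding spill_def by (rule continuous_map_sum[OF finite_atLeastAtMost])
  qed
qed

lemma continuous_map_depth:
  "continuous_map Z (cube_topology n) \<tau> \<Longrightarrow> continuous_map Z euclideanreal (\<lambda>z. depth n (\<tau> z))"
proof -
  assume t: "continuous_map Z (cube_topology n) \<tau>"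
  have "continuous_map Z euclideanreal (\<lambda>z. \<tau> z k * (1 - \<tau> z k))" if "k \<in> {1..n}" for k
    using continuous_map_cube_coordinate[OF t that]
    by (intro continuous_map_real_mult continuous_map_diff) auto
  then show ?thesis
    unfolding depth_def by (rule continuous_map_prod[OF finite_atLeastAtMost])
qed

lemma continuous_map_paste_collar:
  assumes t: "continuous_map Z (cube_topology n) \<tau>" and u: "continuous_map Z euclideanreal u"
    and b: "continuous_map Z Y b" and c: "continuous_map Z Y c"
    and agree: "\<And>z. \<lbrakk>z \<in> topspace Z; spill n (u z) (\<tau> z) = 0;
        stretch n (u z) (\<tau> z) \<in> cube_boundary n\<rbrakk> \<Longrightarrow> b z = c z"
  shows "continuous_map Z Y (\<lambda>z. if spill n (u z) (\<tau> z) = 0 then b z else c z)"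
  unfolding inside_iff[symmetric]
proof (rule continuous_map_cases_le)
  show "continuous_map Z euclideanreal (\<lambda>z. spill n (u z) (\<tau> z))"
    by (rule continuous_map_spill[OF t u])
  show "continuous_map Z euclideanreal (\<lambda>z. depth n (stretch n (u z) (\<tau> z)))"
    by (rule continuous_map_depth[OF continuous_map_stretch[OF t u]])
next
  fix z assume z: "z \<in> topspace Z" and eq: "spill n (u z) (\<tau> z) = depth n (stretch n (u z) (\<tau> z))"
  then have "spill n (u z) (\<tau> z) = 0" using inside_iff by (metis order_refl)
  then show "b z = c z"
    using agree[OF z] eq depth_eq_0_iff[OF stretch_in_cube] by metis
qed (use b c in \<open>auto intro: continuous_map_from_subtopology\<close>)

text \<open>The change of base point along a path \<open>p\<close>: the cube \<open>b\<close>, based at \<open>p 1\<close>, is shrunk to the points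
without spill, and the collar around it runs through \<open>p\<close> backwards. The spill of a boundary point
is at least \<open>1/2\<close>, hence the factor 2.\<close>

definition transport :: "nat \<Rightarrow> (real \<Rightarrow> 'a) \<Rightarrow> ((nat \<Rightarrow> real) \<Rightarrow> 'a) \<Rightarrow> (nat \<Rightarrow> real) \<Rightarrow> 'a" where
  "transport n p b t =
     (if spill n 1 t = 0 then b (stretch n 1 t) else p (max 0 (1 - 2 * spill n 1 t)))"

definition homotopic_along ::
  "nat \<Rightarrow> 'a topology \<Rightarrow> (real \<Rightarrow> 'a) \<Rightarrow> ((nat \<Rightarrow> real) \<Rightarrow> 'a) \<Rightarrow> ((nat \<Rightarrow> real) \<Rightarrow> 'a) \<Rightarrow> bool" where
  "homotopic_along n Y p a b \<longleftrightarrow>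
     (\<exists>G. continuous_map (prod_topology unit_interval (cube_topology n)) Y G \<and>
        (\<forall>t\<in>unit_cube n. G (0, t) = a t \<and> G (1, t) = b t) \<and>
        (\<forall>s\<in>{0..1}. \<forall>t\<in>cube_boundary n. G (s, t) = p s))"

lemma based_homotopy_iff:
  "(a, b) \<in> based_homotopy n Y y \<longleftrightarrow>
     (\<exists>G. continuous_map (prod_topology unit_interval (cube_topology n)) Y G \<and>
        (\<forall>t\<in>unit_cube n. G (0, t) = a t) \<and>
        (\<forall>t\<in>unit_cube n. G (1, t) = b t) \<and>
        (\<forall>s\<in>{0..1}. \<forall>t\<in>cube_boundary n. G (s, t) = y))"
  unfolding based_homotopy_def mem_Collect_eq prod.case
proof (subst homotopic_with)
  show "(\<forall>t\<in>cube_boundary n. h t = y) = (\<forall>t\<in>cube_boundary n. k t = y)"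
    if "\<And>t. t \<in> unit_cube n \<Longrightarrow> h t = k t" for h k :: "(nat \<Rightarrow> real) \<Rightarrow> 'a"
    using that[OF cube_boundary_subset] by simp
qed (rule refl)

lemma
  shows based_homotopy_sym: "(a, b) \<in> based_homotopy n Y y \<Longrightarrow> (b, a) \<in> based_homotopy n Y y"
    and based_homotopy_trans:
      "\<lbrakk>(a, b) \<in> based_homotopy n Y y; (b, c) \<in> based_homotopy n Y y\<rbrakk> \<Longrightarrow> (a, c) \<in> based_homotopy n Y y"
    and based_homotopy_right: "(a, b) \<in> based_homotopy n Y y \<Longrightarrow> b \<in> based_cubes n Y y"
  using equiv_based_homotopy[of n Y y] by (auto elim!: equivE dest: symD transD)

lemma continuous_map_fst_real: "continuous_map (prod_topology unit_interval Z) euclideanreal fst"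
  using continuous_map_fst[of unit_interval Z] by (simp add: continuous_map_in_subtopology)

text \<open>The collar shrinks to nothing while \<open>s\<close> grows to 1. A boundary point has spill at least
\<open>(1 - s) / 2\<close>, so it is sent to \<open>p s\<close>; a point off the collar has no spill, so the two parts agree where they meet.\<close>

lemma homotopic_along_transport:
  assumes p: "continuous_map unit_interval Y p" and b: "b \<in> based_cubes n Y (p 1)"
  shows "homotopic_along n Y p (transport n p b) b"
proof -
  let ?C = "cube_topology n" and ?P = "prod_topology unit_interval (cube_topology n)"
  let ?u = "\<lambda>z. 1 - fst z" and ?\<tau> = "\<lambda>z. snd z :: nat \<Rightarrow> real"
  let ?r = "\<lambda>z. max (fst z) (1 - 2 * spill n (?u z) (?\<tau> z))"
  define G where "G z = (if spill n (?u z) (?\<tau> z) = 0 then b (stretch n (?u z) (?\<tau> z)) else p (?r z))"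
    for z :: "real \<times> (nat \<Rightarrow> real)"
  have bc: "continuous_map ?C Y b" and b1: "\<And>t. t \<in> cube_boundary n \<Longrightarrow> b t = p 1"
    using b by (auto simp: based_cubes_def)
  have u: "continuous_map ?P euclideanreal ?u"
    by (intro continuous_intros continuous_map_fst_real) auto
  have \<tau>: "continuous_map ?P ?C ?\<tau>" by (rule continuous_map_snd)
  have "continuous_map ?P euclideanreal ?r"
    by (intro continuous_intros continuous_map_fst_real continuous_map_spill[OF \<tau> u]) auto
  then have r: "continuous_map ?P unit_interval ?r"
    using spill_nonneg by (auto simp: continuous_map_in_subtopology max_def)
  have "continuous_map ?P Y G"
    unfolding G_def
  proof (rule continuous_map_paste_collar[OF \<tau> u])
    show "continuous_map ?P Y (\<lambda>z. b (stretch n (?u z) (?\<tau> z)))"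
      using continuous_map_compose[OF continuous_map_stretch[OF \<tau> u] bc] by (simp add: o_def)
    show "continuous_map ?P Y (\<lambda>z. p (?r z))"
      using continuous_map_compose[OF r p] by (simp add: o_def)
  qed (auto simp: b1 max_def)
  moreover have "G (0, t) = transport n p b t" for t
    by (simp add: G_def transport_def)
  moreover have "G (1, t) = b t" if "t \<in> topspace ?C" for t
    using that by (simp add: G_def spill_0 stretch_0)
  moreover have "G (s, t) = p s" if "s \<in> {0..1}" "t \<in> cube_boundary n" for s t
  proof (cases "s = 1")
    case True
    then show ?thesis using that cube_boundary_subset[OF that(2)] by (simp add: G_def spill_0 stretch_0 b1)
  next
    case False
    then have "spill n (1 - s) t \<ge> (1 - s) / 2" "spill n (1 - s) t > 0"
      using spill_boundary[OF that(2), of "1 - s"] that(1) by auto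
    moreover from this have "max s (1 - 2 * spill n (1 - s) t) = s"
      by (intro max_absorb1) (simp add: field_simps)
    ultimately show ?thesis by (simp add: G_def)
  qed
  ultimately show ?thesis unfolding homotopic_along_def by blast
qed

text \<open>The bottom of the cylinder over the cube is deformed into its top together with its wall: at stage \<open>u\<close>
the cube is stretched and its points are lifted to the height \<open>u\<close>, less twice the spill. Boundary points
stay at height 0, so composition with a homotopy along \<open>p\<close> gives a homotopy relative to the boundary.\<close>

lemma transport_unique:
  assumes p: "continuous_map unit_interval Y p" and ab: "homotopic_along n Y p a b"
  shows "(a, transport n p b) \<in> based_homotopy n Y (p 0)"
proof -
  let ?C = "cube_topology n" and ?P = "prod_topology unit_interval (cube_topology n)"
  obtain G where G: "continuous_map ?P Y G"
    "\<And>t. t \<in> topspace ?C \<Longrightarrow> G (0, t) = a t" "\<And>t. t \<in> topspace ?C \<Longrightarrow> G (1, t) = b t"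
    "\<And>s t. \<lbrakk>s \<in> {0..1}; t \<in> cube_boundary n\<rbrakk> \<Longrightarrow> G (s, t) = p s"
    using ab unfolding homotopic_along_def by blast
  let ?r = "\<lambda>z. max 0 (fst z - 2 * spill n (fst z) (snd z))"
  define D where "D z = (?r z, stretch n (fst z) (snd z))" for z :: "real \<times> (nat \<Rightarrow> real)"
  have \<tau>: "continuous_map ?P ?C snd" by (rule continuous_map_snd)
  have "continuous_map ?P euclideanreal ?r"
    by (intro continuous_intros continuous_map_fst_real continuous_map_spill[OF \<tau>]) auto
  then have "continuous_map ?P unit_interval ?r"
    by (auto simp: continuous_map_in_subtopology intro: order_trans[OF diff_mono[OF _ order_refl]]
        simp: spill_nonneg algebra_simps add_increasing2)
  then have "continuous_map ?P ?P D"
    unfolding D_def by (intro continuous_map_pairedI continuous_map_stretch[OF \<tau> continuous_map_fst_real])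
  then have "continuous_map ?P Y (G \<circ> D)"
    using G(1) continuous_map_compose by blast
  moreover have "(G \<circ> D) (0, t) = a t" if "t \<in> topspace ?C" for t
    using that by (simp add: D_def spill_0 stretch_0 G)
  moreover have "(G \<circ> D) (1, t) = transport n p b t" if "t \<in> topspace ?C" for t
  proof (cases "spill n 1 t = 0")
    case True
    then show ?thesis by (simp add: D_def transport_def G(3)[OF stretch_in_cube])
  next
    case False
    then have s: "spill n 1 t > 0" using spill_nonneg[of n 1 t] by simp
    show ?thesis
      using s by (simp add: D_def transport_def G(4)[OF _ spill_pos_boundary[OF s]])
  qed
  moreover have "(G \<circ> D) (s, t) = p 0" if "s \<in> {0..1}" "t \<in> cube_boundary n" for s t
  proof -
    have "max 0 (s - 2 * spill n s t) = 0"
      using spill_boundary[OF that(2), of s] that(1) by auto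
    then show ?thesis
      using that(1) G(4)[OF _ stretch_boundary[OF that(2), of s], of 0] by (simp add: D_def)
  qed
  ultimately show ?thesis unfolding based_homotopy_iff by blast
qed

lemma transport_cong:
  assumes p: "continuous_map unit_interval Y p" and bc: "(b, c) \<in> based_homotopy n Y (p 1)"
  shows "(transport n p b, transport n p c) \<in> based_homotopy n Y (p 0)"
proof -
  let ?C = "cube_topology n" and ?P = "prod_topology unit_interval (cube_topology n)"
  obtain H where H: "continuous_map ?P Y H"
    "\<And>t. t \<in> topspace ?C \<Longrightarrow> H (0, t) = b t" "\<And>t. t \<in> topspace ?C \<Longrightarrow> H (1, t) = c t"
    "\<And>s t. \<lbrakk>s \<in> {0..1}; t \<in> cube_boundary n\<rbrakk> \<Longrightarrow> H (s, t) = p 1"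
    using bc unfolding based_homotopy_iff by blast
  let ?u = "\<lambda>z::real \<times> (nat \<Rightarrow> real). 1::real" and ?r = "\<lambda>z::real \<times> (nat \<Rightarrow> real). max 0 (1 - 2 * spill n 1 (snd z))"
  define G where "G z = (if spill n (?u z) (snd z) = 0 then H (fst z, stretch n (?u z) (snd z)) else p (?r z))"
    for z :: "real \<times> (nat \<Rightarrow> real)"
  have \<tau>: "continuous_map ?P ?C snd" by (rule continuous_map_snd)
  have u: "continuous_map ?P euclideanreal ?u" by simp
  have "continuous_map ?P euclideanreal ?r"
    by (intro continuous_intros continuous_map_spill[OF \<tau> u]) auto
  then have r: "continuous_map ?P unit_interval ?r"
    by (auto simp: continuous_map_in_subtopology max_def spill_nonneg)
  have "continuous_map ?P Y G"
    unfolding G_def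
  proof (rule continuous_map_paste_collar[OF \<tau> u])
    have "continuous_map ?P ?P (\<lambda>z. (fst z, stretch n 1 (snd z)))"
      by (intro continuous_map_pairedI continuous_map_stretch[OF \<tau> u] continuous_map_fst)
    from continuous_map_compose[OF this H(1)]
    show "continuous_map ?P Y (\<lambda>z. H (fst z, stretch n 1 (snd z)))"
      by (simp add: o_def)
    show "continuous_map ?P Y (\<lambda>z. p (?r z))"
      using continuous_map_compose[OF r p] by (simp add: o_def)
  qed (auto simp: H(4))
  moreover have "G (s, t) = p 0" if "s \<in> {0..1}" "t \<in> cube_boundary n" for s t
  proof -
    have "spill n 1 t \<noteq> 0" "max 0 (1 - 2 * spill n 1 t) = 0"
      using spill_boundary[OF that(2), of 1] by auto
    then show ?thesis by (simp add: G_def)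
  qed
  moreover have "G (0, t) = transport n p b t" "G (1, t) = transport n p c t" for t
    by (simp_all add: G_def transport_def H(2,3)[OF stretch_in_cube])
  ultimately show ?thesis unfolding based_homotopy_iff by blast
qed

lemma homotopic_along_reverse:
  assumes "homotopic_along n Y p a b"
  shows "homotopic_along n Y (\<lambda>s. p (1 - s)) b a"
proof -
  let ?P = "prod_topology unit_interval (cube_topology n)"
  obtain G where G: "continuous_map ?P Y G"
    "\<And>t. t \<in> unit_cube n \<Longrightarrow> G (0, t) = a t" "\<And>t. t \<in> unit_cube n \<Longrightarrow> G (1, t) = b t"
    "\<And>s t. \<lbrakk>s \<in> {0..1}; t \<in> cube_boundary n\<rbrakk> \<Longrightarrow> G (s, t) = p s"
    using assms unfolding homotopic_along_def by blast
  have "continuous_map ?P unit_interval (\<lambda>z. 1 - fst z)"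
    using continuous_map_diff[OF _ continuous_map_fst_real[of "cube_topology n"], of "\<lambda>_. 1"]
    by (auto simp: continuous_map_in_subtopology)
  then have "continuous_map ?P ?P (\<lambda>z. (1 - fst z, snd z))"
    by (intro continuous_map_pairedI continuous_map_snd)
  from continuous_map_compose[OF this G(1)] have "continuous_map ?P Y (\<lambda>z. G (1 - fst z, snd z))"
    by (simp add: o_def)
  then show ?thesis
    unfolding homotopic_along_def by (intro exI[of _ "\<lambda>z. G (1 - fst z, snd z)"]) (auto simp: G)
qed

text \<open>If \<open>p\<close> is the track of \<open>x\<close> under the homotopy, then \<open>a\<close> and \<open>h \<circ> a\<close> are homotopic along \<open>p\<close>. Hence
transport along \<open>p\<close> is a left inverse of the induced map, and transport along the reversed path
shows that it is a right inverse as well.\<close>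

lemma pi_map_bijective_homotopic_id:
  assumes h: "homotopic_with (\<lambda>_. True) X X id h" and x: "x \<in> topspace X"
  shows "bij_betw (pi_map n X h x) (homotopy_classes n X x) (homotopy_classes n X (h x))"
proof -
  let ?C = "cube_topology n"
  obtain H where H: "continuous_map (prod_topology unit_interval X) X H"
    "\<And>z. H (0, z) = z" "\<And>z. H (1, z) = h z"
    using h unfolding homotopic_with_def by auto
  define p where "p s = H (s, x)" for s
  have "continuous_map unit_interval (prod_topology unit_interval X) (\<lambda>s. (s, x))"
    using x by (intro continuous_map_pairedI) auto
  from continuous_map_compose[OF this H(1)] have p: "continuous_map unit_interval X p"
    by (simp add: p_def[abs_def] o_def)
  have p01: "p 0 = x" "p 1 = h x" by (simp_all add: p_def H)
  let ?q = "\<lambda>s. p (1 - s)"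
  have "continuous_map unit_interval unit_interval (\<lambda>s. 1 - s)"
    by (auto simp: continuous_map_in_subtopology intro!: continuous_intros)
  from continuous_map_compose[OF this p] have q: "continuous_map unit_interval X ?q"
    by (simp add: o_def)
  have hc: "continuous_map X X h" using h homotopic_with_imp_continuous_maps by blast
  have track: "homotopic_along n X p a (h \<circ> a)" if "a \<in> based_cubes n X x" for a
  proof -
    have a: "continuous_map ?C X a" "\<And>t. t \<in> cube_boundary n \<Longrightarrow> a t = x"
      using that by (auto simp: based_cubes_def)
    have "continuous_map (prod_topology unit_interval ?C) (prod_topology unit_interval X) (\<lambda>z. (fst z, a (snd z)))"
      using continuous_map_compose[OF continuous_map_snd a(1), of unit_interval]
      by (intro continuous_map_pairedI continuous_map_fst) (simp add: o_def)
    from continuous_map_compose[OF this H(1)]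
    show ?thesis
      unfolding homotopic_along_def
      by (intro exI[of _ "\<lambda>z. H (fst z, a (snd z))"]) (auto simp: o_def H a p_def)
  qed
  note E = equiv_based_homotopy
  have cls: "pi_map n X h x (based_homotopy n X x `` {a}) = based_homotopy n X (h x) `` {h \<circ> a}"
    if "a \<in> based_cubes n X x" for a using pi_map_class[OF hc that] .
  show ?thesis
  proof (rule bij_betw_imageI)
    show "inj_on (pi_map n X h x) (homotopy_classes n X x)"
    proof (rule inj_onI)
      fix A B assume "A \<in> homotopy_classes n X x" "B \<in> homotopy_classes n X x"
        and eq: "pi_map n X h x A = pi_map n X h x B"
      then obtain a b where a: "a \<in> based_cubes n X x" "A = based_homotopy n X x `` {a}"
        and b: "b \<in> based_cubes n X x" "B = based_homotopy n X x `` {b}"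
        by (auto simp: homotopy_classes_def elim!: quotientE)
      have "(h \<circ> a, h \<circ> b) \<in> based_homotopy n X (p 1)"
        using eq eq_equiv_class[OF _ E based_cubes_comp[OF hc b(1)], of "h \<circ> a"]
        unfolding a(2) b(2) cls[OF a(1)] cls[OF b(1)] p01 by simp
      note * = transport_cong[OF p this] transport_unique[OF p track[OF a(1)]] transport_unique[OF p track[OF b(1)]]
      have "(a, b) \<in> based_homotopy n X x"
        using based_homotopy_trans[OF based_homotopy_trans[OF *(2) *(1)] based_homotopy_sym[OF *(3)]]
        unfolding p01 .
      from equiv_class_eq[OF E this] show "A = B" unfolding a(2) b(2) .
    qed
    show "pi_map n X h x ` homotopy_classes n X x = homotopy_classes n X (h x)"
    proof (intro equalityI subsetI)
      fix B assume "B \<in> pi_map n X h x ` homotopy_classes n X x"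
      then obtain a where a: "a \<in> based_cubes n X x" "B = pi_map n X h x (based_homotopy n X x `` {a})"
        by (auto simp: homotopy_classes_def elim!: quotientE)
      show "B \<in> homotopy_classes n X (h x)"
        unfolding a(2) cls[OF a(1)] homotopy_classes_def by (rule quotientI[OF based_cubes_comp[OF hc a(1)]])
    next
      fix B assume "B \<in> homotopy_classes n X (h x)"
      then obtain b where b: "b \<in> based_cubes n X (h x)" "B = based_homotopy n X (h x) `` {b}"
        by (auto simp: homotopy_classes_def elim!: quotientE)
      let ?a = "transport n p b"
      have ab: "homotopic_along n X p ?a b"
        by (rule homotopic_along_transport[OF p]) (simp add: p01 b)
      have a: "?a \<in> based_cubes n X x"
        using transport_unique[OF p ab, THEN based_homotopy_right] unfolding p01 .
      have "(b, h \<circ> ?a) \<in> based_homotopy n X (h x)"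
        using based_homotopy_trans[OF transport_unique[OF q homotopic_along_reverse[OF ab]]
            based_homotopy_sym[OF transport_unique[OF q homotopic_along_reverse[OF track[OF a]]]]]
        by (simp add: p01)
      from equiv_class_eq[OF E this] have "B = pi_map n X h x (based_homotopy n X x `` {?a})"
        unfolding cls[OF a] b(2) .
      moreover have "based_homotopy n X x `` {?a} \<in> homotopy_classes n X x"
        unfolding homotopy_classes_def by (rule quotientI[OF a])
      ultimately show "B \<in> pi_map n X h x ` homotopy_classes n X x" by (rule image_eqI)
    qed
  qed
qed

definition homotopy_equivalence :: "'a topology \<Rightarrow> 'b topology \<Rightarrow> ('a \<Rightarrow> 'b) \<Rightarrow> bool" where
  "homotopy_equivalence X Y f \<longleftrightarrow>
     continuous_map X Y f \<and>
     (\<exists>g. continuous_map Y X g \<and> homotopic_with (\<lambda>_. True) X X id (g \<circ> f) \<and>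
        homotopic_with (\<lambda>_. True) Y Y id (f \<circ> g))"

text \<open>The two-out-of-six property of bijections.\<close>

lemma bij_betw_middle:
  assumes ca: "a ` A \<subseteq> B" and cb: "b ` B \<subseteq> C"
    and ba: "bij_betw (\<lambda>x. b (a x)) A C" and cb': "bij_betw (\<lambda>y. c (b y)) B D"
  shows "bij_betw a A B"
proof -
  have b: "inj_on b B" using cb' unfolding bij_betw_def inj_on_def by metis
  have "inj_on a A" using ba unfolding bij_betw_def inj_on_def by metis
  moreover have "y \<in> a ` A" if y: "y \<in> B" for y
  proof -
    have "b y \<in> (\<lambda>x. b (a x)) ` A" using ba cb y by (auto simp: bij_betw_def)
    then obtain x where x: "x \<in> A" "b y = b (a x)" by blast
    then have "y = a x" using b y ca by (auto dest: inj_onD)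
    then show ?thesis using x by blast
  qed
  ultimately show ?thesis using ca by (auto simp: bij_betw_def)
qed

lemma pi_map_comp_class:
  assumes "continuous_map X Y f" "continuous_map Y Z g" "A \<in> homotopy_classes n X x"
  shows "pi_map n Z g (f x) (pi_map n Y f x A) = pi_map n Z (g \<circ> f) x A"
    and "pi_map n Y f x A \<in> homotopy_classes n Y (f x)"
proof -
  obtain a where a: "a \<in> based_cubes n X x" "A = based_homotopy n X x `` {a}"
    using assms(3) by (auto simp: homotopy_classes_def elim!: quotientE)
  have fa: "f \<circ> a \<in> based_cubes n Y (f x)" using based_cubes_comp[OF assms(1) a(1)] .
  have gf: "continuous_map X Z (g \<circ> f)" using assms continuous_map_compose by blast
  show "pi_map n Z g (f x) (pi_map n Y f x A) = pi_map n Z (g \<circ> f) x A"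
    unfolding a(2) pi_map_class[OF assms(1) a(1)] pi_map_class[OF assms(2) fa] pi_map_class[OF gf a(1)]
    by (simp add: o_assoc)
  show "pi_map n Y f x A \<in> homotopy_classes n Y (f x)"
    unfolding a(2) pi_map_class[OF assms(1) a(1)] homotopy_classes_def using fa by (rule quotientI)
qed

lemma homotopic_id_path_component:
  assumes "homotopic_with (\<lambda>_. True) X X id h" "x \<in> topspace X"
  shows "path_component_of_set X (h x) = path_component_of_set X x"
proof -
  obtain H where H: "continuous_map (prod_topology unit_interval X) X H"
    "\<And>z. H (0, z) = z" "\<And>z. H (1, z) = h z"
    using assms(1) unfolding homotopic_with_def by auto
  have "continuous_map unit_interval (prod_topology unit_interval X) (\<lambda>s. (s, x))"
    using assms(2) by (intro continuous_map_pairedI) auto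
  from continuous_map_compose[OF this H(1)] have "pathin X (\<lambda>s. H (s, x))"
    by (simp add: pathin_def o_def)
  then have "path_component_of X x (h x)"
    unfolding path_component_of_def by (intro exI[of _ "\<lambda>s. H (s, x)"]) (simp add: H)
  then show ?thesis by (metis path_component_of_equiv)
qed

text \<open>On homotopy classes \<open>g \<circ> f\<close> and \<open>f \<circ> g\<close> induce bijections, since they are homotopic to identities. The
claim follows with two out of six, where \<open>f\<close> occurs once with source \<open>X\<close> based at \<open>x\<close> and
once based at \<open>g (f x)\<close>.\<close>

lemma homotopy_equivalence_imp_weak:
  assumes "homotopy_equivalence X Y f"
  shows "weak_homotopy_equivalence X Y f"
proof -
  obtain g where f: "continuous_map X Y f" and g: "continuous_map Y X g"
    and gf: "homotopic_with (\<lambda>_. True) X X id (g \<circ> f)" and fg: "homotopic_with (\<lambda>_. True) Y Y id (f \<circ> g)"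
    using assms unfolding homotopy_equivalence_def by blast
  have fX: "f x \<in> topspace Y" if "x \<in> topspace X" for x using f that by (auto simp: continuous_map_def)
  have gY: "g y \<in> topspace X" if "y \<in> topspace Y" for y using g that by (auto simp: continuous_map_def)
  have "pi0_bijective X Y f"
    unfolding pi0_bijective_def
  proof (rule bij_betw_byWitness[where f' = "pi0_map Y X g"])
    note pf = pi0_map_component[OF f] and pg = pi0_map_component[OF g]
    have 1: "pi0_map Y X g (pi0_map X Y f (path_component_of_set X x)) = path_component_of_set X x"
      if "x \<in> topspace X" for x
      using pf[OF that] pg[OF fX[OF that]] homotopic_id_path_component[OF gf that] by (simp add: o_def)
    have 2: "pi0_map X Y f (pi0_map Y X g (path_component_of_set Y y)) = path_component_of_set Y y"
      if "y \<in> topspace Y" for y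
      using pg[OF that] pf[OF gY[OF that]] homotopic_id_path_component[OF fg that] by (simp add: o_def)
    show "\<forall>C\<in>path_components_of X. pi0_map Y X g (pi0_map X Y f C) = C"
      unfolding path_components_of_def by (intro ballI, elim imageE, hypsubst, rule 1)
    show "\<forall>C\<in>path_components_of Y. pi0_map X Y f (pi0_map Y X g C) = C"
      unfolding path_components_of_def by (intro ballI, elim imageE, hypsubst, rule 2)
    show "pi0_map X Y f ` path_components_of X \<subseteq> path_components_of Y"
      unfolding path_components_of_def by (intro image_subsetI, elim imageE, hypsubst, subst pf) (auto intro: fX)
    show "pi0_map Y X g ` path_components_of Y \<subseteq> path_components_of X"
      unfolding path_components_of_def by (intro image_subsetI, elim imageE, hypsubst, subst pg) (auto intro: gY)
  qed
  moreover have "bij_betw (pi_map n Y f x) (homotopy_classes n X x) (homotopy_classes n Y (f x))"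
    if x: "x \<in> topspace X" for n x
  proof (rule bij_betw_middle[where b = "pi_map n X g (f x)" and c = "pi_map n Y f (g (f x))"])
    show "pi_map n Y f x ` homotopy_classes n X x \<subseteq> homotopy_classes n Y (f x)"
      using pi_map_comp_class(2)[OF f g] by blast
    show "pi_map n X g (f x) ` homotopy_classes n Y (f x) \<subseteq> homotopy_classes n X (g (f x))"
      using pi_map_comp_class(2)[OF g f] by blast
    have "bij_betw (pi_map n X (g \<circ> f) x) (homotopy_classes n X x) (homotopy_classes n X (g (f x)))"
      using pi_map_bijective_homotopic_id[OF gf x] by simp
    then show "bij_betw (\<lambda>A. pi_map n X g (f x) (pi_map n Y f x A)) (homotopy_classes n X x)
        (homotopy_classes n X (g (f x)))"
      by (subst bij_betw_cong[OF pi_map_comp_class(1)[OF f g]])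
    have "bij_betw (pi_map n Y (f \<circ> g) (f x)) (homotopy_classes n Y (f x)) (homotopy_classes n Y (f (g (f x))))"
      using pi_map_bijective_homotopic_id[OF fg fX[OF x]] by simp
    then show "bij_betw (\<lambda>A. pi_map n Y f (g (f x)) (pi_map n X g (f x) A)) (homotopy_classes n Y (f x))
        (homotopy_classes n Y (f (g (f x))))"
      by (subst bij_betw_cong[OF pi_map_comp_class(1)[OF g f]])
  qed
  ultimately show ?thesis using f by (simp add: weak_homotopy_equivalence_def)
qed

lemma homotopy_equivalence_compose:
  assumes "homotopy_equivalence X Y f" "homotopy_equivalence Y Z g"
  shows "homotopy_equivalence X Z (g \<circ> f)"
proof -
  obtain f' where f: "continuous_map X Y f" "continuous_map Y X f'"
    "homotopic_with (\<lambda>_. True) X X id (f' \<circ> f)" "homotopic_with (\<lambda>_. True) Y Y id (f \<circ> f')"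
    using assms(1) unfolding homotopy_equivalence_def by blast
  obtain g' where g: "continuous_map Y Z g" "continuous_map Z Y g'"
    "homotopic_with (\<lambda>_. True) Y Y id (g' \<circ> g)" "homotopic_with (\<lambda>_. True) Z Z id (g \<circ> g')"
    using assms(2) unfolding homotopy_equivalence_def by blast
  have "homotopic_with (\<lambda>_. True) X X (f' \<circ> id \<circ> f) (f' \<circ> (g' \<circ> g) \<circ> f)"
    by (intro homotopic_with_compose_continuous_map_right[OF _ f(1)]
        homotopic_with_compose_continuous_map_left[OF g(3) f(2)]) auto
  from homotopic_with_trans[OF f(3) this[unfolded comp_id]]
  have 1: "homotopic_with (\<lambda>_. True) X X id ((f' \<circ> g') \<circ> (g \<circ> f))" by (simp add: o_assoc)
  have "homotopic_with (\<lambda>_. True) Z Z (g \<circ> id \<circ> g') (g \<circ> (f \<circ> f') \<circ> g')"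
    by (intro homotopic_with_compose_continuous_map_right[OF _ g(2)]
        homotopic_with_compose_continuous_map_left[OF f(4) g(1)]) auto
  from homotopic_with_trans[OF g(4) this[unfolded comp_id]]
  have 2: "homotopic_with (\<lambda>_. True) Z Z id ((g \<circ> f) \<circ> (f' \<circ> g'))" by (simp add: o_assoc)
  show ?thesis
    unfolding homotopy_equivalence_def
    using continuous_map_compose[OF f(1) g(1)] continuous_map_compose[OF g(2) f(2)] 1 2 by blast
qed

lemma homotopy_equivalence_homeomorphic_map:
  assumes "homeomorphic_map X Y f"
  shows "homotopy_equivalence X Y f"
proof -
  obtain g where g: "homeomorphic_maps X Y f g" using assms homeomorphic_map_maps by blast
  then have fg: "continuous_map X Y f" "continuous_map Y X g" by (auto simp: homeomorphic_maps_def)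
  have "homotopic_with (\<lambda>_. True) X X id (g \<circ> f)" "homotopic_with (\<lambda>_. True) Y Y id (f \<circ> g)"
    by (rule homotopic_with_equal; use g in \<open>auto simp: homeomorphic_maps_def\<close>)+
  then show ?thesis unfolding homotopy_equivalence_def using fg by blast
qed

lemma homotopy_equivalence_eq:
  assumes "homotopy_equivalence X Y f" and eq: "\<And>x. x \<in> topspace X \<Longrightarrow> f x = f' x"
  shows "homotopy_equivalence X Y f'"
proof -
  obtain g where g: "continuous_map X Y f" "continuous_map Y X g"
    "homotopic_with (\<lambda>_. True) X X id (g \<circ> f)" "homotopic_with (\<lambda>_. True) Y Y id (f \<circ> g)"
    using assms(1) unfolding homotopy_equivalence_def by blast
  have f': "continuous_map X Y f'" by (rule continuous_map_eq[OF g(1) eq])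
  have gX: "g y \<in> topspace X" if "y \<in> topspace Y" for y
    using g(2) that by (auto simp: continuous_map_def)
  have "homotopic_with (\<lambda>_. True) X X (g \<circ> f) (g \<circ> f')"
    by (rule homotopic_with_equal) (use eq continuous_map_compose[OF g(1,2)] in auto)
  moreover have "homotopic_with (\<lambda>_. True) Y Y (f \<circ> g) (f' \<circ> g)"
    by (rule homotopic_with_equal) (use eq gX continuous_map_compose[OF g(2,1)] in auto)
  ultimately show ?thesis
    unfolding homotopy_equivalence_def
    using f' g(2) homotopic_with_trans[OF g(3)] homotopic_with_trans[OF g(4)] by (intro conjI exI[of _ g])
qed

section \<open>Members of an equivalence system\<close>

text \<open>The injections carry the spaces over to the universe of \<open>F\<close>: an injective quotient map is a
homeomorphism.\<close>

lemma in_family_homotopy_equivalence: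
  fixes F :: "'u family" and X :: "'a topology" and Y :: "'b topology"
    and \<iota> :: "'a \<Rightarrow> 'u" and \<kappa> :: "'b \<Rightarrow> 'u"
  assumes F: "equivalence_system F" and inj: "inj \<iota>" "inj \<kappa>" and f: "homotopy_equivalence X Y f"
  shows "in_family F X Y f"
proof -
  let ?X = "quotient_topology X \<iota>" and ?Y = "quotient_topology Y \<kappa>"
  have homeo: "homeomorphic_map X ?X \<iota>" "homeomorphic_map Y ?Y \<kappa>"
    using inj quotient_map_quotient_topology unfolding homeomorphic_map_def inj_on_def by blast+
  obtain \<iota>' where \<iota>': "homeomorphic_maps X ?X \<iota> \<iota>'" using homeo(1) homeomorphic_map_maps by blast
  then have "homeomorphic_map ?X X \<iota>'" using homeomorphic_maps_sym homeomorphic_maps_map by blast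
  then have "homotopy_equivalence ?X ?Y (\<kappa> \<circ> (f \<circ> \<iota>'))"
    by (intro homotopy_equivalence_compose[OF homotopy_equivalence_compose[OF _ f]]
        homotopy_equivalence_homeomorphic_map homeo(2))
  then have "F ?X ?Y (\<kappa> \<circ> (f \<circ> \<iota>'))"
    using equivalence_systemD(4)[OF F] homotopy_equivalence_imp_weak by blast
  moreover have "is_copy ?X ?Y (\<kappa> \<circ> (f \<circ> \<iota>')) X Y f"
    unfolding is_copy_def
  proof (intro exI conjI ballI)
    fix x assume x: "x \<in> topspace X"
    show "f x \<in> topspace Y"
      using f x by (auto simp: homotopy_equivalence_def continuous_map_def)
    show "(\<kappa> \<circ> (f \<circ> \<iota>')) (\<iota> x) = \<kappa> (f x)"
      using \<iota>' x by (simp add: homeomorphic_maps_def)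
  qed (use homeo in auto)
  ultimately show ?thesis unfolding in_family_def by blast
qed

lemma equivalence_system_compose:
  assumes F: "equivalence_system F" and f: "F X Y f" and g: "F Y Z g"
  shows "F X Z (g \<circ> f)"
  using equivalence_systemD(2)[OF F, unfolded two_out_of_three_def, rule_format, of X Y f Z g,
      OF conjI[OF equivalence_systemD(1)[OF F f] equivalence_systemD(1)[OF F g]], THEN conjunct1, THEN mp,
      OF conjI[OF f g]] .

text \<open>The intermediate space may have been copied in two different ways; the homeomorphism between the two copies
is inserted.\<close>

lemma in_family_compose:
  fixes F :: "'u family" and X :: "'a topology" and Y :: "'b topology" and Z :: "'c topology"
  assumes F: "equivalence_system F" and f: "in_family F X Y f" and g: "in_family F Y Z g"
  shows "in_family F X Z (g \<circ> f)"
proof -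
  obtain X1 Y1 f1 where f1: "F X1 Y1 f1" "is_copy X1 Y1 f1 X Y f"
    using f unfolding in_family_def by (elim exE conjE)
  obtain p1 q1 where 1: "homeomorphic_map X X1 p1" "homeomorphic_map Y Y1 q1"
    "\<And>x. x \<in> topspace X \<Longrightarrow> f x \<in> topspace Y \<and> f1 (p1 x) = q1 (f x)"
    using f1(2) unfolding is_copy_def by blast
  obtain Y2 Z2 g2 where g2: "F Y2 Z2 g2" "is_copy Y2 Z2 g2 Y Z g"
    using g unfolding in_family_def by (elim exE conjE)
  obtain p2 q2 where 2: "homeomorphic_map Y Y2 p2" "homeomorphic_map Z Z2 q2"
    "\<And>x. x \<in> topspace Y \<Longrightarrow> g x \<in> topspace Z \<and> g2 (p2 x) = q2 (g x)"
    using g2(2) unfolding is_copy_def by blast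
  obtain q1' where q1': "homeomorphic_maps Y Y1 q1 q1'" using 1(2) homeomorphic_map_maps by blast
  then have "homeomorphic_map Y1 Y q1'" using homeomorphic_maps_map by blast
  then have h: "homeomorphic_map Y1 Y2 (p2 \<circ> q1')"
    using 2(1) by (rule homeomorphic_map_compose)
  have "F Y1 Y2 (p2 \<circ> q1')"
    using F h by (rule equivalence_system_homeomorphic_map)
  then have "F X1 Y2 ((p2 \<circ> q1') \<circ> f1)"
    by (rule equivalence_system_compose[of F X1 Y1 f1 Y2 "p2 \<circ> q1'", OF F f1(1)])
  with F have "F X1 Z2 (g2 \<circ> ((p2 \<circ> q1') \<circ> f1))"
    using g2(1) by (rule equivalence_system_compose)
  moreover have "is_copy X1 Z2 (g2 \<circ> ((p2 \<circ> q1') \<circ> f1)) X Z (g \<circ> f)"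
    unfolding is_copy_def
    by (intro exI[of _ p1] exI[of _ q2]) (use 1 2 q1' in \<open>auto simp: homeomorphic_maps_def\<close>)
  ultimately show ?thesis unfolding in_family_def by blast
qed

lemma F_contractible_in_family:
  "\<lbrakk>equivalence_system F; in_family F X Y f; F_contractible F Y\<rbrakk> \<Longrightarrow> F_contractible F X"
  unfolding F_contractible_def by (drule (2) in_family_compose) (simp add: o_def)

lemma F_contractible_homotopic_const:
  fixes F :: "'u family" and Y :: "'a topology" and \<iota> :: "'a \<Rightarrow> 'u"
  assumes F: "equivalence_system F" and \<iota>: "inj \<iota>" and y: "y \<in> topspace Y"
    and h: "homotopic_with (\<lambda>_. True) Y Y id (\<lambda>_. y)"
  shows "F_contractible F Y"
  unfolding F_contractible_def
  \<comment> \<open>every function on the type of one element is injective\<close>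
proof (rule in_family_homotopy_equivalence[OF F \<iota>, where \<kappa> = "\<lambda>_. undefined"])
  show "homotopy_equivalence Y (discrete_topology {()}) (\<lambda>_. ())"
    unfolding homotopy_equivalence_def
  proof (intro conjI exI)
    show "homotopic_with (\<lambda>_. True) Y Y id ((\<lambda>_. y) \<circ> (\<lambda>_. ()))" using h by (simp add: o_def)
    show "homotopic_with (\<lambda>_. True) (discrete_topology {()}) (discrete_topology {()}) id ((\<lambda>_. ()) \<circ> (\<lambda>_. y))"
      by (rule homotopic_with_equal) auto
  qed (use y in auto)
qed (simp add: inj_on_def)

section \<open>The compact-open topology and path spaces\<close>

text \<open>Evaluation is continuous because the unit interval is locally compact: a path that is in \<open>U\<close> at time
\<open>u\<close> maps a compact neighbourhood of \<open>u\<close> into \<open>U\<close>.\<close>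

lemma continuous_map_compact_open_eval:
  "continuous_map (prod_topology (compact_open_topology unit_interval X) unit_interval) X (\<lambda>(\<omega>, u). \<omega> u)"
proof -
  let ?CO = "compact_open_topology unit_interval X"
  show ?thesis
    unfolding continuous_map_def
  proof (intro conjI allI impI)
    show "(\<lambda>(\<omega>, u). \<omega> u) \<in> topspace (prod_topology ?CO unit_interval) \<rightarrow> topspace X"
      by (auto simp: mapping_space_def continuous_map_def)
    fix U assume U: "openin X U"
    show "openin (prod_topology ?CO unit_interval)
        {z \<in> topspace (prod_topology ?CO unit_interval). (case z of (\<omega>, u) \<Rightarrow> \<omega> u) \<in> U}"
      unfolding openin_prod_topology_alt
    proof (intro allI impI)
      fix \<omega> :: "real \<Rightarrow> 'a" and u
      assume "(\<omega>, u) \<in> {z \<in> topspace (prod_topology ?CO unit_interval). (case z of (\<omega>, u) \<Rightarrow> \<omega> u) \<in> U}"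
      then have \<omega>: "\<omega> \<in> mapping_space unit_interval X" and u: "u \<in> {0..1}" "\<omega> u \<in> U" by auto
      have "continuous_map unit_interval X \<omega>" using \<omega> by (simp add: mapping_space_def)
      then have "openin unit_interval {v \<in> {0..1}. \<omega> v \<in> U}" using U by (auto simp: continuous_map_def)
      then obtain e where e: "e > 0" "{0..1} \<inter> cball u e \<subseteq> {v \<in> {0..1}. \<omega> v \<in> U}"
        using u unfolding openin_contains_cball by blast
      let ?C = "{0..1} \<inter> cball u e" and ?V = "{0..1} \<inter> ball u e"
      let ?W = "{f \<in> mapping_space unit_interval X. f ` ?C \<subseteq> U}"
      have "compactin unit_interval ?C"
        by (simp add: compactin_subtopology compact_Int)
      then have "openin ?CO ?W"
        unfolding compact_open_topology_def using U by (intro topology_generated_by_Basis) blast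
      moreover have "openin unit_interval ?V" by (simp add: openin_open_Int)
      moreover have "\<omega> \<in> ?W" using \<omega> e(2) by auto
      moreover have "u \<in> ?V" using u e(1) by simp
      moreover have "?W \<times> ?V \<subseteq> {z \<in> topspace (prod_topology ?CO unit_interval). (case z of (\<omega>, u) \<Rightarrow> \<omega> u) \<in> U}"
        by (auto simp: image_subset_iff)
      ultimately show "\<exists>W V. openin ?CO W \<and> openin unit_interval V \<and> \<omega> \<in> W \<and> u \<in> V \<and>
          W \<times> V \<subseteq> {z \<in> topspace (prod_topology ?CO unit_interval). (case z of (\<omega>, u) \<Rightarrow> \<omega> u) \<in> U}"
        by blast
    qed
  qed
qed

text \<open>A map into a path space is continuous as soon as the uncurried map is. The bad points for a subbasic set
are the projection of a closed set along the compact set \<open>C\<close>, hence closed.\<close>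

lemma continuous_map_compact_open_curry:
  assumes g: "continuous_map (prod_topology Z unit_interval) X (\<lambda>(z, u). h z u)"
  shows "continuous_map Z (compact_open_topology unit_interval X) (\<lambda>z. restrict (h z) {0..1})"
proof -
  let ?S = "{{f \<in> mapping_space unit_interval X. f ` C \<subseteq> U} | C U. compactin unit_interval C \<and> openin X U}"
  have mem: "restrict (h z) {0..1} \<in> mapping_space unit_interval X" if "z \<in> topspace Z" for z
  proof -
    have "continuous_map unit_interval (prod_topology Z unit_interval) (\<lambda>u. (z, u))"
      using that by (intro continuous_map_pairedI) auto
    from continuous_map_compose[OF this g] have "continuous_map unit_interval X (h z)"
      by (simp add: o_def)
    then have "continuous_map unit_interval X (restrict (h z) {0..1})"
      by (rule continuous_map_eq) simp
    then show ?thesis by (simp add: mapping_space_def)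
  qed
  show ?thesis
    unfolding compact_open_topology_def
  proof (rule continuous_on_generated_topo)
    show "(\<lambda>z. restrict (h z) {0..1}) ` topspace Z \<subseteq> \<Union>?S"
    proof (rule image_subsetI)
      fix z assume "z \<in> topspace Z"
      then have "restrict (h z) {0..1} \<in> {f \<in> mapping_space unit_interval X. f ` {} \<subseteq> {}}"
        using mem by simp
      then show "restrict (h z) {0..1} \<in> \<Union>?S"
        by (intro UnionI[of "{f \<in> mapping_space unit_interval X. f ` {} \<subseteq> {}}"])
          (auto intro!: exI[of _ "{}"])
    qed
  next
    fix S assume "S \<in> ?S"
    then obtain C U where S: "S = {f \<in> mapping_space unit_interval X. f ` C \<subseteq> U}"
      and C: "compactin unit_interval C" and U: "openin X U" by blast
    have C01: "C \<subseteq> {0..1}" using compactin_subset_topspace[OF C] by simp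
    let ?I = "subtopology unit_interval C"
    let ?B = "{w \<in> topspace (prod_topology Z ?I). (case w of (z, u) \<Rightarrow> h z u) \<in> topspace X - U}"
    have "continuous_map (prod_topology Z ?I) X (\<lambda>(z, u). h z u)"
      using continuous_map_from_subtopology[OF g, of "topspace Z \<times> C"]
      by (simp add: subtopology_Times subtopology_topspace)
    then have cB: "closedin (prod_topology Z ?I) ?B"
      using closedin_continuous_map_preimage U by blast
    have "compact_space ?I" using C by (simp add: compact_space_subtopology)
    then have "closedin Z (fst ` ?B)"
      using cB closed_map_fst[of ?I Z] by (simp add: closed_map_def)
    then have "openin Z (topspace Z - fst ` ?B)" by blast
    moreover have "(\<lambda>z. restrict (h z) {0..1}) -` S \<inter> topspace Z = topspace Z - fst ` ?B"
    proof (intro equalityI subsetI)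
      fix z assume "z \<in> (\<lambda>z. restrict (h z) {0..1}) -` S \<inter> topspace Z"
      then show "z \<in> topspace Z - fst ` ?B" using C01 by (force simp: S image_subset_iff)
    next
      fix z assume z: "z \<in> topspace Z - fst ` ?B"
      have "h z u \<in> U" if "u \<in> C" for u
      proof (rule ccontr)
        assume "h z u \<notin> U"
        moreover have "h z u \<in> topspace X"
          using mem[of z] z that C01 by (force simp: mapping_space_def continuous_map_def Pi_iff)
        ultimately have "(z, u) \<in> ?B" using z that C01 by auto
        then show False using z by force
      qed
      then show "z \<in> (\<lambda>z. restrict (h z) {0..1}) -` S \<inter> topspace Z"
        using z mem C01 by (auto simp: S)
    qed
    ultimately show "openin Z ((\<lambda>z. restrict (h z) {0..1}) -` S \<inter> topspace Z)" by simp
  qed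
qed

definition reparametrization :: "(real \<Rightarrow> real) \<Rightarrow> bool" where
  "reparametrization \<phi> \<longleftrightarrow> continuous_on {0..1} \<phi> \<and> \<phi> ` {0..1} \<subseteq> {0..1} \<and> mono_on {0..1} \<phi>"

lemma reparametrizationI:
  assumes "continuous_on {0..1} \<phi>" "\<And>u. \<lbrakk>0 \<le> u; u \<le> 1\<rbrakk> \<Longrightarrow> 0 \<le> \<phi> u \<and> \<phi> u \<le> 1"
    and "\<And>u v. \<lbrakk>0 \<le> u; u \<le> v; v \<le> 1\<rbrakk> \<Longrightarrow> \<phi> u \<le> \<phi> v"
  shows "reparametrization \<phi>"
  unfolding reparametrization_def using assms by (auto intro: mono_onI)

lemma
  assumes "reparametrization \<phi>"
  shows reparametrization_range: "\<lbrakk>0 \<le> u; u \<le> 1\<rbrakk> \<Longrightarrow> 0 \<le> \<phi> u \<and> \<phi> u \<le> 1"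
    and reparametrization_mono: "\<lbrakk>0 \<le> u; u \<le> v; v \<le> 1\<rbrakk> \<Longrightarrow> \<phi> u \<le> \<phi> v"
    and reparametrization_continuous: "continuous_on {0..1} \<phi>"
  using assms by (auto simp: reparametrization_def mono_on_def image_subset_iff)

lemma reparametrization_comp:
  "\<lbrakk>reparametrization \<phi>; reparametrization \<psi>\<rbrakk> \<Longrightarrow> reparametrization (\<lambda>u. \<phi> (\<psi> u))"
  unfolding reparametrization_def
  by (auto simp: mono_on_def image_subset_iff intro: continuous_on_compose2)

lemma reparametrization_convex:
  assumes \<phi>: "reparametrization \<phi>" and \<psi>: "reparametrization \<psi>" and r: "0 \<le> r" "r \<le> 1"
  shows "reparametrization (\<lambda>u. (1 - r) * \<phi> u + r * \<psi> u)"
proof (rule reparametrizationI)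
  show "continuous_on {0..1} (\<lambda>u. (1 - r) * \<phi> u + r * \<psi> u)"
    using \<phi> \<psi> by (auto simp: reparametrization_def intro!: continuous_intros)
  show "0 \<le> (1 - r) * \<phi> u + r * \<psi> u \<and> (1 - r) * \<phi> u + r * \<psi> u \<le> 1" if "0 \<le> u" "u \<le> 1" for u
    using reparametrization_range[OF \<phi> that] reparametrization_range[OF \<psi> that] r
    by (auto intro!: convex_bound_le)
  show "(1 - r) * \<phi> u + r * \<psi> u \<le> (1 - r) * \<phi> v + r * \<psi> v" if "0 \<le> u" "u \<le> v" "v \<le> 1" for u v
    using reparametrization_mono[OF \<phi> that] reparametrization_mono[OF \<psi> that] r
    by (intro add_mono mult_left_mono) auto
qed

locale dspace =
  fixes X :: "'a dspace"
  assumes is_dspace: "is_dspace X"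
begin

abbreviation paths :: "'a \<Rightarrow> 'a \<Rightarrow> (real \<Rightarrow> 'a) set" where
  "paths x y \<equiv> dpaths_between X (topspace (dtop X)) {x} {y}"

lemma dpath_mapping_space: "\<omega> \<in> dpaths X \<Longrightarrow> \<omega> \<in> mapping_space unit_interval (dtop X)"
  using is_dspace by (auto simp: is_dspace_def d_structure_def)

lemma dpath_continuous: "\<omega> \<in> dpaths X \<Longrightarrow> continuous_map unit_interval (dtop X) \<omega>"
  using dpath_mapping_space by (simp add: mapping_space_def)

lemma dpath_extensional: "\<omega> \<in> dpaths X \<Longrightarrow> \<omega> \<in> extensional {0..1}"
  using dpath_mapping_space by (simp add: mapping_space_def)

lemma dpath_in_space: "\<lbrakk>\<omega> \<in> dpaths X; 0 \<le> u; u \<le> 1\<rbrakk> \<Longrightarrow> \<omega> u \<in> topspace (dtop X)"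
  using dpath_continuous by (fastforce simp: continuous_map_def Pi_iff)

lemma dpath_const: "x \<in> topspace (dtop X) \<Longrightarrow> const_path x \<in> dpaths X"
  using is_dspace by (simp add: is_dspace_def d_structure_def)

lemma dpath_concat: "\<lbrakk>\<alpha> \<in> dpaths X; \<beta> \<in> dpaths X; \<alpha> 1 = \<beta> 0\<rbrakk> \<Longrightarrow> path_concat \<alpha> \<beta> \<in> dpaths X"
  using is_dspace by (simp add: is_dspace_def d_structure_def)

lemma dpath_reparametrize:
  "\<lbrakk>\<omega> \<in> dpaths X; reparametrization \<phi>\<rbrakk> \<Longrightarrow> restrict (\<lambda>u. \<omega> (\<phi> u)) {0..1} \<in> dpaths X"
  using is_dspace by (simp add: is_dspace_def d_structure_def reparametrization_def o_def)

lemma paths_iff: "\<omega> \<in> paths x y \<longleftrightarrow> \<omega> \<in> dpaths X \<and> \<omega> 0 = x \<and> \<omega> 1 = y"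
  using dpath_in_space by (auto simp: dpaths_between_def dpaths_in_def)

text \<open>A path is a d-path if its two parts are; it is a reparametrization of their concatenation that takes \<open>c\<close>
to \<open>1/2\<close>. Unlike concatenation itself, this allows a cut at any time.\<close>

lemma dpath_split:
  assumes c: "0 < c" "c < 1"
    and "restrict (\<lambda>u. \<omega> (c * u)) {0..1} \<in> dpaths X"
    and "restrict (\<lambda>u. \<omega> (c + (1 - c) * u)) {0..1} \<in> dpaths X"
  shows "restrict \<omega> {0..1} \<in> dpaths X"
proof -
  let ?\<alpha> = "restrict (\<lambda>u. \<omega> (c * u)) {0..1}" and ?\<beta> = "restrict (\<lambda>u. \<omega> (c + (1 - c) * u)) {0..1}"
  let ?\<phi> = "\<lambda>u. if u \<le> c then u / (2 * c) else 1/2 + (u - c) / (2 * (1 - c))"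
  have "path_concat ?\<alpha> ?\<beta> \<in> dpaths X" by (rule dpath_concat[OF assms(3,4)]) simp
  moreover have "reparametrization ?\<phi>"
  proof (rule reparametrizationI)
    show "continuous_on {0..1} ?\<phi>"
    proof (rule continuous_on_subset[of "{0..c} \<union> {c..1}"])
      show "continuous_on ({0..c} \<union> {c..1}) ?\<phi>"
        using c by (intro continuous_on_cases) (auto intro!: continuous_intros)
    qed auto
    show "0 \<le> ?\<phi> u \<and> ?\<phi> u \<le> 1" if "0 \<le> u" "u \<le> 1" for u
      using that c by (auto simp: field_simps)
    show "?\<phi> u \<le> ?\<phi> v" if "0 \<le> u" "u \<le> v" "v \<le> 1" for u v
    proof -
      consider "v \<le> c" | "u \<le> c" "c < v" | "c < u" by linarith
      then show ?thesis
      proof cases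
        case 2
        then have "u / (2 * c) \<le> 1/2" "0 \<le> (v - c) / (2 * (1 - c))"
          using c by (simp_all add: field_simps)
        then have "u / (2 * c) \<le> 1/2 + (v - c) / (2 * (1 - c))" by linarith
        then show ?thesis using 2 by simp
      qed (use that c in \<open>auto intro!: divide_right_mono\<close>)
    qed
  qed
  ultimately have "restrict (\<lambda>u. path_concat ?\<alpha> ?\<beta> (?\<phi> u)) {0..1} \<in> dpaths X"
    by (rule dpath_reparametrize)
  also have "restrict (\<lambda>u. path_concat ?\<alpha> ?\<beta> (?\<phi> u)) {0..1} = restrict \<omega> {0..1}"
  proof (rule restrict_ext)
    fix u :: real assume u: "u \<in> {0..1}"
    show "path_concat ?\<alpha> ?\<beta> (?\<phi> u) = \<omega> u"
    proof (cases "u \<le> c")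
      case True
      then have "0 \<le> u / (2 * c)" "u / (2 * c) \<le> 1 / 2" "u / c \<le> 1" using u c by (auto simp: field_simps)
      then show ?thesis using True c u by (simp add: path_concat_def)
    next
      case False
      define d where "d = (u - c) / (2 * (1 - c))"
      have "0 < d" "d \<le> 1/2" "c + (1 - c) * (2 * d) = u" using False u c by (auto simp: d_def field_simps)
      then have "path_concat ?\<alpha> ?\<beta> (1/2 + d) = \<omega> u" by (simp add: path_concat_def algebra_simps)
      then show ?thesis using False by (simp add: d_def)
    qed
  qed
  finally show ?thesis .
qed

lemma topspace_path_space [simp]: "topspace (path_space X x y) = paths x y"
  using dpath_mapping_space by (auto simp: path_space_def paths_iff)

lemma continuous_map_into_path_space:
  assumes "continuous_map (prod_topology Z unit_interval) (dtop X) (\<lambda>(z, u). h z u)"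
    and "\<And>z. z \<in> topspace Z \<Longrightarrow> restrict (h z) {0..1} \<in> paths x y"
  shows "continuous_map Z (path_space X x y) (\<lambda>z. restrict (h z) {0..1})"
  unfolding path_space_def continuous_map_in_subtopology
  using continuous_map_compact_open_curry[OF assms(1)] assms(2) by auto

lemma continuous_map_path_eval:
  assumes f: "continuous_map Z (path_space X x y) f" and b: "continuous_map Z unit_interval b"
  shows "continuous_map Z (dtop X) (\<lambda>z. f z (b z))"
proof -
  have "continuous_map Z (compact_open_topology unit_interval (dtop X)) f"
    using f by (auto simp: path_space_def continuous_map_in_subtopology)
  then have "continuous_map Z (prod_topology (compact_open_topology unit_interval (dtop X)) unit_interval) (\<lambda>z. (f z, b z))"
    using b by (rule continuous_map_pairedI)
  from continuous_map_compose[OF this continuous_map_compact_open_eval] show ?thesis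
    by (simp add: o_def)
qed

lemma path_concat_paths: "\<lbrakk>\<alpha> \<in> paths x y; \<beta> \<in> paths y z\<rbrakk> \<Longrightarrow> path_concat \<alpha> \<beta> \<in> paths x z"
  using dpath_concat by (auto simp: paths_iff path_concat_def)

lemma continuous_map_snd_real: "continuous_map (prod_topology Z unit_interval) euclideanreal snd"
  using continuous_map_snd[of Z unit_interval] by (simp add: continuous_map_in_subtopology)

lemma continuous_map_path_concat:
  assumes f: "continuous_map Z (path_space X x y) f" and g: "continuous_map Z (path_space X y z) g"
  shows "continuous_map Z (path_space X x z) (\<lambda>w. path_concat (f w) (g w))"
proof -
  let ?P = "prod_topology Z unit_interval"
  have fp: "f w \<in> paths x y" "g w \<in> paths y z" if "w \<in> topspace Z" for w
    using f g that by (auto simp: continuous_map_def)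
  let ?h = "\<lambda>w u. if u \<le> 1/2 then f w (2 * u) else g w (2 * u - 1)"
  have "continuous_map ?P (dtop X) (\<lambda>v. if snd v \<le> 1/2 then f (fst v) (2 * snd v) else g (fst v) (2 * snd v - 1))"
  proof (rule continuous_map_cases_le)
    show "continuous_map ?P euclideanreal snd" by (rule continuous_map_snd_real)
    show "continuous_map (subtopology ?P {v \<in> topspace ?P. snd v \<le> 1/2}) (dtop X) (\<lambda>v. f (fst v) (2 * snd v))"
    proof (rule continuous_map_path_eval)
      show "continuous_map (subtopology ?P {v \<in> topspace ?P. snd v \<le> 1/2}) (path_space X x y) (\<lambda>v. f (fst v))"
        using continuous_map_from_subtopology[OF continuous_map_compose[OF continuous_map_fst f]] by (simp add: o_def)
      show "continuous_map (subtopology ?P {v \<in> topspace ?P. snd v \<le> 1/2}) unit_interval (\<lambda>v. 2 * snd v)"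
        using continuous_map_from_subtopology[OF continuous_map_real_mult_left[OF continuous_map_snd_real]]
        by (auto simp: continuous_map_in_subtopology)
    qed
    show "continuous_map (subtopology ?P {v \<in> topspace ?P. 1/2 \<le> snd v}) (dtop X) (\<lambda>v. g (fst v) (2 * snd v - 1))"
    proof (rule continuous_map_path_eval)
      show "continuous_map (subtopology ?P {v \<in> topspace ?P. 1/2 \<le> snd v}) (path_space X y z) (\<lambda>v. g (fst v))"
        using continuous_map_from_subtopology[OF continuous_map_compose[OF continuous_map_fst g]] by (simp add: o_def)
      have "continuous_map ?P euclideanreal (\<lambda>v. 2 * snd v - 1)"
        by (intro continuous_intros continuous_map_snd_real) auto
      from continuous_map_from_subtopology[OF this]
      show "continuous_map (subtopology ?P {v \<in> topspace ?P. 1/2 \<le> snd v}) unit_interval (\<lambda>v. 2 * snd v - 1)"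
        by (auto simp: continuous_map_in_subtopology)
    qed
    fix v assume v: "v \<in> topspace ?P" "snd v = 1/2"
    then have "f (fst v) 1 = g (fst v) 0" using fp[of "fst v"] unfolding paths_iff by auto
    then show "f (fst v) (2 * snd v) = g (fst v) (2 * snd v - 1)" by (simp add: v(2))
  qed simp
  then have "continuous_map ?P (dtop X) (\<lambda>(w, u). ?h w u)" by (simp add: case_prod_unfold)
  moreover have "restrict (?h w) {0..1} \<in> paths x z" if "w \<in> topspace Z" for w
    using path_concat_paths[OF fp[OF that]] by (simp add: path_concat_def)
  ultimately show ?thesis
    unfolding path_concat_def by (rule continuous_map_into_path_space)
qed

subsection \<open>Directed flows\<close>

text \<open>In the second clause the time of the flow and the time of the path run independently. This is the form that
survives concatenation and reparametrization of \<open>\<omega>\<close> and that yields the homotopies below.\<close>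

definition directed_flow :: "(real \<Rightarrow> 'a \<Rightarrow> 'a) \<Rightarrow> bool" where
  "directed_flow \<Theta> \<longleftrightarrow>
     continuous_map (prod_topology unit_interval (dtop X)) (dtop X) (\<lambda>(s, z). \<Theta> s z) \<and>
     (\<forall>\<omega>\<in>dpaths X. \<forall>a b. reparametrization a \<and> reparametrization b \<longrightarrow>
        restrict (\<lambda>u. \<Theta> (a u) (\<omega> (b u))) {0..1} \<in> dpaths X)"

lemma flow_dpath:
  "\<lbrakk>directed_flow \<Theta>; \<omega> \<in> dpaths X; reparametrization a; reparametrization b\<rbrakk> \<Longrightarrow>
     restrict (\<lambda>u. \<Theta> (a u) (\<omega> (b u))) {0..1} \<in> dpaths X"
  by (simp add: directed_flow_def)

lemma continuous_map_flow:
  assumes \<Theta>: "directed_flow \<Theta>" and a: "continuous_map Z unit_interval a" and f: "continuous_map Z (dtop X) f"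
  shows "continuous_map Z (dtop X) (\<lambda>z. \<Theta> (a z) (f z))"
proof -
  have "continuous_map (prod_topology unit_interval (dtop X)) (dtop X) (\<lambda>(s, z). \<Theta> s z)"
    using \<Theta> by (simp add: directed_flow_def)
  from continuous_map_compose[OF continuous_map_pairedI[OF a f] this] show ?thesis
    by (simp add: o_def)
qed

lemma directed_flow_trivial: "directed_flow (\<lambda>s z. z)"
  unfolding directed_flow_def using dpath_reparametrize by (auto simp: case_prod_unfold continuous_map_snd)

end

lemma reparametrization_basic:
  "reparametrization (\<lambda>u. u)" "0 \<le> c \<Longrightarrow> c \<le> 1 \<Longrightarrow> reparametrization (\<lambda>u. c)"
  "reparametrization (\<lambda>u. min 1 (2 * u))" "reparametrization (\<lambda>u. max 0 (4 * u - 3))"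
  by (rule reparametrizationI; auto intro!: continuous_intros)+

lemma reparametrization_affine:
  "\<lbrakk>0 \<le> c; c \<le> 1\<rbrakk> \<Longrightarrow> reparametrization (\<lambda>u. c * u)"
  "\<lbrakk>0 \<le> c; c \<le> 1\<rbrakk> \<Longrightarrow> reparametrization (\<lambda>u. c + (1 - c) * u)"
  "reparametrization (\<lambda>u. max 0 (2 * u - 1))"
proof -
  assume c: "0 \<le> c" "c \<le> 1"
  show "reparametrization (\<lambda>u. c * u)"
  proof (rule reparametrizationI)
    show "0 \<le> c * u \<and> c * u \<le> 1" if "0 \<le> u" "u \<le> 1" for u
      using c that mult_mono[of c 1 u 1] by simp
    show "c * u \<le> c * v" if "u \<le> v" for u v using that c(1) by (rule mult_left_mono)
  qed (intro continuous_intros)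
  have "c + (1 - c) * u \<le> 1" if "u \<le> 1" for u
    using mult_left_mono[OF that, of "1 - c"] c by simp
  then have le1: "\<And>u. u \<le> 1 \<Longrightarrow> c + (1 - c) * u \<le> 1" .
  show "reparametrization (\<lambda>u. c + (1 - c) * u)"
  proof (rule reparametrizationI)
    show "0 \<le> c + (1 - c) * u \<and> c + (1 - c) * u \<le> 1" if "0 \<le> u" "u \<le> 1" for u
      using c that le1 by simp
    show "c + (1 - c) * u \<le> c + (1 - c) * v" if "u \<le> v" for u v
      using mult_left_mono[OF that, of "1 - c"] c by simp
  qed (intro continuous_intros)
qed (rule reparametrizationI; auto intro!: continuous_intros)

lemma reparametrization_reverse:
  assumes \<phi>: "reparametrization \<phi>"
  shows "reparametrization (\<lambda>u. 1 - \<phi> (1 - u))"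
proof (rule reparametrizationI)
  show "continuous_on {0..1} (\<lambda>u. 1 - \<phi> (1 - u))"
    by (intro continuous_intros continuous_on_compose2[OF reparametrization_continuous[OF \<phi>]]) auto
  show "0 \<le> 1 - \<phi> (1 - u) \<and> 1 - \<phi> (1 - u) \<le> 1" if "0 \<le> u" "u \<le> 1" for u
    using reparametrization_range[OF \<phi>, of "1 - u"] that by simp
  show "1 - \<phi> (1 - u) \<le> 1 - \<phi> (1 - v)" if "0 \<le> u" "u \<le> v" "v \<le> 1" for u v
    using reparametrization_mono[OF \<phi>, of "1 - v" "1 - u"] that by simp
qed

lemma continuous_map_into_interval:
  "\<lbrakk>continuous_map Z euclideanreal f; \<And>z. z \<in> topspace Z \<Longrightarrow> f z \<in> {0..1}\<rbrakk> \<Longrightarrow> continuous_map Z unit_interval f"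
  by (auto simp: continuous_map_in_subtopology)

context dspace
begin

text \<open>Reparametrizations form a convex set. The homotopy joins the pair of the zero function and the
identity to the pair \<open>(a, b)\<close> by a straight line; the start remains fixed because \<open>a\<close> and \<open>b\<close> vanish
there, and the end because \<open>y\<close> is fixed by the flow.\<close>

lemma homotopic_flow_reparametrize:
  assumes \<Theta>: "directed_flow \<Theta>" and id: "\<And>z. z \<in> topspace (dtop X) \<Longrightarrow> \<Theta> 0 z = z"
    and y: "\<And>s. \<lbrakk>0 \<le> s; s \<le> 1\<rbrakk> \<Longrightarrow> \<Theta> s y = y"
    and a: "reparametrization a" "a 0 = 0" and b: "reparametrization b" "b 0 = 0" "b 1 = 1"
  shows "homotopic_with (\<lambda>_. True) (path_space X x y) (path_space X x y) id
    (\<lambda>\<omega>. restrict (\<lambda>u. \<Theta> (a u) (\<omega> (b u))) {0..1})"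
proof -
  let ?P = "path_space X x y" and ?Q = "prod_topology unit_interval (path_space X x y)"
  let ?W = "prod_topology ?Q unit_interval"
  let ?a = "\<lambda>r u. (1 - r) * 0 + r * a u" and ?b = "\<lambda>r u. (1 - r) * u + r * b u"
  have ra: "reparametrization (?a r)" "reparametrization (?b r)" if "0 \<le> r" "r \<le> 1" for r
    using that by (intro reparametrization_convex reparametrization_basic a b; simp)+
  let ?h = "\<lambda>w u. \<Theta> (?a (fst w) u) (snd w (?b (fst w) u))"
  have r: "continuous_map ?W euclideanreal (\<lambda>w. fst (fst w))"
    using continuous_map_compose[OF continuous_map_fst continuous_map_fst_real, of ?P unit_interval]
    by (simp add: o_def)
  have u: "continuous_map ?W euclideanreal (\<lambda>w. \<phi> (snd w))" if "reparametrization \<phi>" for \<phi>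
    using continuous_map_compose[OF continuous_map_snd, of unit_interval euclideanreal \<phi> ?Q]
      reparametrization_continuous[OF that] by (simp add: o_def)
  have \<omega>: "continuous_map ?W ?P (\<lambda>w. snd (fst w))"
    using continuous_map_compose[OF continuous_map_fst continuous_map_snd] by (simp add: o_def)
  have "continuous_map ?W (dtop X) (\<lambda>w. ?h (fst w) (snd w))"
  proof (intro continuous_map_flow[OF \<Theta>] continuous_map_path_eval[OF \<omega>])
    show "continuous_map ?W unit_interval (\<lambda>w. ?a (fst (fst w)) (snd w))"
      by (rule continuous_map_into_interval)
        (use reparametrization_range[OF ra(1)] in \<open>auto intro!: continuous_intros r u a\<close>)
    show "continuous_map ?W unit_interval (\<lambda>w. ?b (fst (fst w)) (snd w))"
      by (rule continuous_map_into_interval)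
        (use reparametrization_range[OF ra(2)] in \<open>auto intro!: continuous_intros r u b continuous_map_snd_real\<close>)
  qed
  then have c: "continuous_map ?W (dtop X) (\<lambda>(w, u). ?h w u)" by (simp add: case_prod_unfold)
  have p: "restrict (?h w) {0..1} \<in> paths x y" if w: "w \<in> topspace ?Q" for w
  proof -
    have w': "0 \<le> fst w" "fst w \<le> 1" "snd w \<in> dpaths X" "snd w 0 = x" "snd w 1 = y"
      using w by (auto simp: paths_iff)
    have "x \<in> topspace (dtop X)" using dpath_in_space[OF w'(3), of 0] w'(4) by simp
    moreover have "0 \<le> fst w * a 1" "fst w * a 1 \<le> 1"
      using reparametrization_range[OF ra(1)[OF w'(1,2)], of 1] by simp_all
    ultimately show ?thesis
      using flow_dpath[OF \<Theta> w'(3) ra[OF w'(1,2)]] w' by (auto simp: paths_iff id y a b)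
  qed
  show ?thesis
  proof (subst homotopic_with, simp, intro exI[of _ "\<lambda>w. restrict (?h w) {0..1}"] conjI ballI)
    show "continuous_map ?Q ?P (\<lambda>w. restrict (?h w) {0..1})"
      by (rule continuous_map_into_path_space[OF c p])
    show "restrict (?h (0, \<omega>)) {0..1} = id \<omega>" if "\<omega> \<in> topspace ?P" for \<omega>
    proof (rule ext)
      have "\<omega> \<in> dpaths X" using that by (simp add: paths_iff)
      then show "restrict (?h (0, \<omega>)) {0..1} u = id \<omega> u" for u
        using extensional_arb[OF dpath_extensional, of \<omega> u] dpath_in_space[of \<omega> u] id by auto
    qed
    show "restrict (?h (1, \<omega>)) {0..1} = restrict (\<lambda>u. \<Theta> (a u) (\<omega> (b u))) {0..1}" for \<omega>
      by simp
  qed simp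
qed

definition flow_line :: "(real \<Rightarrow> 'a \<Rightarrow> 'a) \<Rightarrow> 'a \<Rightarrow> real \<Rightarrow> 'a" where
  "flow_line \<Theta> x = restrict (\<lambda>u. \<Theta> u x) {0..1}"

definition flow_image :: "(real \<Rightarrow> 'a \<Rightarrow> 'a) \<Rightarrow> (real \<Rightarrow> 'a) \<Rightarrow> real \<Rightarrow> 'a" where
  "flow_image \<Theta> \<omega> = restrict (\<lambda>u. \<Theta> 1 (\<omega> u)) {0..1}"

lemma flow_line_paths:
  assumes \<Theta>: "directed_flow \<Theta>" and x: "x \<in> topspace (dtop X)"
  shows "flow_line \<Theta> x \<in> paths (\<Theta> 0 x) (\<Theta> 1 x)"
proof -
  have "restrict (\<lambda>u. \<Theta> u (const_path x u)) {0..1} \<in> dpaths X"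
    using flow_dpath[OF \<Theta> dpath_const[OF x] reparametrization_basic(1) reparametrization_basic(1)] .
  then have "flow_line \<Theta> x \<in> dpaths X"
    by (rule back_subst[of "\<lambda>z. z \<in> dpaths X"]) (auto simp: const_path_def flow_line_def)
  then show ?thesis by (simp add: paths_iff flow_line_def)
qed

lemma flow_image_paths:
  assumes \<Theta>: "directed_flow \<Theta>" and \<omega>: "\<omega> \<in> paths x y"
  shows "flow_image \<Theta> \<omega> \<in> paths (\<Theta> 1 x) (\<Theta> 1 y)"
  using flow_dpath[OF \<Theta> _ reparametrization_basic(2)[of 1] reparametrization_basic(1), of \<omega>] \<omega>
  by (auto simp: paths_iff flow_image_def)

lemma continuous_map_flow_image:
  assumes \<Theta>: "directed_flow \<Theta>"
  shows "continuous_map (path_space X x y) (path_space X (\<Theta> 1 x) (\<Theta> 1 y)) (flow_image \<Theta>)"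
  unfolding flow_image_def
proof (rule continuous_map_into_path_space)
  show "continuous_map (prod_topology (path_space X x y) unit_interval) (dtop X) (\<lambda>(\<omega>, u). \<Theta> 1 (\<omega> u))"
    unfolding case_prod_unfold
    by (intro continuous_map_flow[OF \<Theta>] continuous_map_path_eval[OF continuous_map_fst continuous_map_snd]) auto
  show "restrict (\<lambda>u. \<Theta> 1 (\<omega> u)) {0..1} \<in> paths (\<Theta> 1 x) (\<Theta> 1 y)" if "\<omega> \<in> topspace (path_space X x y)" for \<omega>
    using flow_image_paths[OF \<Theta>, of \<omega> x y] that by (simp add: flow_image_def)
qed

text \<open>Up to homotopy, a d-path to a fixed point may first follow the flow line of its start and then its own
image under the time one map.\<close>

lemma homotopic_flow_line_concat:
  assumes \<Theta>: "directed_flow \<Theta>" and id: "\<And>z. z \<in> topspace (dtop X) \<Longrightarrow> \<Theta> 0 z = z"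
    and y: "\<And>s. \<lbrakk>0 \<le> s; s \<le> 1\<rbrakk> \<Longrightarrow> \<Theta> s y = y"
  shows "homotopic_with (\<lambda>_. True) (path_space X x y) (path_space X x y) id
    (\<lambda>\<omega>. path_concat (flow_line \<Theta> x) (flow_image \<Theta> \<omega>))"
proof -
  let ?f = "\<lambda>\<omega>. restrict (\<lambda>u. \<Theta> (min 1 (2 * u)) (\<omega> (max 0 (2 * u - 1)))) {0..1}"
  have h: "homotopic_with (\<lambda>_. True) (path_space X x y) (path_space X x y) id ?f"
    by (rule homotopic_flow_reparametrize[OF \<Theta> id y])
      (simp_all add: reparametrization_basic reparametrization_affine)
  have "?f \<omega> = path_concat (flow_line \<Theta> x) (flow_image \<Theta> \<omega>)" if "\<omega> \<in> topspace (path_space X x y)" for \<omega>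
    using that unfolding path_concat_def
    by (intro restrict_ext) (auto simp: paths_iff flow_line_def flow_image_def)
  then show ?thesis by (intro homotopic_with_eq[OF h]) simp_all
qed

end

locale loop_free_dspace = dspace X for X :: "'a dspace" +
  assumes no_loops: "\<omega> \<in> paths x x \<Longrightarrow> \<omega> = const_path x"
begin

lemma flow_image_loop:
  assumes \<Theta>: "directed_flow \<Theta>" and \<alpha>: "\<alpha> \<in> paths x y" and eq: "\<Theta> 1 x = \<Theta> 1 y"
    and u: "0 \<le> u" "u \<le> 1"
  shows "\<Theta> 1 (\<alpha> u) = \<Theta> 1 y"
proof -
  have "flow_image \<Theta> \<alpha> = const_path (\<Theta> 1 y)"
    using no_loops flow_image_paths[OF \<Theta> \<alpha>] eq by simp
  then have "flow_image \<Theta> \<alpha> u = const_path (\<Theta> 1 y) u" by simp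
  then show ?thesis using u by (simp add: flow_image_def const_path_def)
qed

text \<open>The homotopy inverse \<open>g\<close> sends \<open>\<omega>\<close> to the flow line of \<open>x\<close> followed by \<open>\<Theta> 1 \<circ> \<omega>\<close>, which starts at the right
point by \<open>\<Theta> 1 x' = \<Theta> 1 x\<close>. In both compositions the loop \<open>\<Theta> 1 \<circ> \<alpha>\<close> is constant. For \<open>g (\<alpha> * \<omega>)\<close>
this leaves the flow line, a pause and \<open>\<Theta> 1 \<circ> \<omega>\<close>. For \<open>\<alpha> * g \<omega>\<close> the square \<open>(s, u) \<mapsto> \<Theta> s (\<alpha> u)\<close>
provides a homotopy from \<open>\<alpha>\<close> followed by the flow line of \<open>x\<close> to the flow line of \<open>x'\<close>.\<close>

lemma push_start_homotopy_equivalence: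
  assumes \<Theta>: "directed_flow \<Theta>" and id: "\<And>z. z \<in> topspace (dtop X) \<Longrightarrow> \<Theta> 0 z = z"
    and \<alpha>: "\<alpha> \<in> paths x' x" and eq: "\<Theta> 1 x' = \<Theta> 1 x"
    and y: "\<And>s. \<lbrakk>0 \<le> s; s \<le> 1\<rbrakk> \<Longrightarrow> \<Theta> s y = y"
  shows "homotopy_equivalence (path_space X x y) (path_space X x' y) (path_concat \<alpha>)"
proof -
  let ?p = "\<Theta> 1 x" and ?P = "path_space X x y" and ?P' = "path_space X x' y"
  define g where "g \<omega> = path_concat (flow_line \<Theta> x) (flow_image \<Theta> \<omega>)" for \<omega>
  have \<alpha>d: "\<alpha> \<in> dpaths X" "\<alpha> 0 = x'" "\<alpha> 1 = x" using \<alpha> by (auto simp: paths_iff)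
  have x: "x \<in> topspace (dtop X)" "x' \<in> topspace (dtop X)"
    using dpath_in_space[OF \<alpha>d(1), of 1] dpath_in_space[OF \<alpha>d(1), of 0] \<alpha>d by simp_all
  have line: "flow_line \<Theta> x \<in> paths x ?p" using flow_line_paths[OF \<Theta> x(1)] by (simp add: id x)
  note \<alpha>1 = flow_image_loop[OF \<Theta> \<alpha> eq]
  have image: "continuous_map ?P' (path_space X ?p y) (flow_image \<Theta>)"
    using continuous_map_flow_image[OF \<Theta>, of x' y] by (simp add: eq y)
  have cf: "continuous_map ?P ?P' (path_concat \<alpha>)"
    using continuous_map_path_concat[of ?P x' x "\<lambda>_. \<alpha>" y "\<lambda>\<omega>. \<omega>"] \<alpha> by simp
  have cg: "continuous_map ?P' ?P g"
    unfolding g_def by (rule continuous_map_path_concat[OF _ image]) (simp add: line)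
  have "homotopic_with (\<lambda>_. True) ?P ?P id (g \<circ> path_concat \<alpha>)"
  proof -
    \<comment> \<open>the pause between \<open>1/2\<close> and \<open>3/4\<close> is the time that \<open>\<Theta> 1 \<circ> \<alpha>\<close> takes in \<open>g (\<alpha> * \<omega>)\<close>\<close>
    let ?f = "\<lambda>\<omega>. restrict (\<lambda>u. \<Theta> (min 1 (2 * u)) (\<omega> (max 0 (4 * u - 3)))) {0..1}"
    have h: "homotopic_with (\<lambda>_. True) ?P ?P id ?f"
      by (rule homotopic_flow_reparametrize[OF \<Theta> id y]) (simp_all add: reparametrization_basic)
    have "?f \<omega> = (g \<circ> path_concat \<alpha>) \<omega>" if "\<omega> \<in> topspace ?P" for \<omega>
    proof -
      have \<omega>0: "\<omega> 0 = x" using that by (simp add: paths_iff)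
      have "\<Theta> (min 1 (2 * u)) (\<omega> (max 0 (4 * u - 3))) =
          (if u \<le> 1/2 then flow_line \<Theta> x (2 * u) else flow_image \<Theta> (path_concat \<alpha> \<omega>) (2 * u - 1))"
        if u: "u \<in> {0..1}" for u
      proof -
        consider "0 \<le> u" "u \<le> 1/2" | "1/2 < u" "u \<le> 3/4" | "3/4 < u" "u \<le> 1" using u by fastforce
        then show ?thesis
        proof cases
          case 1
          then have "min 1 (2 * u) = 2 * u" "max 0 (4 * u - 3) = 0" by auto
          then show ?thesis using 1 by (simp add: flow_line_def \<omega>0)
        next
          case 2
          then have "min 1 (2 * u) = 1" "max 0 (4 * u - 3) = 0" by auto
          then show ?thesis using 2 by (simp add: path_concat_def flow_image_def \<omega>0 \<alpha>1)
        next
          case 3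
          then have "min 1 (2 * u) = 1" "max 0 (4 * u - 3) = 4 * u - 3" by auto
          then show ?thesis using 3 by (simp add: path_concat_def flow_image_def)
        qed
      qed
      then show ?thesis unfolding g_def o_def path_concat_def[of "flow_line \<Theta> x"] by (intro restrict_ext)
    qed
    then show ?thesis by (intro homotopic_with_eq[OF h]) simp_all
  qed
  moreover have "homotopic_with (\<lambda>_. True) ?P' ?P' id (path_concat \<alpha> \<circ> g)"
  proof -
    \<comment> \<open>a homotopy from the flow line of \<open>x'\<close> to \<open>\<alpha>\<close> followed by the flow line of \<open>x\<close>\<close>
    define Q where "Q r = restrict (\<lambda>u. \<Theta> ((1 - r) * u + r * max 0 (2 * u - 1)) (\<alpha> ((1 - r) * 0 + r * min 1 (2 * u)))) {0..1}" for r
    have rep: "reparametrization (\<lambda>u. (1 - r) * u + r * max 0 (2 * u - 1))"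
      "reparametrization (\<lambda>u. (1 - r) * 0 + r * min 1 (2 * u))" if "0 \<le> r" "r \<le> 1" for r
      using that by (intro reparametrization_convex reparametrization_basic reparametrization_affine; simp)+
    have Q: "continuous_map unit_interval (path_space X x' ?p) Q"
      unfolding Q_def
    proof (rule continuous_map_into_path_space)
      let ?W = "prod_topology unit_interval unit_interval"
      have "continuous_map ?W unit_interval (\<lambda>w. (1 - fst w) * snd w + fst w * max 0 (2 * snd w - 1))"
        "continuous_map ?W unit_interval (\<lambda>w. (1 - fst w) * 0 + fst w * min 1 (2 * snd w))"
        by (rule continuous_map_into_interval, use reparametrization_range[OF rep(1)] reparametrization_range[OF rep(2)]
          in \<open>auto intro!: continuous_intros continuous_map_fst_real continuous_map_snd_real\<close>)+
      from continuous_map_flow[OF \<Theta> this(1) continuous_map_compose[OF this(2) dpath_continuous[OF \<alpha>d(1)]]]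
      show "continuous_map ?W (dtop X) (\<lambda>(r, u). \<Theta> ((1 - r) * u + r * max 0 (2 * u - 1)) (\<alpha> ((1 - r) * 0 + r * min 1 (2 * u))))"
        by (simp add: case_prod_unfold o_def)
      show "restrict (\<lambda>u. \<Theta> ((1 - r) * u + r * max 0 (2 * u - 1)) (\<alpha> ((1 - r) * 0 + r * min 1 (2 * u)))) {0..1} \<in> paths x' ?p"
        if "r \<in> topspace unit_interval" for r
        using flow_dpath[OF \<Theta> \<alpha>d(1) rep[of r]] that by (simp add: paths_iff \<alpha>d id x \<alpha>1)
    qed
    have 1: "homotopic_with (\<lambda>_. True) ?P' ?P' (\<lambda>\<omega>. path_concat (Q 0) (flow_image \<Theta> \<omega>)) (\<lambda>\<omega>. path_concat (Q 1) (flow_image \<Theta> \<omega>))"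
      unfolding homotopic_with_def
    proof (intro exI[of _ "\<lambda>w. path_concat (Q (fst w)) (flow_image \<Theta> (snd w))"] conjI)
      show "continuous_map (prod_topology unit_interval ?P') ?P' (\<lambda>w. path_concat (Q (fst w)) (flow_image \<Theta> (snd w)))"
        using continuous_map_compose[OF continuous_map_fst Q] continuous_map_compose[OF continuous_map_snd image]
        by (intro continuous_map_path_concat) (simp_all add: o_def)
    qed auto
    have Q0: "Q 0 = flow_line \<Theta> x'" by (simp add: Q_def flow_line_def \<alpha>d)
    \<comment> \<open>this reparametrization changes the bracketing of a threefold concatenation\<close>
    let ?\<psi> = "\<lambda>u :: real. min (2 * u) (min (u + 1/4) (u / 2 + 1/2))"
    have \<psi>: "reparametrization ?\<psi>"
      by (rule reparametrizationI) (auto intro!: continuous_intros)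
    have 2: "homotopic_with (\<lambda>_. True) ?P' ?P' id (\<lambda>\<omega>. restrict (\<lambda>u. \<omega> (?\<psi> u)) {0..1})"
      using homotopic_flow_reparametrize[OF directed_flow_trivial _ _ reparametrization_basic(2)[of 0] _ \<psi>] by simp
    have "homotopic_with (\<lambda>_. True) ?P' ?P' (id \<circ> (path_concat \<alpha> \<circ> g))
        ((\<lambda>\<omega>. restrict (\<lambda>u. \<omega> (?\<psi> u)) {0..1}) \<circ> (path_concat \<alpha> \<circ> g))"
      by (rule homotopic_with_compose_continuous_map_right[OF 2 continuous_map_compose[OF cg cf]]) simp
    moreover have "((\<lambda>\<omega>. restrict (\<lambda>u. \<omega> (?\<psi> u)) {0..1}) \<circ> (path_concat \<alpha> \<circ> g)) = (\<lambda>\<omega>. path_concat (Q 1) (flow_image \<Theta> \<omega>))"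
    proof (rule ext)
      fix \<omega>
      have \<alpha>X: "\<Theta> 0 (\<alpha> v) = \<alpha> v" if "0 \<le> v" "v \<le> 1" for v using dpath_in_space[OF \<alpha>d(1) that] id by simp
      have "path_concat \<alpha> (g \<omega>) (?\<psi> u) = (if u \<le> 1/2 then Q 1 (2 * u) else flow_image \<Theta> \<omega> (2 * u - 1))"
        if u: "u \<in> {0..1}" for u
      proof -
        consider "0 \<le> u" "u \<le> 1/4" | "1/4 < u" "u \<le> 1/2" | "1/2 < u" "u \<le> 1" using u by fastforce
        then show ?thesis
        proof cases
          case 1
          then have "?\<psi> u = 2 * u" "min 1 (2 * (2 * u)) = 2 * (2 * u)" "max 0 (2 * (2 * u) - 1) = 0" by auto
          then show ?thesis using 1 by (simp add: path_concat_def Q_def \<alpha>X)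
        next
          case 2
          then have "?\<psi> u = u + 1/4" "min 1 (2 * (2 * u)) = 1" "max 0 (2 * (2 * u) - 1) = 2 * (2 * u) - 1" by auto
          then show ?thesis using 2 by (simp add: path_concat_def g_def Q_def flow_line_def \<alpha>d)
        next
          case 3
          then have "?\<psi> u = u / 2 + 1/2" by auto
          then show ?thesis using 3 by (simp add: path_concat_def g_def flow_image_def)
        qed
      qed
      then show "((\<lambda>\<omega>. restrict (\<lambda>u. \<omega> (?\<psi> u)) {0..1}) \<circ> (path_concat \<alpha> \<circ> g)) \<omega> = path_concat (Q 1) (flow_image \<Theta> \<omega>)"
        unfolding o_def path_concat_def[of "Q 1"] by (intro restrict_ext)
    qed
    ultimately have "homotopic_with (\<lambda>_. True) ?P' ?P' (\<lambda>\<omega>. path_concat (Q 1) (flow_image \<Theta> \<omega>)) (path_concat \<alpha> \<circ> g)"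
      by (simp add: homotopic_with_symD)
    with homotopic_with_trans[OF homotopic_flow_line_concat[OF \<Theta> id y] 1[unfolded Q0]]
    show ?thesis by (rule homotopic_with_trans)
  qed
  ultimately show ?thesis
    unfolding homotopy_equivalence_def using cf cg by (intro conjI exI[of _ g])
qed

text \<open>If the flow pushes \<open>x\<close> to the fixed point \<open>y\<close>, the image of a d-path from \<open>x\<close> to \<open>y\<close> under the time
one map is a loop, hence constant. So every path is deformed to the flow line of \<open>x\<close>.\<close>

lemma paths_into_sink_contractible:
  assumes \<Theta>: "directed_flow \<Theta>" and id: "\<And>z. z \<in> topspace (dtop X) \<Longrightarrow> \<Theta> 0 z = z"
    and x: "x \<in> topspace (dtop X)" and xy: "\<Theta> 1 x = y" and y: "\<And>s. \<lbrakk>0 \<le> s; s \<le> 1\<rbrakk> \<Longrightarrow> \<Theta> s y = y"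
  shows "\<exists>c\<in>paths x y. homotopic_with (\<lambda>_. True) (path_space X x y) (path_space X x y) id (\<lambda>_. c)"
proof -
  let ?c = "path_concat (flow_line \<Theta> x) (const_path y)"
  have line: "flow_line \<Theta> x \<in> paths x y" using flow_line_paths[OF \<Theta> x] by (simp add: id x xy)
  have "y \<in> topspace (dtop X)" using line dpath_in_space[of "flow_line \<Theta> x" 1] by (auto simp: paths_iff)
  then have "const_path y \<in> paths y y" using dpath_const by (simp add: paths_iff const_path_def)
  then have c: "?c \<in> paths x y" by (rule path_concat_paths[OF line])
  note h = homotopic_flow_line_concat[OF \<Theta> id y, where x = x]
  have "flow_image \<Theta> \<omega> = const_path y" if "\<omega> \<in> topspace (path_space X x y)" for \<omega>
    using flow_image_paths[OF \<Theta>, of \<omega> x y] that no_loops by (simp add: xy y)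
  then have "homotopic_with (\<lambda>_. True) (path_space X x y) (path_space X x y) id (\<lambda>_. ?c)"
    by (intro homotopic_with_eq[OF h]) simp_all
  then show ?thesis using c by blast
qed

end

section \<open>Reversal of time\<close>

definition rev_path :: "(real \<Rightarrow> 'a) \<Rightarrow> real \<Rightarrow> 'a" where
  "rev_path \<omega> = restrict (\<lambda>u. \<omega> (1 - u)) {0..1}"

definition opposite :: "'a dspace \<Rightarrow> 'a dspace" where
  "opposite X = \<lparr>dtop = dtop X, dpaths = rev_path ` dpaths X\<rparr>"

lemma rev_rev_path: "\<omega> \<in> extensional {0..1} \<Longrightarrow> rev_path (rev_path \<omega>) = \<omega>"
  by (rule ext) (auto simp: rev_path_def extensional_def)

lemma dtop_opposite: "dtop (opposite X) = dtop X"
  by (simp add: opposite_def)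

context dspace
begin

lemma dpaths_opposite_iff: "\<omega> \<in> dpaths (opposite X) \<longleftrightarrow> \<omega> \<in> extensional {0..1} \<and> rev_path \<omega> \<in> dpaths X"
proof
  assume "\<omega> \<in> dpaths (opposite X)"
  then obtain \<gamma> where "\<gamma> \<in> dpaths X" "\<omega> = rev_path \<gamma>" by (auto simp: opposite_def)
  then show "\<omega> \<in> extensional {0..1} \<and> rev_path \<omega> \<in> dpaths X"
    using rev_rev_path[OF dpath_extensional] by (simp add: rev_path_def)
next
  assume "\<omega> \<in> extensional {0..1} \<and> rev_path \<omega> \<in> dpaths X"
  then show "\<omega> \<in> dpaths (opposite X)"
    using rev_rev_path[of \<omega>] by (force simp: opposite_def image_iff)
qed

lemma is_dspace_opposite: "is_dspace (opposite X)"
  unfolding is_dspace_def d_structure_def dtop_opposite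
proof (intro conjI ballI allI impI subsetI)
  fix \<omega> assume "\<omega> \<in> dpaths (opposite X)"
  then have \<omega>: "\<omega> \<in> extensional {0..1}" "rev_path \<omega> \<in> dpaths X" by (auto simp: dpaths_opposite_iff)
  have "continuous_map unit_interval unit_interval (\<lambda>u. 1 - u)"
    by (auto simp: continuous_map_in_subtopology intro!: continuous_intros)
  from continuous_map_compose[OF this dpath_continuous[OF \<omega>(2)]]
  have "continuous_map unit_interval (dtop X) (\<lambda>u. rev_path \<omega> (1 - u))" by (simp add: o_def)
  then have "continuous_map unit_interval (dtop X) \<omega>"
    by (rule continuous_map_eq) (auto simp: rev_path_def)
  then show "\<omega> \<in> mapping_space unit_interval (dtop X)" using \<omega> by (simp add: mapping_space_def)
next
  fix x assume "x \<in> topspace (dtop X)"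
  moreover have "rev_path (const_path x) = const_path x" by (rule ext) (simp add: rev_path_def const_path_def)
  ultimately show "const_path x \<in> dpaths (opposite X)"
    using dpath_const by (simp add: dpaths_opposite_iff) (simp add: const_path_def)
next
  fix \<alpha> \<beta> assume "\<alpha> \<in> dpaths (opposite X)" "\<beta> \<in> dpaths (opposite X)" "\<alpha> 1 = \<beta> 0"
  moreover from this have "rev_path (path_concat \<alpha> \<beta>) = path_concat (rev_path \<beta>) (rev_path \<alpha>)"
    by (auto simp: fun_eq_iff rev_path_def path_concat_def algebra_simps)
  moreover have "rev_path \<beta> 1 = \<beta> 0" "rev_path \<alpha> 0 = \<alpha> 1" by (simp_all add: rev_path_def)
  ultimately show "path_concat \<alpha> \<beta> \<in> dpaths (opposite X)"
    using dpath_concat[of "rev_path \<beta>" "rev_path \<alpha>"] by (auto simp: dpaths_opposite_iff) (simp add: path_concat_def)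
next
  fix \<alpha> and \<phi> :: "real \<Rightarrow> real"
  assume \<alpha>: "\<alpha> \<in> dpaths (opposite X)" and \<phi>: "continuous_on {0..1} \<phi> \<and> \<phi> ` {0..1} \<subseteq> {0..1} \<and> mono_on {0..1} \<phi>"
  have \<phi>': "reparametrization \<phi>" using \<phi> by (simp add: reparametrization_def)
  from dpath_reparametrize[OF _ reparametrization_reverse[OF \<phi>'], of "rev_path \<alpha>"] \<alpha>
  have "restrict (\<lambda>u. rev_path \<alpha> (1 - \<phi> (1 - u))) {0..1} \<in> dpaths X" by (simp add: dpaths_opposite_iff)
  also have "restrict (\<lambda>u. rev_path \<alpha> (1 - \<phi> (1 - u))) {0..1} = rev_path (restrict (\<alpha> \<circ> \<phi>) {0..1})"
    unfolding rev_path_def by (rule restrict_ext) (use reparametrization_range[OF \<phi>'] in auto)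
  finally show "restrict (\<alpha> \<circ> \<phi>) {0..1} \<in> dpaths (opposite X)" by (simp add: dpaths_opposite_iff)
qed

interpretation opp: dspace "opposite X" by (unfold_locales) (rule is_dspace_opposite)

lemma paths_opposite_iff: "\<omega> \<in> opp.paths y x \<longleftrightarrow> \<omega> \<in> extensional {0..1} \<and> rev_path \<omega> \<in> paths x y"
  unfolding opp.paths_iff paths_iff dpaths_opposite_iff by (auto simp: rev_path_def)

lemma rev_path_opposite: "\<omega> \<in> paths x y \<Longrightarrow> rev_path \<omega> \<in> opp.paths y x"
  unfolding paths_opposite_iff using rev_rev_path[OF dpath_extensional]
  by (auto simp: paths_iff) (simp add: rev_path_def)

lemma homeomorphic_maps_rev_path:
  "homeomorphic_maps (path_space X x y) (path_space (opposite X) y x) rev_path rev_path"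
proof -
  have j: "continuous_map (prod_topology Z unit_interval) unit_interval (\<lambda>w. 1 - snd w)" for Z :: "'b topology"
    by (rule continuous_map_into_interval) (auto intro!: continuous_intros continuous_map_snd_real)
  have "continuous_map (path_space X x y) (path_space (opposite X) y x) rev_path"
    unfolding rev_path_def
  proof (rule opp.continuous_map_into_path_space)
    show "continuous_map (prod_topology (path_space X x y) unit_interval) (dtop (opposite X)) (\<lambda>(\<omega>, u). \<omega> (1 - u))"
      unfolding case_prod_unfold dtop_opposite by (rule continuous_map_path_eval[OF continuous_map_fst j])
    show "restrict (\<lambda>u. \<omega> (1 - u)) {0..1} \<in> opp.paths y x" if "\<omega> \<in> topspace (path_space X x y)" for \<omega>
      using rev_path_opposite[of \<omega>] that by (simp add: rev_path_def)
  qed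
  moreover have "continuous_map (path_space (opposite X) y x) (path_space X x y) rev_path"
    unfolding rev_path_def
  proof (rule continuous_map_into_path_space)
    show "continuous_map (prod_topology (path_space (opposite X) y x) unit_interval) (dtop X) (\<lambda>(\<omega>, u). \<omega> (1 - u))"
      unfolding case_prod_unfold using opp.continuous_map_path_eval[OF continuous_map_fst j] by (simp add: dtop_opposite)
    show "restrict (\<lambda>u. \<omega> (1 - u)) {0..1} \<in> paths x y" if "\<omega> \<in> topspace (path_space (opposite X) y x)" for \<omega>
      using paths_opposite_iff[of \<omega>] that by (simp add: rev_path_def)
  qed
  ultimately show ?thesis
    unfolding homeomorphic_maps_def
    using rev_rev_path[OF dpath_extensional] rev_rev_path[OF opp.dpath_extensional]
    by (simp add: paths_iff opp.paths_iff)
qed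

lemma
  shows homeomorphic_map_rev_path: "homeomorphic_map (path_space X x y) (path_space (opposite X) y x) rev_path"
    and homeomorphic_map_rev_path': "homeomorphic_map (path_space (opposite X) y x) (path_space X x y) rev_path"
  using homeomorphic_maps_rev_path homeomorphic_maps_map by blast+

text \<open>Reversing also the time of the flow turns a flow that ends with the identity into one that starts with it,
so that the results about the start of d-paths apply to their ends.\<close>

lemma directed_flow_opposite:
  assumes \<Psi>: "directed_flow \<Psi>"
  shows "opp.directed_flow (\<lambda>s. \<Psi> (1 - s))"
  unfolding opp.directed_flow_def dtop_opposite
proof (intro conjI ballI allI impI)
  have "continuous_map (prod_topology unit_interval (dtop X)) unit_interval (\<lambda>w. 1 - fst w)"
    by (rule continuous_map_into_interval) (auto intro!: continuous_intros continuous_map_fst_real)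
  from continuous_map_flow[OF \<Psi> this continuous_map_snd]
  show "continuous_map (prod_topology unit_interval (dtop X)) (dtop X) (\<lambda>(s, z). \<Psi> (1 - s) z)"
    by (simp add: case_prod_unfold)
  fix \<omega> and a b :: "real \<Rightarrow> real"
  assume \<omega>: "\<omega> \<in> dpaths (opposite X)" and ab: "reparametrization a \<and> reparametrization b"
  have "restrict (\<lambda>u. \<Psi> (1 - a (1 - u)) (rev_path \<omega> (1 - b (1 - u)))) {0..1} \<in> dpaths X"
    by (rule flow_dpath[OF \<Psi>]) (use \<omega> ab reparametrization_reverse in \<open>auto simp: dpaths_opposite_iff\<close>)
  also have "restrict (\<lambda>u. \<Psi> (1 - a (1 - u)) (rev_path \<omega> (1 - b (1 - u)))) {0..1} =
      rev_path (restrict (\<lambda>u. \<Psi> (1 - a u) (\<omega> (b u))) {0..1})"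
    unfolding rev_path_def by (rule restrict_ext) (use reparametrization_range[of b] ab in auto)
  finally show "restrict (\<lambda>u. \<Psi> (1 - a u) (\<omega> (b u))) {0..1} \<in> dpaths (opposite X)"
    by (simp add: dpaths_opposite_iff)
qed

end

context loop_free_dspace
begin

lemma loop_free_opposite: "loop_free_dspace (opposite X)"
proof -
  interpret opp: dspace "opposite X" by unfold_locales (rule is_dspace_opposite)
  show ?thesis
  proof unfold_locales
    fix \<omega> x assume \<omega>: "\<omega> \<in> opp.paths x x"
    then have "rev_path \<omega> = const_path x" using paths_opposite_iff no_loops by blast
    moreover have "rev_path (const_path x) = const_path x" by (rule ext) (simp add: rev_path_def const_path_def)
    ultimately have "rev_path (rev_path \<omega>) = const_path x" by simp
    then show "\<omega> = const_path x" using rev_rev_path \<omega> paths_opposite_iff by metis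
  qed
qed

interpretation opp: loop_free_dspace "opposite X" by (rule loop_free_opposite)

lemma push_end_homotopy_equivalence:
  assumes \<Psi>: "directed_flow \<Psi>" and id: "\<And>z. z \<in> topspace (dtop X) \<Longrightarrow> \<Psi> 1 z = z"
    and \<beta>: "\<beta> \<in> paths y y'" and eq: "\<Psi> 0 y = \<Psi> 0 y'"
    and x: "\<And>s. \<lbrakk>0 \<le> s; s \<le> 1\<rbrakk> \<Longrightarrow> \<Psi> s x = x"
  shows "homotopy_equivalence (path_space X x y) (path_space X x y') (\<lambda>\<omega>. path_concat \<omega> \<beta>)"
proof -
  have "homotopy_equivalence (path_space (opposite X) y x) (path_space (opposite X) y' x) (path_concat (rev_path \<beta>))"
    by (rule opp.push_start_homotopy_equivalence[OF directed_flow_opposite[OF \<Psi>]])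
      (use id rev_path_opposite[OF \<beta>] eq x in \<open>auto simp: dtop_opposite\<close>)
  then have "homotopy_equivalence (path_space X x y) (path_space X x y')
      (rev_path \<circ> (path_concat (rev_path \<beta>) \<circ> rev_path))"
    by (rule homotopy_equivalence_compose[OF homotopy_equivalence_compose
          [OF homotopy_equivalence_homeomorphic_map[OF homeomorphic_map_rev_path]]
          homotopy_equivalence_homeomorphic_map[OF homeomorphic_map_rev_path']])
  then show ?thesis
  proof (rule homotopy_equivalence_eq)
    fix \<omega> assume "\<omega> \<in> topspace (path_space X x y)"
    then have "\<omega> 1 = \<beta> 0" using \<beta> by (simp add: paths_iff)
    then show "(rev_path \<circ> (path_concat (rev_path \<beta>) \<circ> rev_path)) \<omega> = path_concat \<omega> \<beta>"
      by (auto simp: fun_eq_iff rev_path_def path_concat_def algebra_simps)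
  qed
qed

text \<open>Extension by \<open>\<alpha>\<close> and \<open>\<beta>\<close> is extension at the start followed by extension at the end, and each of
these is an equivalence by its own flow.\<close>

lemma path_ext_homotopy_equivalence:
  assumes \<Theta>: "directed_flow \<Theta>" "\<And>z. z \<in> topspace (dtop X) \<Longrightarrow> \<Theta> 0 z = z"
    and \<Psi>: "directed_flow \<Psi>" "\<And>z. z \<in> topspace (dtop X) \<Longrightarrow> \<Psi> 1 z = z"
    and \<alpha>: "\<alpha> \<in> dpaths X" "\<Theta> 1 (\<alpha> 0) = \<Theta> 1 (\<alpha> 1)" "\<And>s. \<lbrakk>0 \<le> s; s \<le> 1\<rbrakk> \<Longrightarrow> \<Psi> s (\<alpha> 0) = \<alpha> 0"
    and \<beta>: "\<beta> \<in> dpaths X" "\<Psi> 0 (\<beta> 0) = \<Psi> 0 (\<beta> 1)" "\<And>s. \<lbrakk>0 \<le> s; s \<le> 1\<rbrakk> \<Longrightarrow> \<Theta> s (\<beta> 0) = \<beta> 0"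
  shows "homotopy_equivalence (path_space X (\<alpha> 1) (\<beta> 0)) (path_space X (\<alpha> 0) (\<beta> 1)) (path_ext \<alpha> \<beta>)"
proof -
  have "homotopy_equivalence (path_space X (\<alpha> 1) (\<beta> 0)) (path_space X (\<alpha> 0) (\<beta> 0)) (path_concat \<alpha>)"
    by (rule push_start_homotopy_equivalence[OF \<Theta>]) (use \<alpha> \<beta> in \<open>auto simp: paths_iff\<close>)
  moreover have "homotopy_equivalence (path_space X (\<alpha> 0) (\<beta> 0)) (path_space X (\<alpha> 0) (\<beta> 1)) (\<lambda>\<omega>. path_concat \<omega> \<beta>)"
    by (rule push_end_homotopy_equivalence[OF \<Psi>]) (use \<alpha> \<beta> in \<open>auto simp: paths_iff\<close>)
  ultimately have "homotopy_equivalence (path_space X (\<alpha> 1) (\<beta> 0)) (path_space X (\<alpha> 0) (\<beta> 1))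
      ((\<lambda>\<omega>. path_concat \<omega> \<beta>) \<circ> path_concat \<alpha>)"
    by (rule homotopy_equivalence_compose)
  then show ?thesis by (rule homotopy_equivalence_eq) (simp add: path_ext_def)
qed

lemma paths_from_source_contractible:
  fixes F :: "'u family" and \<iota> :: "(real \<Rightarrow> 'a) \<Rightarrow> 'u"
  assumes \<Psi>: "directed_flow \<Psi>" and id: "\<And>z. z \<in> topspace (dtop X) \<Longrightarrow> \<Psi> 1 z = z"
    and y: "y \<in> topspace (dtop X)" and yx: "\<Psi> 0 y = x" and x: "\<And>s. \<lbrakk>0 \<le> s; s \<le> 1\<rbrakk> \<Longrightarrow> \<Psi> s x = x"
    and F: "equivalence_system F" and \<iota>: "inj \<iota>"
  shows "F_contractible F (path_space X x y)"
proof -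
  obtain c where "c \<in> opp.paths y x"
    "homotopic_with (\<lambda>_. True) (path_space (opposite X) y x) (path_space (opposite X) y x) id (\<lambda>_. c)"
    using opp.paths_into_sink_contractible[OF directed_flow_opposite[OF \<Psi>], of y x] id y yx x by (auto simp: dtop_opposite)
  then have "F_contractible F (path_space (opposite X) y x)"
    by (intro F_contractible_homotopic_const[OF F \<iota>]) auto
  moreover have "in_family F (path_space X x y) (path_space (opposite X) y x) rev_path"
    by (intro in_family_homotopy_equivalence[OF F \<iota> \<iota>] homotopy_equivalence_homeomorphic_map
        homeomorphic_map_rev_path)
  ultimately show ?thesis using F_contractible_in_family[OF F] by blast
qed

end

section \<open>Normal forms of the points of a realization\<close>

definition delete_coord :: "nat \<Rightarrow> nat \<Rightarrow> (nat \<Rightarrow> real) \<Rightarrow> nat \<Rightarrow> real" where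
  "delete_coord n i t = restrict (\<lambda>k. if k < i then t k else t (Suc k)) {1..n}"

lemma cube_iff: "t \<in> unit_cube n \<longleftrightarrow>
    (\<forall>k\<in>{1..n}. 0 \<le> t k \<and> t k \<le> 1) \<and> (\<forall>k. k \<notin> {1..n} \<longrightarrow> t k = undefined)"
  by (auto simp: topspace_cube_topology PiE_iff extensional_def)

lemma cube_eqI: "\<lbrakk>t \<in> unit_cube n; t' \<in> unit_cube n;
    \<And>k. k \<in> {1..n} \<Longrightarrow> t k = t' k\<rbrakk> \<Longrightarrow> t = t'"
  by (rule ext) (metis cube_iff)

lemma cube_leI: "\<lbrakk>t \<in> unit_cube n; t' \<in> unit_cube n;
    \<And>k. k \<in> {1..n} \<Longrightarrow> t k \<le> t' k\<rbrakk> \<Longrightarrow> t \<le> t'"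
  unfolding le_fun_def by (metis cube_iff order_refl)

lemma restrict_in_cube: "(\<And>k. k \<in> {1..n} \<Longrightarrow> 0 \<le> f k \<and> f k \<le> 1) \<Longrightarrow> restrict f {1..n} \<in> unit_cube n"
  by (simp add: cube_iff)

lemma delete_coord_in_cube:
  "\<lbrakk>t \<in> unit_cube (Suc n); 1 \<le> i\<rbrakk> \<Longrightarrow> delete_coord n i t \<in> unit_cube n"
  by (auto simp: cube_iff delete_coord_def)

lemma delete_delete_coord:
  "\<lbrakk>1 \<le> i; i < j; j \<le> Suc (Suc n)\<rbrakk> \<Longrightarrow>
     delete_coord n i (delete_coord (Suc n) j t) = delete_coord n (j - 1) (delete_coord (Suc n) i t)"
  by (rule ext) (auto simp: delete_coord_def)

lemma insert_delete_coord:
  "\<lbrakk>t \<in> unit_cube (Suc n); 1 \<le> i; i \<le> Suc n\<rbrakk> \<Longrightarrow>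
     insert_coord (Suc n) i (t i) (delete_coord n i t) = t"
  by (rule ext) (auto simp: insert_coord_def delete_coord_def cube_iff)

lemma delete_insert_coord:
  "\<lbrakk>t \<in> unit_cube n; 1 \<le> i; i \<le> Suc n\<rbrakk> \<Longrightarrow>
     delete_coord n i (insert_coord (Suc n) i e t) = t"
  by (rule ext) (auto simp: insert_coord_def delete_coord_def cube_iff)

definition is_endpoint :: "real \<Rightarrow> bool" where
  "is_endpoint x \<longleftrightarrow> x = 0 \<or> x = 1"

text \<open>As long as some coordinate is 0 or 1, the point lies on a face, and the coordinate is removed. The
argument \<open>n\<close> is the dimension of \<open>c\<close>.\<close>

primrec cube_normal_form ::
  "'c precubical \<Rightarrow> nat \<Rightarrow> 'c \<Rightarrow> (nat \<Rightarrow> real) \<Rightarrow> 'c \<times> (nat \<Rightarrow> real)" where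
  "cube_normal_form K 0 c t = (c, t)"
| "cube_normal_form K (Suc n) c t =
     (if \<exists>i\<in>{1..Suc n}. is_endpoint (t i)
      then let i = (LEAST i. i \<in> {1..Suc n} \<and> is_endpoint (t i))
           in cube_normal_form K n (face K (t i = 1) i c) (delete_coord n i t)
      else (c, t))"

declare cube_normal_form.simps(2) [simp del]

text \<open>The action on representatives of a function of one coordinate. It is compatible with the gluing if the
function fixes 0 and 1, whether continuous or not.\<close>

definition map_coords :: "'c precubical \<Rightarrow> (real \<Rightarrow> real) \<Rightarrow> 'c \<times> (nat \<Rightarrow> real) \<Rightarrow> 'c \<times> (nat \<Rightarrow> real)" where
  "map_coords K \<phi> p = (fst p, restrict (\<lambda>k. \<phi> (snd p k)) {1..cube_dim K (fst p)})"

definition endpoint_preserving :: "(real \<Rightarrow> real) \<Rightarrow> bool" where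
  "endpoint_preserving \<phi> \<longleftrightarrow> (\<forall>x\<in>{0..1}. \<phi> x \<in> {0..1}) \<and> \<phi> 0 = 0 \<and> \<phi> 1 = 1"

lemma equivclp_map:
  assumes "equivclp r p q" and "\<And>a b. r a b \<Longrightarrow> equivclp r' (f a) (f b)"
  shows "equivclp r' (f p) (f q)"
  using assms(1)
proof (induction rule: equivclp_induct)
  case (step y z)
  then show ?case using assms(2) by (metis equivclp_sym equivclp_trans)
qed simp

locale precubical =
  fixes K :: "'c precubical"
  assumes precubical: "precubical_set K"
begin

abbreviation dim :: "'c \<Rightarrow> nat" where "dim \<equiv> cube_dim K"

abbreviation cls :: "'c \<times> (nat \<Rightarrow> real) \<Rightarrow> ('c \<times> (nat \<Rightarrow> real)) set" where
  "cls \<equiv> realization_class K"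

definition valid :: "'c \<times> (nat \<Rightarrow> real) \<Rightarrow> bool" where
  "valid p \<longleftrightarrow> (\<exists>n. fst p \<in> cells K n \<and> snd p \<in> unit_cube n)"

definition interior_rep :: "'c \<times> (nat \<Rightarrow> real) \<Rightarrow> bool" where
  "interior_rep p \<longleftrightarrow> valid p \<and> (\<forall>k\<in>{1..dim (fst p)}. 0 < snd p k \<and> snd p k < 1)"

definition normal_form :: "'c \<times> (nat \<Rightarrow> real) \<Rightarrow> 'c \<times> (nat \<Rightarrow> real)" where
  "normal_form p = cube_normal_form K (dim (fst p)) (fst p) (snd p)"

lemma dim_eq [simp]: "c \<in> cells K n \<Longrightarrow> dim c = n"
  by (rule cube_dim_eq[OF precubical])

lemma cells_cubes: "c \<in> cells K n \<Longrightarrow> c \<in> cubes K"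
  by (auto simp: cubes_def)

lemma cubes_cells: "c \<in> cubes K \<Longrightarrow> c \<in> cells K (dim c)"
  by (auto simp: cubes_def)

lemma valid_iff: "valid p \<longleftrightarrow> fst p \<in> cubes K \<and> snd p \<in> unit_cube (dim (fst p))"
proof
  assume "valid p"
  then obtain n where "fst p \<in> cells K n" "snd p \<in> unit_cube n" by (auto simp: valid_def)
  then show "fst p \<in> cubes K \<and> snd p \<in> unit_cube (dim (fst p))"
    using cells_cubes by simp
next
  assume "fst p \<in> cubes K \<and> snd p \<in> unit_cube (dim (fst p))"
  then show "valid p" unfolding valid_def using cubes_cells by blast
qed

lemma face_cell: "\<lbrakk>c \<in> cells K (Suc n); 1 \<le> i; i \<le> Suc n\<rbrakk> \<Longrightarrow> face K \<epsilon> i c \<in> cells K n"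
proof -
  assume c: "c \<in> cells K (Suc n)" "1 \<le> i" "i \<le> Suc n"
  have "\<forall>n \<epsilon> i. \<forall>c\<in>cells K n. 1 \<le> i \<and> i \<le> n \<longrightarrow> face K \<epsilon> i c \<in> cells K (n - 1)"
    using precubical[unfolded precubical_set_def, THEN conjunct2, THEN conjunct1] .
  from this[rule_format, OF c(1), of i \<epsilon>] show ?thesis using c by simp
qed

lemma face_face:
  "\<lbrakk>c \<in> cells K n; 1 \<le> i; i < j; j \<le> n\<rbrakk> \<Longrightarrow> face K \<epsilon> i (face K \<eta> j c) = face K \<eta> (j - 1) (face K \<epsilon> i c)"
  using precubical unfolding precubical_set_def by blast

text \<open>The order in which coordinates are removed does not matter, by the pre-cubical identity. This is
what makes the normal form invariant under gluing.\<close>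

lemma cube_normal_form_delete:
  assumes "c \<in> cells K (Suc n)" "i \<in> {1..Suc n}" "is_endpoint (t i)"
  shows "cube_normal_form K (Suc n) c t = cube_normal_form K n (face K (t i = 1) i c) (delete_coord n i t)"
  using assms
proof (induction n arbitrary: c t i)
  case 0
  have "(LEAST i. i \<in> {1..Suc 0} \<and> is_endpoint (t i)) = i" using 0 by (intro Least_equality) auto
  then show ?case using 0 by (auto simp: Let_def cube_normal_form.simps(2))
next
  case (Suc n)
  let ?P = "\<lambda>i. i \<in> {1..Suc (Suc n)} \<and> is_endpoint (t i)"
  define j where "j = Least ?P"
  have Pi: "?P i" using Suc.prems by simp
  have j: "?P j" unfolding j_def using Pi by (rule LeastI)
  have ji: "j \<le> i" unfolding j_def using Pi by (rule Least_le)
  have eq: "cube_normal_form K (Suc (Suc n)) c t =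
      cube_normal_form K (Suc n) (face K (t j = 1) j c) (delete_coord (Suc n) j t)"
    unfolding cube_normal_form.simps(2)[of K "Suc n"] j_def[symmetric] Let_def using Pi by (intro if_P) blast
  show ?case
  proof (cases "j = i")
    case True
    then show ?thesis using eq by simp
  next
    case False
    then have lt: "j < i" using ji by simp
    have ij: "i - 1 \<in> {1..Suc n}" "j \<in> {1..Suc n}" using lt j Suc.prems(2) by auto
    have 1: "delete_coord (Suc n) j t (i - 1) = t i" "delete_coord (Suc n) i t j = t j"
      using lt Suc.prems(2) j by (auto simp: delete_coord_def)
    have "cube_normal_form K (Suc n) (face K (t j = 1) j c) (delete_coord (Suc n) j t) =
        cube_normal_form K n (face K (t i = 1) (i - 1) (face K (t j = 1) j c))
          (delete_coord n (i - 1) (delete_coord (Suc n) j t))"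
      using Suc.IH[of "face K (t j = 1) j c" "i - 1" "delete_coord (Suc n) j t"]
        face_cell[OF Suc.prems(1), of j "t j = 1"] j ij Suc.prems(3) 1 by simp
    also have "face K (t i = 1) (i - 1) (face K (t j = 1) j c) = face K (t j = 1) j (face K (t i = 1) i c)"
      using face_face[OF Suc.prems(1), of j i] lt j Suc.prems(2) by auto
    also have "delete_coord n (i - 1) (delete_coord (Suc n) j t) = delete_coord n j (delete_coord (Suc n) i t)"
      using delete_delete_coord[of j i n t] lt j Suc.prems(2) by auto
    also have "cube_normal_form K n (face K (t j = 1) j (face K (t i = 1) i c)) \<dots> =
        cube_normal_form K (Suc n) (face K (t i = 1) i c) (delete_coord (Suc n) i t)"
      using Suc.IH[of "face K (t i = 1) i c" j "delete_coord (Suc n) i t"]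
        face_cell[OF Suc.prems(1), of i "t i = 1"] j ij Suc.prems(2) 1 by simp
    finally show ?thesis using eq by simp
  qed
qed

lemma cube_normal_form_interior:
  "(\<And>k. k \<in> {1..n} \<Longrightarrow> \<not> is_endpoint (t k)) \<Longrightarrow> cube_normal_form K n c t = (c, t)"
  by (cases n) (auto simp: cube_normal_form.simps(2))

text \<open>This packages the removal of one coordinate, so that proofs about normal forms need not mention which
coordinate is removed.\<close>

lemma cube_normal_form_induct [consumes 2, case_names interior face]:
  assumes "c \<in> cells K n" "t \<in> unit_cube n"
    and interior: "\<And>n c t. \<lbrakk>c \<in> cells K n; t \<in> unit_cube n;
        \<And>k. k \<in> {1..n} \<Longrightarrow> \<not> is_endpoint (t k); cube_normal_form K n c t = (c, t)\<rbrakk> \<Longrightarrow> P n c t"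
    and face: "\<And>n c t i. \<lbrakk>c \<in> cells K (Suc n); t \<in> unit_cube (Suc n);
        1 \<le> i; i \<le> Suc n; is_endpoint (t i);
        cube_normal_form K (Suc n) c t = cube_normal_form K n (face K (t i = 1) i c) (delete_coord n i t);
        P n (face K (t i = 1) i c) (delete_coord n i t)\<rbrakk> \<Longrightarrow> P (Suc n) c t"
  shows "P n c t"
  using assms(1,2)
proof (induction n arbitrary: c t)
  case 0
  then show ?case by (intro interior) auto
next
  case (Suc n)
  show ?case
  proof (cases "\<exists>i\<in>{1..Suc n}. is_endpoint (t i)")
    case True
    then obtain i where i: "i \<in> {1..Suc n}" "is_endpoint (t i)" by blast
    show ?thesis
    proof (rule face[where i = i])
      show "cube_normal_form K (Suc n) c t = cube_normal_form K n (face K (t i = 1) i c) (delete_coord n i t)"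
        by (rule cube_normal_form_delete) (use i Suc.prems in auto)
      show "P n (face K (t i = 1) i c) (delete_coord n i t)"
        by (rule Suc.IH) (use i Suc.prems face_cell[of c n i] delete_coord_in_cube[of t n i] in simp_all)
    qed (use i Suc.prems in auto)
  next
    case False
    then show ?thesis using Suc.prems by (intro interior cube_normal_form_interior) auto
  qed
qed

lemma glue_delete:
  assumes "c \<in> cells K (Suc n)" "t \<in> unit_cube (Suc n)" "1 \<le> i" "i \<le> Suc n" "is_endpoint (t i)"
  shows "glue K (face K (t i = 1) i c, delete_coord n i t) (c, t)"
proof -
  have "of_bool (t i = 1) = t i" using assms(5) by (auto simp: is_endpoint_def)
  then show ?thesis
    unfolding glue_def
    using assms delete_coord_in_cube[OF assms(2,3)] insert_delete_coord[OF assms(2,3,4)]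
    by (intro exI[of _ "Suc n"] exI[of _ c] exI[of _ i] exI[of _ "t i = 1"] exI[of _ "delete_coord n i t"]) auto
qed

lemma glueE:
  assumes "glue K p p'"
  obtains n c i \<epsilon> t where "c \<in> cells K (Suc n)" "1 \<le> i" "i \<le> Suc n" "t \<in> unit_cube n"
    "p = (face K \<epsilon> i c, t)" "p' = (c, insert_coord (Suc n) i (of_bool \<epsilon>) t)"
proof -
  obtain n c i \<epsilon> t where *: "c \<in> cells K n" "1 \<le> i" "i \<le> n" "t \<in> unit_cube (n - 1)"
    "p = (face K \<epsilon> i c, t)" "p' = (c, insert_coord n i (of_bool \<epsilon>) t)"
    using assms unfolding glue_def by blast
  moreover obtain m where "n = Suc m" using * by (cases n) auto
  ultimately show thesis using that by simp
qed

lemma normal_form_props: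
  assumes "valid p"
  shows "equivclp (glue K) (normal_form p) p \<and> interior_rep (normal_form p)"
proof -
  obtain n where n: "fst p \<in> cells K n" "snd p \<in> unit_cube n"
    using assms unfolding valid_def by blast
  have "equivclp (glue K) (cube_normal_form K n (fst p) (snd p)) (fst p, snd p) \<and>
      interior_rep (cube_normal_form K n (fst p) (snd p))"
    using n
  proof (induction rule: cube_normal_form_induct)
    case (interior n c t)
    then have "0 < t k \<and> t k < 1" if "k \<in> {1..n}" for k
      using that unfolding cube_iff is_endpoint_def by (metis less_eq_real_def)
    then show ?case using interior by (auto simp: interior_rep_def valid_def)
  next
    case (face n c t i)
    then show ?case using glue_delete[OF face(1-5)] by (metis equivclp_into_equivclp)
  qed
  then show ?thesis using n by (simp add: normal_form_def)
qed

lemmas normal_form_equivclp = normal_form_props[THEN conjunct1]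
  and normal_form_interior_rep = normal_form_props[THEN conjunct2]

lemma normal_form_interior: "interior_rep p \<Longrightarrow> normal_form p = p"
  unfolding normal_form_def interior_rep_def by (subst cube_normal_form_interior) (fastforce simp: is_endpoint_def)+

lemma interior_rep_valid: "interior_rep p \<Longrightarrow> valid p"
  by (simp add: interior_rep_def)

lemma glue_normal_form:
  assumes "glue K p p'"
  shows "normal_form p = normal_form p'"
  using assms
proof (cases rule: glueE)
  case (1 n c i \<epsilon> t)
  let ?t = "insert_coord (Suc n) i (of_bool \<epsilon>) t"
  have ti: "?t i = of_bool \<epsilon>" using 1 by (simp add: insert_coord_def)
  have "cube_normal_form K (Suc n) c ?t = cube_normal_form K n (face K (?t i = 1) i c) (delete_coord n i ?t)"
    by (rule cube_normal_form_delete) (use 1 ti in \<open>auto simp: is_endpoint_def\<close>)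
  then show ?thesis
    using 1 ti delete_insert_coord[of t n i] face_cell[of c n i \<epsilon>] by (simp add: normal_form_def)
qed

lemma equivclp_normal_form: "equivclp (glue K) p p' \<Longrightarrow> normal_form p = normal_form p'"
proof (induction rule: equivclp_induct)
  case (step y z)
  then show ?case using glue_normal_form by metis
qed simp

lemma cls_eq_iff: "cls p = cls p' \<longleftrightarrow> equivclp (glue K) p p'"
proof
  assume "cls p = cls p'"
  moreover have "p' \<in> cls p'" by (simp add: realization_class_def)
  ultimately have "p' \<in> cls p" by simp
  then show "equivclp (glue K) p p'" by (simp add: realization_class_def)
next
  assume *: "equivclp (glue K) p p'"
  show "cls p = cls p'"
    unfolding realization_class_def
    by (rule Collect_cong, rule iffI, erule equivclp_trans[OF equivclp_sym[OF *]], erule equivclp_trans[OF *])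
qed

lemma cls_normal_form: "valid p \<Longrightarrow> cls (normal_form p) = cls p"
  unfolding cls_eq_iff by (rule normal_form_equivclp)

text \<open>The representative of a point whose coordinates are strictly between 0 and 1.\<close>

definition canon :: "('c \<times> (nat \<Rightarrow> real)) set \<Rightarrow> 'c \<times> (nat \<Rightarrow> real)" where
  "canon z = normal_form (SOME p. p \<in> z)"

lemma canon_cls: "canon (cls p) = normal_form p"
proof -
  have "p \<in> cls p" by (simp add: realization_class_def)
  then have "(SOME p'. p' \<in> cls p) \<in> cls p" by (rule someI)
  then have "equivclp (glue K) p (SOME p'. p' \<in> cls p)" by (simp add: realization_class_def)
  then show ?thesis unfolding canon_def by (metis equivclp_normal_form)
qed

lemma canon_interior: "interior_rep p \<Longrightarrow> canon (cls p) = p"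
  by (simp add: canon_cls normal_form_interior)

abbreviation points :: "('c \<times> (nat \<Rightarrow> real)) set set" where
  "points \<equiv> topspace (dtop (realization K))"

lemma points_eq: "points = cls ` Collect valid"
  unfolding realization_def quotient_dspace_def cube_sum_def sum_dspace_def directed_cube_def
  by (auto simp: valid_iff image_iff Bex_def)

lemma pointE:
  assumes "z \<in> points"
  obtains c t where "interior_rep (c, t)" "z = cls (c, t)" "canon z = (c, t)"
proof -
  obtain p where p: "valid p" "z = cls p" using assms points_eq by auto
  then show thesis
    using that[of "fst (normal_form p)" "snd (normal_form p)"] normal_form_interior_rep[OF p(1)]
      cls_normal_form[OF p(1)] canon_cls by simp
qed

lemma cls_in_points: "valid p \<Longrightarrow> cls p \<in> points"
  by (simp add: points_eq)

lemma glue_map_coords: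
  assumes \<phi>: "endpoint_preserving \<phi>" and "glue K p p'"
  shows "glue K (map_coords K \<phi> p) (map_coords K \<phi> p')"
  using assms(2)
proof (cases rule: glueE)
  case (1 n c i \<epsilon> t)
  have t: "restrict (\<lambda>k. \<phi> (t k)) {1..n} \<in> unit_cube n"
    using 1(4) \<phi> by (intro restrict_in_cube) (auto simp: endpoint_preserving_def cube_iff)
  have "restrict (\<lambda>k. \<phi> (insert_coord (Suc n) i (of_bool \<epsilon>) t k)) {1..Suc n} =
      insert_coord (Suc n) i (of_bool \<epsilon>) (restrict (\<lambda>k. \<phi> (t k)) {1..n})"
    using 1 \<phi> by (auto simp: fun_eq_iff insert_coord_def endpoint_preserving_def)
  then show ?thesis
    unfolding glue_def using 1 t face_cell[of c n i \<epsilon>]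
    by (intro exI[of _ "Suc n"] exI[of _ c] exI[of _ i] exI[of _ \<epsilon>] exI[of _ "restrict (\<lambda>k. \<phi> (t k)) {1..n}"])
      (simp add: map_coords_def)
qed

lemma cls_map_coords_cong:
  assumes \<phi>: "endpoint_preserving \<phi>" and "cls p = cls p'"
  shows "cls (map_coords K \<phi> p) = cls (map_coords K \<phi> p')"
  using assms(2) unfolding cls_eq_iff
  by (rule equivclp_map) (use glue_map_coords[OF \<phi>] in blast)

lemma valid_map_coords: "\<lbrakk>endpoint_preserving \<phi>; valid p\<rbrakk> \<Longrightarrow> valid (map_coords K \<phi> p)"
  by (auto simp: valid_iff map_coords_def endpoint_preserving_def cube_iff intro!: restrict_in_cube)

text \<open>The least and the greatest vertex of the cell that contains the point.\<close>

definition lo :: "('c \<times> (nat \<Rightarrow> real)) set \<Rightarrow> 'c" where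
  "lo z = extreme_vertex K False (fst (canon z))"

definition hi :: "('c \<times> (nat \<Rightarrow> real)) set \<Rightarrow> 'c" where
  "hi z = extreme_vertex K True (fst (canon z))"

text \<open>Removing the coordinates of a corner one by one takes the first face each time, as the definition of
the extreme vertices does.\<close>

lemma normal_form_corner:
  assumes "c \<in> cells K n"
  shows "normal_form (c, restrict (\<lambda>_. of_bool \<epsilon>) {1..n}) =
     (extreme_vertex K \<epsilon> c, restrict (\<lambda>_. of_bool \<epsilon>) {1..0})"
proof -
  have "cube_normal_form K n c (restrict (\<lambda>_. of_bool \<epsilon>) {1..n}) =
      ((face K \<epsilon> 1 ^^ n) c, restrict (\<lambda>_. of_bool \<epsilon>) {1..0})"
    using assms
  proof (induction n arbitrary: c)
    case (Suc n)
    let ?t = "restrict (\<lambda>_. of_bool \<epsilon> :: real) {1..Suc n}"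
    have "cube_normal_form K (Suc n) c ?t = cube_normal_form K n (face K (?t 1 = 1) 1 c) (delete_coord n 1 ?t)"
      by (rule cube_normal_form_delete) (use Suc.prems in \<open>auto simp: is_endpoint_def\<close>)
    also have "delete_coord n 1 ?t = restrict (\<lambda>_. of_bool \<epsilon>) {1..n}"
      by (auto simp: fun_eq_iff delete_coord_def)
    finally show ?case
      using Suc.IH[OF face_cell[OF Suc.prems, of 1 \<epsilon>]] by (simp add: funpow_swap1)
  qed simp
  then show ?thesis using assms by (simp add: normal_form_def extreme_vertex_def)
qed

lemma extreme_vertex_cell: "c \<in> cells K n \<Longrightarrow> extreme_vertex K \<epsilon> c \<in> cells K 0"
proof -
  assume c: "c \<in> cells K n"
  have "(face K \<epsilon> 1 ^^ n) c \<in> cells K 0"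
    using c
  proof (induction n arbitrary: c)
    case (Suc n)
    then show ?case using face_cell[OF Suc.prems, of 1 \<epsilon>] by (simp add: funpow_swap1)
  qed simp
  then show ?thesis using c by (simp add: extreme_vertex_def)
qed

lemma extreme_vertex_vertex [simp]: "v \<in> cells K 0 \<Longrightarrow> extreme_vertex K \<epsilon> v = v"
  by (simp add: extreme_vertex_def)

definition round_down :: "real \<Rightarrow> real" where "round_down x = of_bool (x = 1)"
definition round_up :: "real \<Rightarrow> real" where "round_up x = of_bool (x \<noteq> 0)"

lemma endpoint_preserving_round: "endpoint_preserving round_down" "endpoint_preserving round_up"
  by (auto simp: endpoint_preserving_def round_down_def round_up_def)

text \<open>
Rounding every coordinate down is compatible with the gluing, so it may be computed in the normal form,
where all coordinates become 0. Hence \<open>lo\<close> can be read off from any representative; likewise \<open>hi\<close>.\<close>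

lemma
  assumes "valid p"
  shows lo_cls: "lo (cls p) = fst (normal_form (map_coords K round_down p))"
    and hi_cls: "hi (cls p) = fst (normal_form (map_coords K round_up p))"
proof -
  let ?q = "normal_form p"
  have q: "interior_rep ?q" "cls p = cls ?q" "canon (cls p) = ?q"
    using normal_form_interior_rep[OF assms] cls_normal_form[OF assms] canon_cls by auto
  obtain n where n: "fst ?q \<in> cells K n" using q(1) by (auto simp: interior_rep_def valid_def)
  have "map_coords K round_down ?q = (fst ?q, restrict (\<lambda>_. of_bool False) {1..n})"
    "map_coords K round_up ?q = (fst ?q, restrict (\<lambda>_. of_bool True) {1..n})"
    using q(1) n by (auto simp: map_coords_def interior_rep_def round_down_def round_up_def intro!: restrict_ext)
  moreover have "normal_form (map_coords K \<phi> p) = normal_form (map_coords K \<phi> ?q)" if "endpoint_preserving \<phi>" for \<phi>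
    using cls_map_coords_cong[OF that q(2)] unfolding cls_eq_iff by (rule equivclp_normal_form)
  ultimately show "lo (cls p) = fst (normal_form (map_coords K round_down p))"
    "hi (cls p) = fst (normal_form (map_coords K round_up p))"
    using normal_form_corner[OF n, of False] normal_form_corner[OF n, of True]
    by (simp_all add: lo_def hi_def q(3) endpoint_preserving_round)
qed

definition edges :: "('c \<times> 'c) set" where
  "edges = {(extreme_vertex K False e, extreme_vertex K True e) | e. e \<in> cells K 1}"

lemma edge_normal_form:
  assumes "c \<in> cells K n" "t \<in> unit_cube n"
    and "i \<in> {1..n}" "\<not> is_endpoint (t i)" "\<And>k. \<lbrakk>k \<in> {1..n}; k \<noteq> i\<rbrakk> \<Longrightarrow> is_endpoint (t k)"
  shows "fst (cube_normal_form K n c t) \<in> cells K 1"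
  using assms
proof (induction arbitrary: i rule: cube_normal_form_induct)
  case (interior n c t)
  have "k = i" if "k \<in> {1..n}" for k using interior that by blast
  then have "{1..n} = {i}" using interior.prems(1) by blast
  then have "card {1..n} = 1" by simp
  then show ?case using interior by simp
next
  case (face n c t j)
  let ?i = "if i < j then i else i - 1"
  have ij: "i \<noteq> j" using face by auto
  have "fst (cube_normal_form K n (face K (t j = 1) j c) (delete_coord n j t)) \<in> cells K 1"
  proof (rule face.IH[of ?i])
    show "?i \<in> {1..n}" using face ij by auto
    show "\<not> is_endpoint (delete_coord n j t ?i)" using face ij by (auto simp: delete_coord_def)
    show "is_endpoint (delete_coord n j t k)" if "k \<in> {1..n}" "k \<noteq> ?i" for k
      using face.prems(3)[of k] face.prems(3)[of "Suc k"] that ij by (auto simp: delete_coord_def split: if_splits)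
  qed
  then show ?case using face by simp
qed

text \<open>The midpoint between two neighbouring corners lies in a 1-cell, and rounding it down and up gives the two
corners. So the two vertices are the ends of that 1-cell.\<close>

lemma corner_edge:
  assumes c: "c \<in> cells K n" and b: "b \<in> unit_cube n" "\<And>k. k \<in> {1..n} \<Longrightarrow> is_endpoint (b k)"
    and i: "i \<in> {1..n}" "b i = 0"
  shows "(fst (normal_form (c, b)), fst (normal_form (c, b(i := 1)))) \<in> edges"
proof -
  let ?p = "(c, b(i := 1/2))"
  have v: "valid ?p" using c b i by (auto simp: valid_def cube_iff intro!: exI[of _ n])
  have "fst (cube_normal_form K n c (b(i := 1/2))) \<in> cells K 1"
    by (rule edge_normal_form[OF c _ i(1)]) (use b i in \<open>auto simp: is_endpoint_def cube_iff\<close>)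
  then have "fst (normal_form ?p) \<in> cells K 1" using c by (simp add: normal_form_def)
  moreover have "map_coords K round_down ?p = (c, b)" "map_coords K round_up ?p = (c, b(i := 1))"
    using c b(2) i b(1) by (auto simp: map_coords_def fun_eq_iff round_down_def round_up_def is_endpoint_def cube_iff)
  ultimately show ?thesis
    using lo_cls[OF v] hi_cls[OF v] canon_cls[of ?p] unfolding edges_def lo_def hi_def
    by (intro CollectI exI[of _ "fst (normal_form ?p)"]) simp
qed

lemma corner_mono:
  assumes c: "c \<in> cells K n" and b: "b \<in> unit_cube n" "\<And>k. k \<in> {1..n} \<Longrightarrow> is_endpoint (b k)"
    and b': "b' \<in> unit_cube n" "\<And>k. k \<in> {1..n} \<Longrightarrow> is_endpoint (b' k)"
    and le: "b \<le> b'" and ne: "b \<noteq> b'"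
  shows "(fst (normal_form (c, b)), fst (normal_form (c, b'))) \<in> edges\<^sup>+"
  using b le ne
proof (induction "card {k \<in> {1..n}. b k \<noteq> b' k}" arbitrary: b rule: less_induct)
  case less
  obtain i where i: "i \<in> {1..n}" "b i \<noteq> b' i" 
  proof -
    have "\<exists>i\<in>{1..n}. b i \<noteq> b' i"
    proof (rule ccontr)
      assume "\<not> (\<exists>i\<in>{1..n}. b i \<noteq> b' i)"
      then have "b = b'" by (intro cube_eqI[OF less.prems(1) b'(1)]) blast
      then show False using less.prems(4) by simp
    qed
    then show thesis using that by blast
  qed
  then have i01: "b i = 0" "b' i = 1"
    using less.prems(2)[OF i(1)] b'(2)[OF i(1)] le_funD[OF less.prems(3), of i] by (auto simp: is_endpoint_def)
  let ?b = "b(i := 1)"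
  have edge: "(fst (normal_form (c, b)), fst (normal_form (c, ?b))) \<in> edges"
    by (rule corner_edge[OF c less.prems(1,2) i(1) i01(1)])
  show ?case
  proof (cases "?b = b'")
    case True
    then show ?thesis using edge by auto
  next
    case False
    have "{k \<in> {1..n}. ?b k \<noteq> b' k} \<subseteq> {k \<in> {1..n}. b k \<noteq> b' k}"
      by (rule subsetI) (simp add: i01 split: if_splits)
    moreover have "i \<in> {k \<in> {1..n}. b k \<noteq> b' k}" "i \<notin> {k \<in> {1..n}. ?b k \<noteq> b' k}"
      using i i01 by simp_all
    ultimately have "{k \<in> {1..n}. ?b k \<noteq> b' k} \<subset> {k \<in> {1..n}. b k \<noteq> b' k}" by blast
    then have "card {k \<in> {1..n}. ?b k \<noteq> b' k} < card {k \<in> {1..n}. b k \<noteq> b' k}"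
      by (intro psubset_card_mono) auto
    then have "(fst (normal_form (c, ?b)), fst (normal_form (c, b'))) \<in> edges\<^sup>+"
    proof (rule less.hyps)
      show "?b \<in> unit_cube n" using less.prems(1) i(1) by (auto simp: cube_iff)
      show "?b \<le> b'" using less.prems(3) i01 by (auto simp: le_fun_def)
    qed (use less.prems(2) False in \<open>auto simp: is_endpoint_def\<close>)
    with edge show ?thesis by (rule trancl_into_trancl2)
  qed
qed

text \<open>Two points of a cube with zeros in the same places and ones in the same places lie in the same open
face, and their remaining coordinates compare as before.\<close>

lemma cube_normal_form_parallel:
  assumes "c \<in> cells K n" "t \<in> unit_cube n" "t \<le> t'"
    and "\<And>k. k \<in> {1..n} \<Longrightarrow> (t k = 0 \<longleftrightarrow> t' k = 0) \<and> (t k = 1 \<longleftrightarrow> t' k = 1)"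
  shows "fst (cube_normal_form K n c t) = fst (cube_normal_form K n c t') \<and>
    snd (cube_normal_form K n c t) \<le> snd (cube_normal_form K n c t')"
  using assms
proof (induction arbitrary: t' rule: cube_normal_form_induct)
  case (interior n c t)
  have "cube_normal_form K n c t' = (c, t')"
    by (rule cube_normal_form_interior) (use interior in \<open>auto simp: is_endpoint_def\<close>)
  then show ?case using interior by simp
next
  case (face n c t i)
  have t'i: "is_endpoint (t' i)" "(t' i = 1) = (t i = 1)"
    using face.hyps(3-5) face.prems(2)[of i] by (auto simp: is_endpoint_def)
  have "cube_normal_form K (Suc n) c t' = cube_normal_form K n (face K (t i = 1) i c) (delete_coord n i t')"
    using cube_normal_form_delete[of c n i t'] face.hyps t'i by simp
  moreover have "delete_coord n i t \<le> delete_coord n i t'"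
    using face.prems(1) by (auto simp: le_fun_def delete_coord_def)
  moreover have "(delete_coord n i t k = 0 \<longleftrightarrow> delete_coord n i t' k = 0) \<and>
      (delete_coord n i t k = 1 \<longleftrightarrow> delete_coord n i t' k = 1)" if "k \<in> {1..n}" for k
    using face.prems(2)[of k] face.prems(2)[of "Suc k"] that by (auto simp: delete_coord_def)
  ultimately show ?case
    using face.IH[of "delete_coord n i t'"] face.hyps(6) by simp
qed

section \<open>The order on the points\<close>

text \<open>Both extreme vertices move along edges, and inside a cell the coordinates increase. If both
extreme vertices agree, the cells are required to agree too: two different cells may have the same extreme
vertices, but no d-path connects them if there are no loops of edges.\<close>

definition point_le :: "('c \<times> (nat \<Rightarrow> real)) set \<Rightarrow> ('c \<times> (nat \<Rightarrow> real)) set \<Rightarrow> bool" where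
  "point_le z z' \<longleftrightarrow> (lo z, lo z') \<in> edges\<^sup>* \<and> (hi z, hi z') \<in> edges\<^sup>* \<and>
     (lo z = lo z' \<and> hi z = hi z' \<longrightarrow> fst (canon z) = fst (canon z') \<and> snd (canon z) \<le> snd (canon z'))"

lemma point_le_refl: "point_le z z"
  by (simp add: point_le_def)

end

locale loop_free_precubical = precubical K for K :: "'c precubical" +
  assumes no_edge_loops: "precubical_no_loops K"
begin

lemma edges_chain:
  "(v, w) \<in> edges\<^sup>+ \<Longrightarrow> \<exists>es. es \<noteq> [] \<and> set es \<subseteq> cells K 1 \<and>
     extreme_vertex K False (hd es) = v \<and> extreme_vertex K True (last es) = w \<and>
     (\<forall>i. Suc i < length es \<longrightarrow> extreme_vertex K True (es ! i) = extreme_vertex K False (es ! Suc i))"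
proof (induction rule: trancl_induct)
  case (base w)
  then obtain e where "e \<in> cells K 1" "v = extreme_vertex K False e" "w = extreme_vertex K True e"
    by (auto simp: edges_def)
  then show ?case by (intro exI[of _ "[e]"]) auto
next
  case (step w x)
  obtain e where e: "e \<in> cells K 1" "w = extreme_vertex K False e" "x = extreme_vertex K True e"
    using step.hyps(2) by (auto simp: edges_def)
  obtain es where es: "es \<noteq> []" "set es \<subseteq> cells K 1" "extreme_vertex K False (hd es) = v"
    "extreme_vertex K True (last es) = w"
    "\<And>i. Suc i < length es \<Longrightarrow> extreme_vertex K True (es ! i) = extreme_vertex K False (es ! Suc i)"
    using step.IH by blast
  have "extreme_vertex K True ((es @ [e]) ! i) = extreme_vertex K False ((es @ [e]) ! Suc i)"
    if i: "Suc i < length (es @ [e])" for i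
  proof (cases "Suc i < length es")
    case True
    then show ?thesis using es(5) by (simp add: nth_append)
  next
    case False
    then have "i = length es - 1" "Suc i = length es" using i by auto
    then show ?thesis using es(1,4) e(2) by (simp add: nth_append last_conv_nth)
  qed
  then show ?case using es e by (intro exI[of _ "es @ [e]"]) auto
qed

lemma acyclic_edges: "acyclic edges"
  unfolding acyclic_def using edges_chain no_edge_loops unfolding precubical_no_loops_def by metis

lemma edges_antisym: "\<lbrakk>(v, w) \<in> edges\<^sup>*; (w, v) \<in> edges\<^sup>*\<rbrakk> \<Longrightarrow> v = w"
  using acyclic_edges by (metis acyclic_def rtranclD trancl_rtrancl_trancl)

lemma point_le_trans:
  assumes xy: "point_le x y" and yz: "point_le y z"
  shows "point_le x z"
  unfolding point_le_def
proof (intro conjI impI)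
  show "(lo x, lo z) \<in> edges\<^sup>*" "(hi x, hi z) \<in> edges\<^sup>*"
    using xy yz rtrancl_trans[of "lo x" "lo y" edges "lo z"] rtrancl_trans[of "hi x" "hi y" edges "hi z"]
    by (simp_all add: point_le_def)
  assume "lo x = lo z \<and> hi x = hi z"
  then have "lo x = lo y" "hi x = hi y" "lo y = lo z" "hi y = hi z"
    using xy yz edges_antisym[of "lo x" "lo y"] edges_antisym[of "hi x" "hi y"] by (simp_all add: point_le_def)
  then show "fst (canon x) = fst (canon z)" "snd (canon x) \<le> snd (canon z)"
    using xy yz by (auto simp: point_le_def intro: order_trans)
qed

lemma point_le_antisym:
  assumes "point_le x y" "point_le y x" "x \<in> points" "y \<in> points"
  shows "x = y"
proof -
  have "lo x = lo y" "hi x = hi y" using assms(1,2) edges_antisym by (auto simp: point_le_def)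
  then have "canon x = canon y"
    using assms(1,2) by (auto simp: point_le_def prod_eq_iff)
  then show ?thesis by (metis assms(3,4) pointE)
qed

text \<open>Inside a cube rounding is monotone, so the extreme vertices move along edges. If they do
not move, then the rounded coordinates do not change either, since there are no loops, and the two points
lie in the same open face.\<close>

lemma point_le_cube:
  assumes c: "c \<in> cells K n" and t: "t \<in> unit_cube n" "t' \<in> unit_cube n" and le: "t \<le> t'"
  shows "point_le (cls (c, t)) (cls (c, t'))"
proof -
  have v: "valid (c, t)" "valid (c, t')" using c t by (auto simp: valid_def)
  have *: "(fst (normal_form (map_coords K \<phi> (c, t))), fst (normal_form (map_coords K \<phi> (c, t')))) \<in> edges\<^sup>* \<and>
      (fst (normal_form (map_coords K \<phi> (c, t))) = fst (normal_form (map_coords K \<phi> (c, t'))) \<longrightarrow>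
        (\<forall>k\<in>{1..n}. \<phi> (t k) = \<phi> (t' k)))"
    if \<phi>: "\<And>x y. \<lbrakk>0 \<le> x; x \<le> y; y \<le> 1\<rbrakk> \<Longrightarrow> \<phi> x \<le> \<phi> y" "\<And>x. is_endpoint (\<phi> x)" for \<phi>
  proof -
    let ?b = "restrict (\<lambda>k. \<phi> (t k)) {1..n}" and ?b' = "restrict (\<lambda>k. \<phi> (t' k)) {1..n}"
    have m: "map_coords K \<phi> (c, t) = (c, ?b)" "map_coords K \<phi> (c, t') = (c, ?b')"
      using c by (simp_all add: map_coords_def)
    have \<phi>01: "0 \<le> \<phi> x \<and> \<phi> x \<le> 1" for x using \<phi>(2)[of x] by (auto simp: is_endpoint_def)
    have b: "?b \<in> unit_cube n" "?b' \<in> unit_cube n"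
      by (rule restrict_in_cube, rule \<phi>01)+
    have "?b \<le> ?b'" using t \<phi>(1) le by (intro cube_leI[OF b]) (auto simp: cube_iff le_fun_def)
    then have "?b \<noteq> ?b' \<Longrightarrow> (fst (normal_form (c, ?b)), fst (normal_form (c, ?b'))) \<in> edges\<^sup>+"
      by (intro corner_mono[OF c b(1) _ b(2)]) (auto simp: \<phi>(2))
    moreover have "?b = ?b' \<Longrightarrow> \<forall>k\<in>{1..n}. \<phi> (t k) = \<phi> (t' k)" by (metis restrict_apply')
    ultimately show ?thesis
      unfolding m using acyclic_edges[unfolded acyclic_def] by (metis rtrancl.rtrancl_refl trancl_into_rtrancl)
  qed
  have lo: "(lo (cls (c, t)), lo (cls (c, t'))) \<in> edges\<^sup>*"
    "lo (cls (c, t)) = lo (cls (c, t')) \<Longrightarrow> k \<in> {1..n} \<Longrightarrow> round_down (t k) = round_down (t' k)" for k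
    unfolding lo_cls[OF v(1)] lo_cls[OF v(2)]
    using *[of round_down] by (auto simp: round_down_def is_endpoint_def)
  have hi: "(hi (cls (c, t)), hi (cls (c, t'))) \<in> edges\<^sup>*"
    "hi (cls (c, t)) = hi (cls (c, t')) \<Longrightarrow> k \<in> {1..n} \<Longrightarrow> round_up (t k) = round_up (t' k)" for k
    unfolding hi_cls[OF v(1)] hi_cls[OF v(2)]
    using *[of round_up] by (auto simp: round_up_def is_endpoint_def)
  show ?thesis
    unfolding point_le_def
  proof (intro conjI impI lo hi)
    assume eq: "lo (cls (c, t)) = lo (cls (c, t')) \<and> hi (cls (c, t)) = hi (cls (c, t'))"
    have "(t k = 0 \<longleftrightarrow> t' k = 0) \<and> (t k = 1 \<longleftrightarrow> t' k = 1)" if "k \<in> {1..n}" for k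
      using lo(2)[of k] hi(2)[of k] eq that by (auto simp: round_down_def round_up_def of_bool_eq_iff)
    from cube_normal_form_parallel[OF c t(1) le this]
    show "fst (canon (cls (c, t))) = fst (canon (cls (c, t')))" "snd (canon (cls (c, t))) \<le> snd (canon (cls (c, t')))"
      using c by (simp_all add: canon_cls normal_form_def)
  qed
qed

end

section \<open>Directed paths in the realization\<close>

lemma restrict_mem_cong: "\<lbrakk>restrict f A \<in> P; \<And>u. u \<in> A \<Longrightarrow> f u = g u\<rbrakk> \<Longrightarrow> restrict g A \<in> P"
  by (metis restrict_ext)

context precubical
begin

sublocale dspace "realization K"
  by unfold_locales (rule is_dspace_realization)

lemma cube_path_dpath:
  assumes c: "c \<in> cells K n" and \<gamma>: "\<gamma> \<in> dpaths (directed_cube n)"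
  shows "restrict (\<lambda>s. cls (c, \<gamma> s)) {0..1} \<in> dpaths (realization K)"
proof -
  let ?\<delta> = "restrict (\<lambda>s. (c, \<gamma> s)) {0..1}"
  have "?\<delta> \<in> dpaths (cube_sum K)"
    using c \<gamma> cells_cubes[OF c] unfolding cube_sum_def sum_dspace_def
    by (simp, intro exI[of _ c] exI[of _ \<gamma>], simp)
  moreover have "restrict (cls \<circ> ?\<delta>) {0..1} = restrict (\<lambda>s. cls (c, \<gamma> s)) {0..1}"
    by (rule restrict_ext) simp
  ultimately show ?thesis
    unfolding realization_def quotient_dspace_def by force
qed

lemma dpaths_realization_induct:
  assumes P: "d_structure (dtop (realization K)) P"
    and cube: "\<And>n c \<gamma>. \<lbrakk>c \<in> cells K n; \<gamma> \<in> dpaths (directed_cube n)\<rbrakk> \<Longrightarrow> restrict (\<lambda>s. cls (c, \<gamma> s)) {0..1} \<in> P"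
    and \<omega>: "\<omega> \<in> dpaths (realization K)"
  shows "\<omega> \<in> P"
proof -
  have "restrict (cls \<circ> \<delta>) {0..1} \<in> P" if \<delta>: "\<delta> \<in> dpaths (cube_sum K)" for \<delta>
  proof -
    obtain c \<gamma> where c: "c \<in> cubes K" "\<gamma> \<in> dpaths (directed_cube (dim c))" "\<delta> = restrict (\<lambda>s. (c, \<gamma> s)) {0..1}"
      using \<delta> unfolding cube_sum_def sum_dspace_def by auto
    have "restrict (cls \<circ> \<delta>) {0..1} = restrict (\<lambda>s. cls (c, \<gamma> s)) {0..1}"
      unfolding c(3) by (rule restrict_ext) simp
    then show ?thesis using cube[OF cubes_cells[OF c(1)] c(2)] by simp
  qed
  moreover have "d_structure (quotient_topology (dtop (cube_sum K)) cls) P"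
    using P by (simp add: realization_def quotient_dspace_def)
  ultimately show ?thesis
    using \<omega> unfolding realization_def quotient_dspace_def by force
qed

lemma directed_cube_pathI:
  assumes "\<And>s. s \<in> {0..1} \<Longrightarrow> \<gamma> s \<in> unit_cube n"
    and "\<And>k. k \<in> {1..n} \<Longrightarrow> continuous_on {0..1} (\<lambda>s. \<gamma> s k)"
    and "\<And>k s s'. \<lbrakk>k \<in> {1..n}; 0 \<le> s; s \<le> s'; s' \<le> 1\<rbrakk> \<Longrightarrow> \<gamma> s k \<le> \<gamma> s' k"
  shows "restrict \<gamma> {0..1} \<in> dpaths (directed_cube n)"
proof -
  have "continuous_map unit_interval (cube_topology n) \<gamma>"
    by (rule continuous_map_into_cube) (use assms in auto)
  then have "continuous_map unit_interval (cube_topology n) (restrict \<gamma> {0..1})"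
    by (rule continuous_map_eq) simp
  moreover have "mono_on {0..1} (\<lambda>s. restrict \<gamma> {0..1} s k)" if "k \<in> {1..n}" for k
    by (rule mono_onI) (use assms(3)[OF that] in auto)
  ultimately show ?thesis by (simp add: directed_cube_def mapping_space_def)
qed

lemma
  assumes "\<gamma> \<in> dpaths (directed_cube n)"
  shows directed_cube_path_in: "\<lbrakk>0 \<le> s; s \<le> 1\<rbrakk> \<Longrightarrow> \<gamma> s \<in> unit_cube n"
    and directed_cube_path_continuous: "k \<in> {1..n} \<Longrightarrow> continuous_on {0..1} (\<lambda>s. \<gamma> s k)"
    and directed_cube_path_mono: "\<lbrakk>0 \<le> s; s \<le> s'; s' \<le> 1\<rbrakk> \<Longrightarrow> \<gamma> s \<le> \<gamma> s'"
proof -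
  have c: "continuous_map unit_interval (cube_topology n) \<gamma>"
    and m: "\<And>k. k \<in> {1..n} \<Longrightarrow> mono_on {0..1} (\<lambda>s. \<gamma> s k)"
    using assms by (auto simp: directed_cube_def mapping_space_def)
  show in_cube: "\<gamma> s \<in> unit_cube n" if "0 \<le> s" "s \<le> 1" for s
    using c that by (fastforce simp: continuous_map_def Pi_iff)
  show "continuous_on {0..1} (\<lambda>s. \<gamma> s k)" if "k \<in> {1..n}"
    using continuous_map_cube_coordinate[OF c that] by simp
  show "\<gamma> s \<le> \<gamma> s'" if "0 \<le> s" "s \<le> s'" "s' \<le> 1"
  proof (rule cube_leI)
    show "\<gamma> s k \<le> \<gamma> s' k" if "k \<in> {1..n}" for k
      using mono_onD[OF m[OF that], of s s'] \<open>0 \<le> s\<close> \<open>s \<le> s'\<close> \<open>s' \<le> 1\<close> by simp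
  qed (use in_cube that in auto)
qed

lemma segment_path:
  assumes c: "c \<in> cells K n" and t: "t \<in> unit_cube n" "t' \<in> unit_cube n" "t \<le> t'"
  shows "\<exists>\<omega>. \<omega> \<in> paths (cls (c, t)) (cls (c, t'))"
proof -
  let ?\<gamma> = "\<lambda>s. restrict (\<lambda>k. (1 - s) * t k + s * t' k) {1..n}"
  have t01: "0 \<le> t k" "t k \<le> 1" "0 \<le> t' k" "t' k \<le> 1" if "k \<in> {1..n}" for k
    using t that by (auto simp: cube_iff)
  have mem: "?\<gamma> s \<in> unit_cube n" if "s \<in> {0..1}" for s
    by (rule restrict_in_cube) (use that t01 in \<open>auto intro!: convex_bound_le\<close>)
  have "restrict ?\<gamma> {0..1} \<in> dpaths (directed_cube n)"
  proof (rule directed_cube_pathI[OF mem])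
    show "continuous_on {0..1} (\<lambda>s. ?\<gamma> s k)" if "k \<in> {1..n}" for k
      using that by (auto intro!: continuous_intros)
    show "?\<gamma> s k \<le> ?\<gamma> s' k" if "k \<in> {1..n}" "0 \<le> s" "s \<le> s'" "s' \<le> 1" for k s s'
    proof -
      have "s * (t' k - t k) \<le> s' * (t' k - t k)"
        using le_funD[OF t(3), of k] that by (intro mult_right_mono) auto
      then show ?thesis using that by (simp add: algebra_simps)
    qed
  qed
  from cube_path_dpath[OF c this]
  have "restrict (\<lambda>s. cls (c, restrict ?\<gamma> {0..1} s)) {0..1} \<in> dpaths (realization K)" .
  moreover have "?\<gamma> 0 = t" by (rule cube_eqI[OF mem t(1)]) auto
  moreover have "?\<gamma> 1 = t'" by (rule cube_eqI[OF mem t(2)]) auto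
  ultimately show ?thesis
    by (intro exI[of _ "restrict (\<lambda>s. cls (c, restrict ?\<gamma> {0..1} s)) {0..1}"]) (simp add: paths_iff)
qed

end

context loop_free_precubical
begin

text \<open>The d-paths form the smallest d-structure that contains the paths in the cubes, and the paths
along which \<open>point_le\<close> increases form another one: transitivity gives closure under concatenation.\<close>

lemma dpath_point_le:
  assumes "\<omega> \<in> dpaths (realization K)" "0 \<le> s" "s \<le> s'" "s' \<le> 1"
  shows "point_le (\<omega> s) (\<omega> s')"
proof -
  let ?T = "dtop (realization K)"
  let ?P = "{\<omega> \<in> mapping_space unit_interval ?T. \<forall>s s'. 0 \<le> s \<and> s \<le> s' \<and> s' \<le> 1 \<longrightarrow> point_le (\<omega> s) (\<omega> s')}"
  have M: "d_structure ?T (mapping_space unit_interval ?T)" by (rule d_structure_mapping_space)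
  have "d_structure ?T ?P"
    unfolding d_structure_def[of _ ?P]
  proof (intro conjI ballI allI impI)
    show "const_path x \<in> ?P" if "x \<in> topspace ?T" for x
      using M that by (auto simp: d_structure_def) (auto simp: const_path_def point_le_refl)
    show "path_concat \<alpha> \<beta> \<in> ?P" if \<alpha>: "\<alpha> \<in> ?P" and \<beta>: "\<beta> \<in> ?P" and eq: "\<alpha> 1 = \<beta> 0" for \<alpha> \<beta>
    proof -
      have "path_concat \<alpha> \<beta> \<in> mapping_space unit_interval ?T"
        using M \<alpha> \<beta> eq by (simp add: d_structure_def)
      moreover have "point_le (path_concat \<alpha> \<beta> s) (path_concat \<alpha> \<beta> s')" if s: "0 \<le> s" "s \<le> s'" "s' \<le> 1" for s s'
      proof -
        consider "s' \<le> 1/2" | "s \<le> 1/2" "1/2 < s'" | "1/2 < s" by linarith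
        then show ?thesis
        proof cases
          case 2
          have "point_le (\<alpha> (2 * s)) (\<alpha> 1)" "point_le (\<beta> 0) (\<beta> (2 * s' - 1))"
            using \<alpha> \<beta> 2 s by auto
          then have "point_le (\<alpha> (2 * s)) (\<beta> (2 * s' - 1))" using point_le_trans eq by simp
          then show ?thesis using 2 s by (simp add: path_concat_def)
        qed (use \<alpha> \<beta> s in \<open>auto simp: path_concat_def\<close>)
      qed
      ultimately show ?thesis by simp
    qed
    show "restrict (\<alpha> \<circ> \<phi>) {0..1} \<in> ?P"
      if \<alpha>: "\<alpha> \<in> ?P" and \<phi>: "continuous_on {0..1} \<phi> \<and> \<phi> ` {0..1} \<subseteq> {0..1} \<and> mono_on {0..1} \<phi>" for \<alpha> and \<phi> :: "real \<Rightarrow> real"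
    proof -
      have r: "reparametrization \<phi>" using \<phi> by (simp add: reparametrization_def)
      have "restrict (\<alpha> \<circ> \<phi>) {0..1} \<in> mapping_space unit_interval ?T"
        using M \<alpha> \<phi> by (simp add: d_structure_def)
      then show ?thesis
        using \<alpha> reparametrization_range[OF r] reparametrization_mono[OF r] by auto
    qed
  qed auto
  moreover have "restrict (\<lambda>s. cls (c, \<gamma> s)) {0..1} \<in> ?P"
    if c: "c \<in> cells K n" and \<gamma>: "\<gamma> \<in> dpaths (directed_cube n)" for n c \<gamma>
    using dpath_mapping_space[OF cube_path_dpath[OF c \<gamma>]] point_le_cube[OF c]
      directed_cube_path_in[OF \<gamma>] directed_cube_path_mono[OF \<gamma>] by auto
  ultimately have "\<omega> \<in> ?P" using assms(1) by (rule dpaths_realization_induct)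
  then show ?thesis using assms(2-4) by blast
qed

sublocale loop_free_dspace "realization K"
proof unfold_locales
  fix \<omega> x assume \<omega>: "\<omega> \<in> paths x x"
  have \<omega>': "\<omega> \<in> dpaths (realization K)" "\<omega> 0 = x" "\<omega> 1 = x" using \<omega> by (simp_all only: paths_iff)
  have "\<omega> u = x" if "0 \<le> u" "u \<le> 1" for u
  proof (rule point_le_antisym)
    show "point_le (\<omega> u) x" using dpath_point_le[OF \<omega>'(1), of u 1] that \<omega>'(3) by simp
    show "point_le x (\<omega> u)" using dpath_point_le[OF \<omega>'(1), of 0 u] that \<omega>'(2) by simp
    show "\<omega> u \<in> points" using dpath_in_space[OF \<omega>'(1) that] .
    show "x \<in> points" using dpath_in_space[OF \<omega>'(1), of 0] \<omega>'(2) by simp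
  qed
  then show "\<omega> = const_path x"
    using extensional_arb[OF dpath_extensional[OF \<omega>'(1)]] by (intro ext) (simp add: const_path_def)
qed

lemma reachable_point_le:
  assumes "reachable (realization K) x y"
  shows "point_le x y"
proof -
  obtain \<omega> where "\<omega> \<in> paths x y" using assms unfolding reachable_def by blast
  then have "\<omega> \<in> dpaths (realization K)" "\<omega> 0 = x" "\<omega> 1 = y" by (simp_all only: paths_iff)
  then show ?thesis using dpath_point_le[of \<omega> 0 1] by simp
qed

end

section \<open>Coordinatewise flows\<close>

definition coordinate_flow :: "(real \<Rightarrow> real \<Rightarrow> real) \<Rightarrow> bool" where
  "coordinate_flow F \<longleftrightarrow>
     continuous_on ({0..1} \<times> {0..1}) (\<lambda>(s, x). F s x) \<and>
     (\<forall>s\<in>{0..1}. endpoint_preserving (F s)) \<and>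
     (\<forall>s\<in>{0..1}. \<forall>s'\<in>{0..1}. \<forall>x\<in>{0..1}. \<forall>x'\<in>{0..1}. s \<le> s' \<longrightarrow> x \<le> x' \<longrightarrow> F s x \<le> F s' x')"

lemma
  assumes "coordinate_flow F"
  shows coordinate_flow_endpoint: "\<lbrakk>0 \<le> s; s \<le> 1\<rbrakk> \<Longrightarrow> endpoint_preserving (F s)"
    and coordinate_flow_range: "\<lbrakk>0 \<le> s; s \<le> 1; 0 \<le> x; x \<le> 1\<rbrakk> \<Longrightarrow> 0 \<le> F s x \<and> F s x \<le> 1"
    and coordinate_flow_mono: "\<lbrakk>0 \<le> s; s \<le> s'; s' \<le> 1; 0 \<le> x; x \<le> x'; x' \<le> 1\<rbrakk> \<Longrightarrow> F s x \<le> F s' x'"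
  using assms by (auto simp: coordinate_flow_def endpoint_preserving_def)

lemma coordinate_flow_continuous_map:
  assumes F: "coordinate_flow F" and a: "continuous_map Z unit_interval a" and b: "continuous_map Z unit_interval b"
  shows "continuous_map Z euclideanreal (\<lambda>z. F (a z) (b z))"
proof -
  have "continuous_map (prod_topology unit_interval unit_interval) euclideanreal (\<lambda>(s, x). F s x)"
    using F by (simp add: coordinate_flow_def prod_topology_subtopology_eu)
  from continuous_map_compose[OF continuous_map_pairedI[OF a b] this] show ?thesis by (simp add: o_def)
qed

context precubical
begin

definition flow :: "(real \<Rightarrow> real \<Rightarrow> real) \<Rightarrow> real \<Rightarrow> ('c \<times> (nat \<Rightarrow> real)) set \<Rightarrow> ('c \<times> (nat \<Rightarrow> real)) set" where
  "flow F s z = cls (map_coords K (F s) (canon z))"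

lemma flow_cls:
  assumes F: "coordinate_flow F" and p: "valid p" and s: "0 \<le> s" "s \<le> 1"
  shows "flow F s (cls p) = cls (map_coords K (F s) p)"
  unfolding flow_def canon_cls
  by (rule cls_map_coords_cong[OF coordinate_flow_endpoint[OF F s] cls_normal_form[OF p]])

lemma flow_cube_path:
  assumes F: "coordinate_flow F" and c: "c \<in> cells K n" and \<gamma>: "\<gamma> \<in> dpaths (directed_cube n)"
    and a: "reparametrization a" and b: "reparametrization b"
  shows "restrict (\<lambda>u. flow F (a u) (cls (c, \<gamma> (b u)))) {0..1} \<in> dpaths (realization K)"
proof -
  let ?\<gamma> = "\<lambda>u. restrict (\<lambda>k. F (a u) (\<gamma> (b u) k)) {1..n}"
  have \<gamma>01: "0 \<le> \<gamma> s k \<and> \<gamma> s k \<le> 1" if "0 \<le> s" "s \<le> 1" "k \<in> {1..n}" for s k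
    using directed_cube_path_in[OF \<gamma> that(1,2)] that(3) unfolding cube_iff by blast
  note ar = reparametrization_range[OF a] and br = reparametrization_range[OF b]
  have "restrict ?\<gamma> {0..1} \<in> dpaths (directed_cube n)"
  proof (rule directed_cube_pathI)
    show "?\<gamma> u \<in> unit_cube n" if "u \<in> {0..1}" for u
      by (rule restrict_in_cube, rule coordinate_flow_range[OF F]) (use that ar br \<gamma>01 in auto)
    show "continuous_on {0..1} (\<lambda>u. ?\<gamma> u k)" if k: "k \<in> {1..n}" for k
    proof -
      have "continuous_on {0..1} (\<lambda>u. \<gamma> (b u) k)"
        by (rule continuous_on_compose2[OF directed_cube_path_continuous[OF \<gamma> k] reparametrization_continuous[OF b]])
          (use br in auto)
      then have "continuous_map unit_interval euclideanreal (\<lambda>u. F (a u) (\<gamma> (b u) k))"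
        by (intro coordinate_flow_continuous_map[OF F] continuous_map_into_interval)
          (use reparametrization_continuous[OF a] ar br \<gamma>01 k in auto)
      then show ?thesis using k by simp
    qed
    show "?\<gamma> u k \<le> ?\<gamma> u' k" if "k \<in> {1..n}" "0 \<le> u" "u \<le> u'" "u' \<le> 1" for k u u'
    proof -
      have "\<gamma> (b u) k \<le> \<gamma> (b u') k"
        using directed_cube_path_mono[OF \<gamma>, of "b u" "b u'"] reparametrization_mono[OF b that(2-4)]
          br[of u] br[of u'] that by (auto simp: le_fun_def)
      moreover have "a u \<le> a u'" "0 \<le> a u" "a u' \<le> 1"
        using reparametrization_mono[OF a that(2-4)] ar[of u] ar[of u'] that by auto
      moreover have "0 \<le> \<gamma> (b u) k" "\<gamma> (b u') k \<le> 1"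
        using \<gamma>01[of "b u" k] \<gamma>01[of "b u'" k] br[of u] br[of u'] that by auto
      ultimately have "F (a u) (\<gamma> (b u) k) \<le> F (a u') (\<gamma> (b u') k)"
        using coordinate_flow_mono[OF F] by blast
      then show ?thesis using that by simp
    qed
  qed
  from cube_path_dpath[OF c this]
  have "restrict (\<lambda>u. cls (c, restrict ?\<gamma> {0..1} u)) {0..1} \<in> dpaths (realization K)" .
  moreover have "cls (c, restrict ?\<gamma> {0..1} u) = flow F (a u) (cls (c, \<gamma> (b u)))" if "u \<in> {0..1}" for u
  proof -
    have "valid (c, \<gamma> (b u))"
      using c directed_cube_path_in[OF \<gamma>, of "b u"] br[of u] that by (auto simp: valid_def)
    then show ?thesis
      using flow_cls[OF F, of "(c, \<gamma> (b u))" "a u"] ar[of u] that c by (simp add: map_coords_def)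
  qed
  ultimately show ?thesis by (rule restrict_mem_cong)
qed

text \<open>The reparametrization \<open>b\<close> of the path may cross the middle of the concatenation at any time \<open>c\<close>. The path is
split there, and before and after \<open>c\<close> only one of the two paths is involved.\<close>

lemma flow_concat:
  assumes \<alpha>: "\<And>a b. reparametrization a \<Longrightarrow> reparametrization b \<Longrightarrow>
        restrict (\<lambda>u. flow F (a u) (\<alpha> (b u))) {0..1} \<in> dpaths (realization K)"
    and \<beta>: "\<And>a b. reparametrization a \<Longrightarrow> reparametrization b \<Longrightarrow>
        restrict (\<lambda>u. flow F (a u) (\<beta> (b u))) {0..1} \<in> dpaths (realization K)"
    and eq: "\<alpha> 1 = \<beta> 0" and a: "reparametrization a" and b: "reparametrization b"
  shows "restrict (\<lambda>u. flow F (a u) (path_concat \<alpha> \<beta> (b u))) {0..1} \<in> dpaths (realization K)"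
proof -
  note br = reparametrization_range[OF b] and bm = reparametrization_mono[OF b]
  have first: "restrict (\<lambda>u. flow F (a (\<phi> u)) (path_concat \<alpha> \<beta> (b (\<phi> u)))) {0..1} \<in> dpaths (realization K)"
    if \<phi>: "reparametrization \<phi>" "b (\<phi> 1) \<le> 1/2" for \<phi>
  proof -
    have "path_concat \<alpha> \<beta> (b (\<phi> u)) = \<alpha> (min 1 (2 * b (\<phi> u)))" if "u \<in> {0..1}" for u
    proof -
      have "0 \<le> b (\<phi> u)" "b (\<phi> u) \<le> b (\<phi> 1)"
        using reparametrization_range[OF reparametrization_comp[OF b \<phi>(1)], of u]
          reparametrization_mono[OF reparametrization_comp[OF b \<phi>(1)], of u 1] that by auto
      moreover from this have "min 1 (2 * b (\<phi> u)) = 2 * b (\<phi> u)" using \<phi>(2) by simp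
      ultimately show ?thesis using \<phi>(2) by (simp add: path_concat_def)
    qed
    then show ?thesis
      by (intro restrict_mem_cong[OF \<alpha>[OF reparametrization_comp[OF a \<phi>(1)]
          reparametrization_comp[OF reparametrization_basic(3) reparametrization_comp[OF b \<phi>(1)]]]]) simp
  qed
  have second: "restrict (\<lambda>u. flow F (a (\<phi> u)) (path_concat \<alpha> \<beta> (b (\<phi> u)))) {0..1} \<in> dpaths (realization K)"
    if \<phi>: "reparametrization \<phi>" "1/2 \<le> b (\<phi> 0)" for \<phi>
  proof -
    have "path_concat \<alpha> \<beta> (b (\<phi> u)) = \<beta> (max 0 (2 * b (\<phi> u) - 1))" if "u \<in> {0..1}" for u
    proof -
      have "b (\<phi> u) \<le> 1" "b (\<phi> 0) \<le> b (\<phi> u)"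
        using reparametrization_range[OF reparametrization_comp[OF b \<phi>(1)], of u]
          reparametrization_mono[OF reparametrization_comp[OF b \<phi>(1)], of 0 u] that by auto
      then consider "b (\<phi> u) = 1/2" | "1/2 < b (\<phi> u)" "b (\<phi> u) \<le> 1" using \<phi>(2) by linarith
      then show ?thesis
      proof cases
        case 1
        show ?thesis unfolding 1 by (simp add: path_concat_def eq)
      qed (simp add: path_concat_def)
    qed
    then show ?thesis
      by (intro restrict_mem_cong[OF \<beta>[OF reparametrization_comp[OF a \<phi>(1)]
          reparametrization_comp[OF reparametrization_affine(3) reparametrization_comp[OF b \<phi>(1)]]]]) simp
  qed
  consider "b 1 \<le> 1/2" | "1/2 \<le> b 0" | "b 0 < 1/2" "1/2 < b 1" by linarith
  then show ?thesis
  proof cases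
    case 1
    then show ?thesis using first[OF reparametrization_basic(1)] by simp
  next
    case 2
    then show ?thesis using second[OF reparametrization_basic(1)] by simp
  next
    case 3
    obtain c where c: "0 \<le> c" "c \<le> 1" "b c = 1/2"
      using IVT'[of b 0 "1/2" 1] 3 reparametrization_continuous[OF b] by auto
    have "c \<noteq> 0" "c \<noteq> 1" using c(3) 3 by auto
    then have c': "0 < c" "c < 1" using c by auto
    show ?thesis
      by (rule dpath_split[OF c' first second]) (use c in \<open>auto intro!: reparametrization_affine\<close>)
  qed
qed

text \<open>On the coproduct the flow preserves the summands, so an open set around the image can be pulled back in one
cube, which is open in the coproduct.\<close>

lemma continuous_map_cube_sum_flow:
  assumes F: "coordinate_flow F"
  shows "continuous_map (prod_topology unit_interval (dtop (cube_sum K))) (dtop (cube_sum K))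
    (\<lambda>(s, p). map_coords K (F s) p)"
proof -
  let ?S = "dtop (cube_sum K)" and ?G = "\<lambda>(s, p). map_coords K (F s) p"
  have S: "?S = sum_topology (\<lambda>c. cube_topology (dim c)) (cubes K)"
    by (simp add: cube_sum_def sum_dspace_def directed_cube_def)
  have top: "(c, t) \<in> topspace ?S \<longleftrightarrow> valid (c, t)" for c t
    by (auto simp: S valid_iff)
  show ?thesis
    unfolding continuous_map_def
  proof (intro conjI allI impI)
    show "?G \<in> topspace (prod_topology unit_interval ?S) \<rightarrow> topspace ?S"
      using valid_map_coords[OF coordinate_flow_endpoint[OF F]] top by (force simp: map_coords_def)
    fix U assume U: "openin ?S U"
    show "openin (prod_topology unit_interval ?S) {z \<in> topspace (prod_topology unit_interval ?S). ?G z \<in> U}"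
      unfolding openin_prod_topology_alt
    proof (intro allI impI)
      fix s p assume "(s, p) \<in> {z \<in> topspace (prod_topology unit_interval ?S). ?G z \<in> U}"
      then obtain c t where p: "p = (c, t)" "s \<in> {0..1}" "valid (c, t)" "map_coords K (F s) (c, t) \<in> U"
        using top by (cases p) auto
      let ?C = "cube_topology (dim c)"
      let ?g = "\<lambda>z. restrict (\<lambda>k. F (fst z) (snd z k)) {1..dim c}"
      have c: "c \<in> cubes K" and t: "t \<in> topspace ?C" using p(3) by (auto simp: valid_iff)
      have g: "continuous_map (prod_topology unit_interval ?C) ?C ?g"
      proof (rule continuous_map_into_cube)
        show "?g z \<in> topspace ?C" if "z \<in> topspace (prod_topology unit_interval ?C)" for z
          by (rule restrict_in_cube, rule coordinate_flow_range[OF F])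
            (use that in \<open>auto simp: cube_iff\<close>)
        show "continuous_map (prod_topology unit_interval ?C) euclideanreal (\<lambda>z. ?g z k)" if k: "k \<in> {1..dim c}" for k
        proof -
          have "continuous_map (prod_topology unit_interval ?C) unit_interval (\<lambda>z. snd z k)"
            using continuous_map_cube_coordinate[OF continuous_map_snd k]
            by (rule continuous_map_into_interval) (use k in \<open>auto simp: cube_iff\<close>)
          from coordinate_flow_continuous_map[OF F continuous_map_fst this] show ?thesis using k by simp
        qed
      qed
      have "openin ?C {x. (c, x) \<in> U}" using U c unfolding S openin_sum_topology by blast
      then have opn: "openin (prod_topology unit_interval ?C)
          {z \<in> topspace (prod_topology unit_interval ?C). ?g z \<in> {x. (c, x) \<in> U}}"
        using g unfolding continuous_map_def by blast
      have mem: "(s, t) \<in> {z \<in> topspace (prod_topology unit_interval ?C). ?g z \<in> {x. (c, x) \<in> U}}"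
        using p t by (simp add: map_coords_def)
      from openin_prod_topology_alt[THEN iffD1, rule_format, OF opn mem] obtain V W where VW: "openin unit_interval V" "openin ?C W" "s \<in> V" "t \<in> W"
        "V \<times> W \<subseteq> {z \<in> topspace (prod_topology unit_interval ?C). ?g z \<in> {x. (c, x) \<in> U}}"
        by (elim exE conjE)
      have "openin ?S (Pair c ` W)"
        using open_map_component_injection[OF c, of "\<lambda>c. cube_topology (dim c)"] VW(2)
        unfolding S open_map_def by blast
      moreover have "V \<times> Pair c ` W \<subseteq> {z \<in> topspace (prod_topology unit_interval ?S). ?G z \<in> U}"
      proof
        fix z assume "z \<in> V \<times> Pair c ` W"
        then obtain s' t' where z: "z = (s', (c, t'))" "s' \<in> V" "t' \<in> W" by auto
        then have "(s', t') \<in> {z \<in> topspace (prod_topology unit_interval ?C). ?g z \<in> {x. (c, x) \<in> U}}"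
          using VW(5) by blast
        then show "z \<in> {z \<in> topspace (prod_topology unit_interval ?S). ?G z \<in> U}"
          using z(1) c by (auto simp: map_coords_def top valid_iff)
      qed
      ultimately show "\<exists>V W. openin unit_interval V \<and> openin ?S W \<and> s \<in> V \<and> p \<in> W \<and>
          V \<times> W \<subseteq> {z \<in> topspace (prod_topology unit_interval ?S). ?G z \<in> U}"
        using VW p(1) by blast
    qed
  qed
qed

lemma quotient_map_cls: "quotient_map (dtop (cube_sum K)) (dtop (realization K)) cls"
  by (simp add: realization_def quotient_dspace_def quotient_map_quotient_topology)

text \<open>Since the unit interval is locally compact, its product with the quotient map is again a quotient map, so that
continuity can be checked on the coproduct of the cubes.\<close>

lemma continuous_map_flow_realization:
  assumes F: "coordinate_flow F"
  shows "continuous_map (prod_topology unit_interval (dtop (realization K))) (dtop (realization K)) (\<lambda>(s, z). flow F s z)"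
proof -
  let ?S = "dtop (cube_sum K)" and ?R = "dtop (realization K)"
  have "compact_space unit_interval" by (simp add: compact_space_subtopology)
  then have q: "quotient_map (prod_topology unit_interval ?S) (prod_topology unit_interval ?R) (\<lambda>(s, p). (s, cls p))"
    by (intro quotient_map_prod_right quotient_map_cls compact_imp_locally_compact_space disjI1
        Hausdorff_space_subtopology Hausdorff_space_euclidean)
  have "continuous_map (prod_topology unit_interval ?S) ?R (cls \<circ> (\<lambda>(s, p). map_coords K (F s) p))"
    by (rule continuous_map_compose[OF continuous_map_cube_sum_flow[OF F]
        quotient_imp_continuous_map[OF quotient_map_cls]])
  then have "continuous_map (prod_topology unit_interval ?S) ?R ((\<lambda>(s, z). flow F s z) \<circ> (\<lambda>(s, p). (s, cls p)))"
  proof (rule continuous_map_eq)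
    fix z assume "z \<in> topspace (prod_topology unit_interval ?S)"
    then obtain s p where z: "z = (s, p)" "0 \<le> s" "s \<le> 1" "valid p"
      by (auto simp: cube_sum_def sum_dspace_def directed_cube_def valid_iff)
    then show "(cls \<circ> (\<lambda>(s, p). map_coords K (F s) p)) z = ((\<lambda>(s, z). flow F s z) \<circ> (\<lambda>(s, p). (s, cls p))) z"
      using flow_cls[OF F] by simp
  qed
  then show ?thesis using continuous_compose_quotient_map_eq[OF q] by blast
qed

text \<open>The paths \<open>\<omega>\<close> for which all \<open>u \<mapsto> flow F (a u) (\<omega> (b u))\<close> are d-paths form a d-structure that contains the
paths in the cubes.\<close>

lemma directed_flow_coordinate_flow:
  assumes F: "coordinate_flow F"
  shows "directed_flow (flow F)"
  unfolding directed_flow_def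
proof (intro conjI ballI allI impI continuous_map_flow_realization[OF F])
  let ?T = "dtop (realization K)"
  let ?P = "{\<omega> \<in> mapping_space unit_interval ?T. \<forall>a b. reparametrization a \<longrightarrow> reparametrization b \<longrightarrow>
      restrict (\<lambda>u. flow F (a u) (\<omega> (b u))) {0..1} \<in> dpaths (realization K)}"
  have M: "d_structure ?T (mapping_space unit_interval ?T)" by (rule d_structure_mapping_space)
  have cube: "restrict (\<lambda>s. cls (c, \<gamma> s)) {0..1} \<in> ?P"
    if c: "c \<in> cells K n" and \<gamma>: "\<gamma> \<in> dpaths (directed_cube n)" for n c \<gamma>
  proof -
    have "restrict (\<lambda>u. flow F (a u) (restrict (\<lambda>s. cls (c, \<gamma> s)) {0..1} (b u))) {0..1} \<in> dpaths (realization K)"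
      if ab: "reparametrization a" "reparametrization b" for a b
      by (rule restrict_mem_cong[OF flow_cube_path[OF F c \<gamma> ab]])
        (use reparametrization_range[OF ab(2)] in simp)
    then show ?thesis using dpath_mapping_space[OF cube_path_dpath[OF c \<gamma>]] by simp
  qed
  have P: "d_structure ?T ?P"
    unfolding d_structure_def[of _ ?P]
  proof (intro conjI ballI allI impI)
    show "const_path x \<in> ?P" if x: "x \<in> topspace ?T" for x
    proof -
      obtain c t where ct: "interior_rep (c, t)" "x = cls (c, t)" "canon x = (c, t)" by (rule pointE[OF x])
      then obtain n where n: "c \<in> cells K n" "t \<in> unit_cube n"
        by (auto simp: interior_rep_def valid_def)
      have "restrict (\<lambda>_. t) {0..1} \<in> dpaths (directed_cube n)"
        by (rule directed_cube_pathI) (use n in auto)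
      from cube[OF n(1) this] show ?thesis
        unfolding const_path_def ct(2) by (rule restrict_mem_cong) simp
    qed
    show "path_concat \<alpha> \<beta> \<in> ?P" if \<alpha>: "\<alpha> \<in> ?P" and \<beta>: "\<beta> \<in> ?P" and eq: "\<alpha> 1 = \<beta> 0" for \<alpha> \<beta>
      using M \<alpha> \<beta> eq flow_concat[of F \<alpha> \<beta>] by (auto simp: d_structure_def)
    show "restrict (\<alpha> \<circ> \<phi>) {0..1} \<in> ?P"
      if \<alpha>: "\<alpha> \<in> ?P" and \<phi>: "continuous_on {0..1} \<phi> \<and> \<phi> ` {0..1} \<subseteq> {0..1} \<and> mono_on {0..1} \<phi>" for \<alpha> and \<phi> :: "real \<Rightarrow> real"
    proof -
      have r: "reparametrization \<phi>" using \<phi> by (simp add: reparametrization_def)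
      have "restrict (\<lambda>u. flow F (a u) (restrict (\<alpha> \<circ> \<phi>) {0..1} (b u))) {0..1} \<in> dpaths (realization K)"
        if ab: "reparametrization a" "reparametrization b" for a b
      proof -
        have "restrict (\<lambda>u. flow F (a u) (\<alpha> (\<phi> (b u)))) {0..1} \<in> dpaths (realization K)"
          using \<alpha> ab(1) reparametrization_comp[OF r ab(2)] by simp
        then show ?thesis
          by (rule restrict_mem_cong) (use reparametrization_range[OF ab(2)] in simp)
      qed
      then show ?thesis using M \<alpha> \<phi> by (simp add: d_structure_def)
    qed
  qed auto
  fix \<omega> and a b :: "real \<Rightarrow> real"
  assume \<omega>: "\<omega> \<in> dpaths (realization K)" and ab: "reparametrization a \<and> reparametrization b"
  have "\<omega> \<in> ?P" using P cube \<omega> by (rule dpaths_realization_induct)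
  then show "restrict (\<lambda>u. flow F (a u) (\<omega> (b u))) {0..1} \<in> dpaths (realization K)" using ab by blast
qed

end

section \<open>Triviality criteria\<close>

context dspace
begin

lemma subpath_reachable:
  assumes \<beta>: "\<beta> \<in> dpaths X" and u: "0 \<le> u" "u \<le> 1"
  shows "reachable X (\<beta> 0) (\<beta> u)" and "reachable X (\<beta> u) (\<beta> 1)"
proof -
  have "restrict (\<lambda>v. \<beta> (u * v)) {0..1} \<in> paths (\<beta> 0) (\<beta> u)"
    "restrict (\<lambda>v. \<beta> (u + (1 - u) * v)) {0..1} \<in> paths (\<beta> u) (\<beta> 1)"
    using dpath_reparametrize[OF \<beta> reparametrization_affine(1)[OF u]]
      dpath_reparametrize[OF \<beta> reparametrization_affine(2)[OF u]] by (simp_all add: paths_iff)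
  then show "reachable X (\<beta> 0) (\<beta> u)" "reachable X (\<beta> u) (\<beta> 1)" unfolding reachable_def by blast+
qed

lemma dpaths_in_up_part: "\<beta> \<in> dpaths_between X A {z} {w} \<Longrightarrow> \<beta> \<in> dpaths_in X (up_part X A z)"
  using subpath_reachable(1)[of \<beta>] by (auto simp: dpaths_between_def dpaths_in_def up_part_def)

lemma dpaths_in_down_part: "\<beta> \<in> dpaths_between X A {w} {z} \<Longrightarrow> \<beta> \<in> dpaths_in X (down_part X A z)"
  using subpath_reachable(2)[of \<beta>] by (auto simp: dpaths_between_def dpaths_in_def down_part_def)

text \<open>All choices of the stable path space are connected by members of \<open>F\<close>, so contractibility need
only be checked for one end point \<open>w\<close> above the given one.\<close>

lemma future_trivialI:
  assumes F: "equivalence_system F" and stable: "future_stable F X A A"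
    and w: "\<And>a z. \<lbrakk>a \<in> A; z \<in> A\<rbrakk> \<Longrightarrow>
        \<exists>w\<in>A. dpaths_between X A {z} {w} \<noteq> {} \<and> F_contractible F (path_space X a w)"
  shows "future_trivial F X A"
  unfolding future_trivial_def
proof (intro conjI stable ballI)
  fix Y assume "Y \<in> SP_plus F X A A"
  then obtain a z where Y: "Y = path_space X a z" "a \<in> A" "z \<in> St_plus F X (const_path a) A"
    by (auto simp: SP_plus_def)
  have z: "z \<in> A" using Y(3) by (simp add: St_plus_def)
  obtain w \<beta> where wb: "\<beta> \<in> dpaths_between X A {z} {w}" "F_contractible F (path_space X a w)"
    using w[OF Y(2) z] by blast
  have "path_ext_in_family F X (const_path a) \<beta>"
    using Y(3) dpaths_in_up_part[OF wb(1)] by (simp add: St_plus_def)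
  then have "in_family F (path_space X a z) (path_space X a w) (path_ext (const_path a) \<beta>)"
    using wb(1) by (simp add: path_ext_in_family_def dpaths_between_def const_path_def)
  then show "F_contractible F Y" unfolding Y(1) by (rule F_contractible_in_family[OF F _ wb(2)])
qed

lemma past_trivialI:
  assumes F: "equivalence_system F" and stable: "past_stable F X A A"
    and w: "\<And>b z. \<lbrakk>b \<in> A; z \<in> A\<rbrakk> \<Longrightarrow>
        \<exists>w\<in>A. dpaths_between X A {w} {z} \<noteq> {} \<and> F_contractible F (path_space X w b)"
  shows "past_trivial F X A"
  unfolding past_trivial_def
proof (intro conjI stable ballI)
  fix Y assume "Y \<in> SP_minus F X A A"
  then obtain b z where Y: "Y = path_space X z b" "b \<in> A" "z \<in> St_minus F X A (const_path b)"
    by (auto simp: SP_minus_def)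
  have z: "z \<in> A" using Y(3) by (simp add: St_minus_def)
  obtain w \<beta> where wb: "\<beta> \<in> dpaths_between X A {w} {z}" "F_contractible F (path_space X w b)"
    using w[OF Y(2) z] by blast
  have "path_ext_in_family F X \<beta> (const_path b)"
    using Y(3) dpaths_in_down_part[OF wb(1)] by (simp add: St_minus_def)
  then have "in_family F (path_space X z b) (path_space X w b) (path_ext \<beta> (const_path b))"
    using wb(1) by (simp add: path_ext_in_family_def dpaths_between_def const_path_def)
  then show "F_contractible F Y" unfolding Y(1) by (rule F_contractible_in_family[OF F _ wb(2)])
qed

end

section \<open>Flows that collapse coordinates\<close>

text \<open>At time 1 the interval from \<open>m\<close> to \<open>M\<close> is collapsed to \<open>M\<close>, the points above \<open>M\<close> stay, and
those below \<open>m\<close> are rescaled linearly.\<close>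

definition collapse_up :: "real \<Rightarrow> real \<Rightarrow> real \<Rightarrow> real \<Rightarrow> real" where
  "collapse_up m M s x = (1 - s) * x + s * max x (min M (x * M / m))"

definition collapse_down :: "real \<Rightarrow> real \<Rightarrow> real \<Rightarrow> real \<Rightarrow> real" where
  "collapse_down m M s x = 1 - collapse_up m (1 - M) (1 - s) (1 - x)"

lemma collapse_up_0: "collapse_up m M 0 x = x"
  by (simp add: collapse_up_def)

lemma collapse_up_fixed: "M \<le> x \<Longrightarrow> collapse_up m M s x = x"
  by (simp add: collapse_up_def max_def min_def algebra_simps)

lemma collapse_up_1:
  assumes "0 < m" "m \<le> x" "x \<le> M"
  shows "collapse_up m M 1 x = M"
proof -
  have "M * m \<le> M * x" using assms by (intro mult_left_mono) auto
  then have "M \<le> x * M / m" using assms by (simp add: pos_le_divide_eq mult.commute)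
  then show ?thesis using assms by (simp add: collapse_up_def)
qed

lemma coordinate_flow_collapse_up:
  assumes m: "0 < m" "m \<le> M" "M \<le> 1"
  shows "coordinate_flow (collapse_up m M)"
proof -
  have mono: "collapse_up m M s x \<le> collapse_up m M s' x'"
    if s: "0 \<le> s" "s \<le> s'" "s' \<le> 1" and x: "0 \<le> x" "x \<le> x'" "x' \<le> 1" for s s' x x'
  proof -
    let ?\<phi> = "\<lambda>x. max x (min M (x * M / m))"
    have "x * M / m \<le> x' * M / m" using x m by (intro divide_right_mono mult_right_mono) auto
    then have \<phi>: "?\<phi> x \<le> ?\<phi> x'" using x by (intro max.mono min.mono) auto
    have "collapse_up m M s x \<le> collapse_up m M s x'"
      unfolding collapse_up_def using s x \<phi> by (intro add_mono mult_left_mono) auto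
    also have "collapse_up m M s x' = x' + s * (?\<phi> x' - x')" by (simp add: collapse_up_def algebra_simps)
    also have "\<dots> \<le> x' + s' * (?\<phi> x' - x')" using s by (intro add_left_mono mult_right_mono) auto
    also have "\<dots> = collapse_up m M s' x'" by (simp add: collapse_up_def algebra_simps)
    finally show ?thesis .
  qed
  have "m * M \<le> 1 * M" using m by (intro mult_right_mono) auto
  then have "M \<le> M / m" using m by (simp add: pos_le_divide_eq mult.commute)
  then have ends: "collapse_up m M s 0 = 0" "collapse_up m M s 1 = 1" for s
    using m by (simp_all add: collapse_up_def)
  have "0 \<le> collapse_up m M s x \<and> collapse_up m M s x \<le> 1" if "0 \<le> s" "s \<le> 1" "0 \<le> x" "x \<le> 1" for s x
    using mono[of s s 0 x] mono[of s s x 1] ends that by simp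
  moreover have "continuous_on ({0..1} \<times> {0..1}) (\<lambda>(s, x). collapse_up m M s x)"
    unfolding collapse_up_def case_prod_unfold using m by (intro continuous_intros) auto
  ultimately show ?thesis
    unfolding coordinate_flow_def endpoint_preserving_def using mono ends by auto
qed

lemma collapse_down_1: "collapse_down m M 1 x = x"
  by (simp add: collapse_down_def collapse_up_0)

lemma collapse_down_fixed: "x \<le> M \<Longrightarrow> collapse_down m M s x = x"
  by (simp add: collapse_down_def collapse_up_fixed)

lemma collapse_down_0: "\<lbrakk>0 < m; M \<le> x; x \<le> 1 - m\<rbrakk> \<Longrightarrow> collapse_down m M 0 x = M"
  by (simp add: collapse_down_def collapse_up_1)

lemma coordinate_flow_collapse_down:
  assumes m: "0 < m" "m \<le> 1 - M" "0 \<le> M"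
  shows "coordinate_flow (collapse_down m M)"
proof -
  have up: "coordinate_flow (collapse_up m (1 - M))" by (rule coordinate_flow_collapse_up) (use m in auto)
  have "continuous_on ({0..1} \<times> {0..1}) (\<lambda>(s, x). collapse_down m M s x)"
    unfolding collapse_down_def collapse_up_def case_prod_unfold using m by (intro continuous_intros) auto
  moreover have "endpoint_preserving (collapse_down m M s)" if "0 \<le> s" "s \<le> 1" for s
    using coordinate_flow_endpoint[OF up, of "1 - s"] that by (auto simp: endpoint_preserving_def collapse_down_def)
  moreover have "collapse_down m M s x \<le> collapse_down m M s' x'"
    if "0 \<le> s" "s \<le> s'" "s' \<le> 1" "0 \<le> x" "x \<le> x'" "x' \<le> 1" for s s' x x'
    using coordinate_flow_mono[OF up, of "1 - s'" "1 - s" "1 - x'" "1 - x"] that by (simp add: collapse_down_def)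
  ultimately show ?thesis unfolding coordinate_flow_def by auto
qed

context precubical
begin

text \<open>Only the coordinates of the normal form count; a vertex has none and is therefore fixed by every coordinatewise flow.\<close>

definition coords :: "('c \<times> (nat \<Rightarrow> real)) set \<Rightarrow> real set" where
  "coords z = snd (canon z) ` {1..dim (fst (canon z))}"

text \<open>For \<open>M = 0\<close> and \<open>M = 1\<close> this is an extreme vertex of the cell (\<open>diagonal_corner\<close>).\<close>

definition diagonal :: "'c \<Rightarrow> real \<Rightarrow> ('c \<times> (nat \<Rightarrow> real)) set" where
  "diagonal c M = cls (c, restrict (\<lambda>_. M) {1..dim c})"

lemma coords_bounds:
  assumes "z \<in> points" "z' \<in> points"
  shows "\<exists>m M. 0 < m \<and> m \<le> M \<and> M < 1 \<and> (\<forall>x\<in>coords z \<union> coords z'. m \<le> x \<and> x \<le> M)"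
proof -
  have c: "finite (coords z) \<and> coords z \<subseteq> {0<..<1}" if z: "z \<in> points" for z
  proof -
    obtain c t where "interior_rep (c, t)" "z = cls (c, t)" "canon z = (c, t)" by (rule pointE[OF z])
    then show ?thesis by (auto simp: coords_def interior_rep_def)
  qed
  let ?S = "insert (1/2) (coords z \<union> coords z')"
  have S: "finite ?S" "?S \<subseteq> {0<..<1}" using c[OF assms(1)] c[OF assms(2)] by auto
  have "Min ?S \<in> ?S" "Max ?S \<in> ?S" using Min_in[OF S(1)] Max_in[OF S(1)] by blast+
  then have "0 < Min ?S" "Max ?S < 1" using S(2) by (meson greaterThanLessThan_iff subsetD)+
  moreover have "Min ?S \<le> x \<and> x \<le> Max ?S" if "x \<in> ?S" for x
    using Min_le[OF S(1) that] Max_ge[OF S(1) that] by blast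
  ultimately show ?thesis by (intro exI[of _ "Min ?S"] exI[of _ "Max ?S"]) (meson insertCI order_trans)
qed

lemma cls_canon: "z \<in> points \<Longrightarrow> cls (canon z) = z"
  by (metis pointE)

lemma flow_fixed:
  assumes z: "z \<in> points" and eq: "\<And>x. x \<in> coords z \<Longrightarrow> F s x = x"
  shows "flow F s z = z"
proof -
  obtain c t where ct: "interior_rep (c, t)" "z = cls (c, t)" "canon z = (c, t)" by (rule pointE[OF z])
  have "map_coords K (F s) (c, t) = (c, t)"
    using ct(1) eq by (auto simp: map_coords_def coords_def ct(3) interior_rep_def valid_iff fun_eq_iff cube_iff)
  then show ?thesis by (simp add: flow_def ct(3)) (simp add: ct(2))
qed

lemma flow_diagonal:
  assumes z: "z \<in> points" and eq: "\<And>x. x \<in> coords z \<Longrightarrow> F s x = M"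
  shows "flow F s z = diagonal (fst (canon z)) M"
proof -
  have "map_coords K (F s) (canon z) = (fst (canon z), restrict (\<lambda>_. M) {1..dim (fst (canon z))})"
    using eq by (auto simp: map_coords_def coords_def intro!: restrict_ext)
  then show ?thesis by (simp add: flow_def diagonal_def)
qed

lemma valid_diagonal: "\<lbrakk>c \<in> cubes K; 0 \<le> M; M \<le> 1\<rbrakk> \<Longrightarrow> valid (c, restrict (\<lambda>_. M) {1..dim c})"
  unfolding valid_iff fst_conv snd_conv by (intro conjI restrict_in_cube)

lemma diagonal_in_points: "\<lbrakk>c \<in> cubes K; 0 \<le> M; M \<le> 1\<rbrakk> \<Longrightarrow> diagonal c M \<in> points"
  unfolding diagonal_def by (intro cls_in_points valid_diagonal)

lemma canon_diagonal:
  "\<lbrakk>c \<in> cubes K; 0 < M; M < 1\<rbrakk> \<Longrightarrow> canon (diagonal c M) = (c, restrict (\<lambda>_. M) {1..dim c})"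
  unfolding diagonal_def
  by (rule canon_interior, unfold interior_rep_def, intro conjI valid_diagonal) auto

lemma canon_corner:
  "c \<in> cubes K \<Longrightarrow> canon (diagonal c (of_bool \<epsilon>)) = (extreme_vertex K \<epsilon> c, restrict (\<lambda>_. of_bool \<epsilon>) {1..0})"
  unfolding diagonal_def canon_cls using normal_form_corner[OF cubes_cells] by blast

lemma extreme_vertex_in_cells: "c \<in> cubes K \<Longrightarrow> extreme_vertex K \<epsilon> c \<in> cells K 0"
  using extreme_vertex_cell[OF cubes_cells] by blast

lemma diagonal_corner:
  assumes "c \<in> cubes K"
  shows "diagonal c (of_bool \<epsilon>) = diagonal (extreme_vertex K \<epsilon> c) (of_bool \<epsilon>)"
proof -
  have "diagonal c (of_bool \<epsilon>) \<in> points" by (rule diagonal_in_points[OF assms]) auto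
  from cls_canon[OF this] show ?thesis
    unfolding canon_corner[OF assms] using extreme_vertex_in_cells[OF assms, of \<epsilon>]
    by (simp add: diagonal_def)
qed

lemma coords_diagonal:
  assumes c: "c \<in> cubes K" and M: "0 \<le> M" "M \<le> 1"
  shows "coords (diagonal c M) \<subseteq> {M}"
proof -
  consider "M = of_bool False" | "M = of_bool True" | "0 < M" "M < 1" using M by fastforce
  then show ?thesis
  proof cases
    case 3
    then show ?thesis by (auto simp: coords_def canon_diagonal[OF c])
  qed (simp_all only: coords_def canon_corner[OF c] fst_conv snd_conv
        dim_eq[OF extreme_vertex_in_cells[OF c]], simp_all)
qed

lemma path_to_diagonal:
  assumes z: "z \<in> points" and M: "0 \<le> M" "M \<le> 1" and le: "\<And>x. x \<in> coords z \<Longrightarrow> x \<le> M"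
  shows "\<exists>\<omega>. \<omega> \<in> paths z (diagonal (fst (canon z)) M)"
proof -
  obtain c t where ct: "interior_rep (c, t)" "z = cls (c, t)" "canon z = (c, t)" by (rule pointE[OF z])
  have c: "c \<in> cubes K" and t: "t \<in> unit_cube (dim c)"
    using ct(1) by (auto simp: interior_rep_def valid_iff)
  have d: "restrict (\<lambda>_. M) {1..dim c} \<in> unit_cube (dim c)"
    using valid_diagonal[OF c M] by (simp add: valid_iff)
  have "t \<le> restrict (\<lambda>_. M) {1..dim c}"
    by (rule cube_leI[OF t d]) (use le in \<open>auto simp: coords_def ct(3)\<close>)
  from segment_path[OF cubes_cells[OF c] t d this] show ?thesis
    by (simp add: ct(3)) (simp add: ct(2) diagonal_def)
qed

lemma path_from_diagonal:
  assumes z: "z \<in> points" and M: "0 \<le> M" "M \<le> 1" and le: "\<And>x. x \<in> coords z \<Longrightarrow> M \<le> x"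
  shows "\<exists>\<omega>. \<omega> \<in> paths (diagonal (fst (canon z)) M) z"
proof -
  obtain c t where ct: "interior_rep (c, t)" "z = cls (c, t)" "canon z = (c, t)" by (rule pointE[OF z])
  have c: "c \<in> cubes K" and t: "t \<in> unit_cube (dim c)"
    using ct(1) by (auto simp: interior_rep_def valid_iff)
  have d: "restrict (\<lambda>_. M) {1..dim c} \<in> unit_cube (dim c)"
    using valid_diagonal[OF c M] by (simp add: valid_iff)
  have "restrict (\<lambda>_. M) {1..dim c} \<le> t"
    by (rule cube_leI[OF d t]) (use le in \<open>auto simp: coords_def ct(3)\<close>)
  from segment_path[OF cubes_cells[OF c] d t this] show ?thesis
    by (simp add: ct(3)) (simp add: ct(2) diagonal_def)
qed

lemma canon_cube: "z \<in> points \<Longrightarrow> fst (canon z) \<in> cubes K"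
  by (erule pointE) (auto simp: interior_rep_def valid_iff)

lemma open_cell_iff:
  assumes "c \<in> cubes K"
  shows "z \<in> open_cell K c \<longleftrightarrow> z \<in> points \<and> fst (canon z) = c"
proof
  assume "z \<in> open_cell K c"
  then obtain t where "interior_rep (c, t)" "z = cls (c, t)"
    using assms by (auto simp: open_cell_def interior_rep_def valid_iff)
  then show "z \<in> points \<and> fst (canon z) = c"
    by (simp add: canon_interior cls_in_points interior_rep_valid)
next
  assume z: "z \<in> points \<and> fst (canon z) = c"
  then obtain t where "interior_rep (c, t)" "z = cls (c, t)" by (metis pointE fst_conv)
  then show "z \<in> open_cell K c" by (auto simp: open_cell_def interior_rep_def valid_iff)
qed

lemma V_plus_iff: "z \<in> V_plus K v \<longleftrightarrow> z \<in> points \<and> hi z = v"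
  using open_cell_iff canon_cube[of z] by (auto simp: V_plus_def hi_def)

lemma V_minus_iff: "z \<in> V_minus K v \<longleftrightarrow> z \<in> points \<and> lo z = v"
  using open_cell_iff canon_cube[of z] by (auto simp: V_minus_def lo_def)

end

section \<open>Order convexity and contractible path spaces\<close>

context loop_free_precubical
begin

definition order_convex :: "('c \<times> (nat \<Rightarrow> real)) set set \<Rightarrow> bool" where
  "order_convex A \<longleftrightarrow> A \<subseteq> points \<and>
     (\<forall>x\<in>A. \<forall>y\<in>A. \<forall>z\<in>points. point_le x z \<longrightarrow> point_le z y \<longrightarrow> z \<in> A)"

lemma order_convex_path:
  assumes A: "order_convex A" and \<omega>: "\<omega> \<in> paths x y" and xy: "x \<in> A" "y \<in> A"
  shows "\<omega> \<in> dpaths_between (realization K) A {x} {y}"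
proof -
  have \<omega>': "\<omega> \<in> dpaths (realization K)" "\<omega> 0 = x" "\<omega> 1 = y" using \<omega> by (simp_all only: paths_iff)
  have "\<omega> u \<in> A" if "0 \<le> u" "u \<le> 1" for u
  proof -
    have "point_le x (\<omega> u)" "point_le (\<omega> u) y" "\<omega> u \<in> points"
      using dpath_point_le[OF \<omega>'(1), of 0 u] dpath_point_le[OF \<omega>'(1), of u 1]
        dpath_in_space[OF \<omega>'(1) that] that \<omega>'(2,3) by simp_all
    then show ?thesis using A xy unfolding order_convex_def by blast
  qed
  then show ?thesis using \<omega>' unfolding dpaths_between_def dpaths_in_def by auto
qed

lemma order_convex_d_convex:
  assumes A: "order_convex A"
  shows "d_convex (realization K) A"
  unfolding d_convex_def
proof
  show "dpaths_between (realization K) A A A \<subseteq> dpaths_between (realization K) points A A"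
    using A unfolding dpaths_between_def dpaths_in_def order_convex_def by blast
  show "dpaths_between (realization K) points A A \<subseteq> dpaths_between (realization K) A A A"
  proof
    fix \<omega> assume "\<omega> \<in> dpaths_between (realization K) points A A"
    then have "\<omega> \<in> paths (\<omega> 0) (\<omega> 1)" "\<omega> 0 \<in> A" "\<omega> 1 \<in> A" by (simp_all add: dpaths_between_def)
    then show "\<omega> \<in> dpaths_between (realization K) A A A"
      using order_convex_path[OF A] by (auto simp: dpaths_between_def)
  qed
qed

lemma point_le_between:
  assumes "point_le x z" "point_le z y"
  shows "lo x = lo y \<Longrightarrow> lo z = lo x" and "hi x = hi y \<Longrightarrow> hi z = hi x"
  using assms edges_antisym[of "lo x" "lo z"] edges_antisym[of "hi x" "hi z"] unfolding point_le_def by metis+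

lemma order_convex_V_plus: "order_convex (V_plus K v)"
  unfolding order_convex_def
proof (intro conjI ballI impI)
  show "V_plus K v \<subseteq> points" by (auto simp: V_plus_iff)
  show "z \<in> V_plus K v"
    if "x \<in> V_plus K v" "y \<in> V_plus K v" "z \<in> points" "point_le x z" "point_le z y" for x y z
    using point_le_between(2)[OF that(4,5)] that(1-3) by (simp add: V_plus_iff)
qed

lemma order_convex_V_minus: "order_convex (V_minus K v)"
  unfolding order_convex_def
proof (intro conjI ballI impI)
  show "V_minus K v \<subseteq> points" by (auto simp: V_minus_iff)
  show "z \<in> V_minus K v"
    if "x \<in> V_minus K v" "y \<in> V_minus K v" "z \<in> points" "point_le x z" "point_le z y" for x y z
    using point_le_between(1)[OF that(4,5)] that(1-3) by (simp add: V_minus_iff)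
qed

lemma order_convex_open_cell:
  assumes c: "c \<in> cubes K"
  shows "order_convex (open_cell K c)"
  unfolding order_convex_def
proof (intro conjI ballI impI)
  show "open_cell K c \<subseteq> points" using open_cell_iff[OF c] by blast
  fix x y z assume *: "x \<in> open_cell K c" "y \<in> open_cell K c" "z \<in> points" "point_le x z" "point_le z y"
  have "lo x = lo y" "hi x = hi y" using * open_cell_iff[OF c] by (simp_all add: lo_def hi_def)
  then have "lo x = lo z" "hi x = hi z" using point_le_between[OF *(4,5)] by simp_all
  then have "fst (canon x) = fst (canon z)" using *(4) by (simp add: point_le_def)
  then show "z \<in> open_cell K c" using *(1,3) open_cell_iff[OF c] by simp
qed

lemma coords_mono_diagonal:
  assumes c: "c \<in> cubes K" and M: "0 < M" "M < 1" and y: "y \<in> open_cell K c"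
  shows "reachable (realization K) (diagonal c M) y \<Longrightarrow> x \<in> coords y \<Longrightarrow> M \<le> x"
    and "reachable (realization K) y (diagonal c M) \<Longrightarrow> x \<in> coords y \<Longrightarrow> x \<le> M"
proof -
  have cy: "fst (canon y) = c" using y open_cell_iff[OF c] by simp
  have eq: "lo (diagonal c M) = lo y" "hi (diagonal c M) = hi y"
    using cy canon_diagonal[OF c M] by (simp_all add: lo_def hi_def)
  show "M \<le> x" if r: "reachable (realization K) (diagonal c M) y" and x: "x \<in> coords y"
  proof -
    have "snd (canon (diagonal c M)) \<le> snd (canon y)"
      using reachable_point_le[OF r] eq unfolding point_le_def by blast
    moreover obtain k where "k \<in> {1..dim c}" "x = snd (canon y) k" using x cy by (auto simp: coords_def)
    ultimately show ?thesis
      using le_funD[of "restrict (\<lambda>_. M) {1..dim c}" "snd (canon y)" k] unfolding canon_diagonal[OF c M] by simp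
  qed
  show "x \<le> M" if r: "reachable (realization K) y (diagonal c M)" and x: "x \<in> coords y"
  proof -
    have "snd (canon y) \<le> snd (canon (diagonal c M))"
      using reachable_point_le[OF r] eq[symmetric] unfolding point_le_def by blast
    moreover obtain k where "k \<in> {1..dim c}" "x = snd (canon y) k" using x cy by (auto simp: coords_def)
    ultimately show ?thesis
      using le_funD[of "snd (canon y)" "restrict (\<lambda>_. M) {1..dim c}" k] unfolding canon_diagonal[OF c M] by simp
  qed
qed

lemma paths_to_diagonal_contractible:
  fixes F :: "'u family" and \<iota> :: "(real \<Rightarrow> ('c \<times> (nat \<Rightarrow> real)) set) \<Rightarrow> 'u"
  assumes F: "equivalence_system F" "inj \<iota>" and a: "a \<in> points" and M: "0 < M" "M \<le> 1"
    and le: "\<And>x. x \<in> coords a \<Longrightarrow> x \<le> M"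
  shows "F_contractible F (path_space (realization K) a (diagonal (fst (canon a)) M))"
proof -
  let ?d = "diagonal (fst (canon a)) M"
  obtain m' where m': "0 < m'" "\<And>x. x \<in> coords a \<Longrightarrow> m' \<le> x" using coords_bounds[OF a a] by blast
  define m where "m = min m' M"
  have m: "0 < m" "m \<le> M" "\<And>x. x \<in> coords a \<Longrightarrow> m \<le> x" using m' M by (force simp: m_def)+
  have d: "?d \<in> points" "coords ?d \<subseteq> {M}"
    using diagonal_in_points[OF canon_cube[OF a]] coords_diagonal[OF canon_cube[OF a]] M by auto
  have "\<exists>p\<in>paths a ?d. homotopic_with (\<lambda>_. True) (path_space (realization K) a ?d) (path_space (realization K) a ?d) id (\<lambda>_. p)"
  proof (rule paths_into_sink_contractible)
    show "directed_flow (flow (collapse_up m M))"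
      by (intro directed_flow_coordinate_flow coordinate_flow_collapse_up m M)
    show "flow (collapse_up m M) 0 z = z" if "z \<in> points" for z
      by (rule flow_fixed[OF that]) (rule collapse_up_0)
    show "flow (collapse_up m M) 1 a = ?d"
      by (rule flow_diagonal[OF a]) (use collapse_up_1 m le in blast)
    show "flow (collapse_up m M) s ?d = ?d" for s
      by (rule flow_fixed[OF d(1)]) (use d(2) collapse_up_fixed in auto)
  qed (rule a)
  then obtain p where p: "p \<in> paths a ?d"
    "homotopic_with (\<lambda>_. True) (path_space (realization K) a ?d) (path_space (realization K) a ?d) id (\<lambda>_. p)"
    by blast
  show ?thesis
    by (rule F_contractible_homotopic_const[OF F _ p(2)]) (use p(1) in simp)
qed

lemma paths_from_diagonal_contractible:
  fixes F :: "'u family" and \<iota> :: "(real \<Rightarrow> ('c \<times> (nat \<Rightarrow> real)) set) \<Rightarrow> 'u"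
  assumes F: "equivalence_system F" "inj \<iota>" and b: "b \<in> points" and M: "0 \<le> M" "M < 1"
    and ge: "\<And>x. x \<in> coords b \<Longrightarrow> M \<le> x"
  shows "F_contractible F (path_space (realization K) (diagonal (fst (canon b)) M) b)"
proof -
  let ?d = "diagonal (fst (canon b)) M"
  obtain M' where M': "M' < 1" "\<And>x. x \<in> coords b \<Longrightarrow> x \<le> M'" using coords_bounds[OF b b] by blast
  define m where "m = min (1 - M') (1 - M)"
  have m: "0 < m" "m \<le> 1 - M" "\<And>x. x \<in> coords b \<Longrightarrow> x \<le> 1 - m" using M' M by (force simp: m_def)+
  have d: "?d \<in> points" "coords ?d \<subseteq> {M}"
    using diagonal_in_points[OF canon_cube[OF b]] coords_diagonal[OF canon_cube[OF b]] M by auto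
  show ?thesis
  proof (rule paths_from_source_contractible[OF _ _ b _ _ F])
    show "directed_flow (flow (collapse_down m M))"
      by (intro directed_flow_coordinate_flow coordinate_flow_collapse_down m M)
    show "flow (collapse_down m M) 1 z = z" if "z \<in> points" for z
      by (rule flow_fixed[OF that]) (rule collapse_down_1)
    show "flow (collapse_down m M) 0 b = ?d"
      by (rule flow_diagonal[OF b]) (use collapse_down_0 m ge in blast)
    show "flow (collapse_down m M) s ?d = ?d" for s
      by (rule flow_fixed[OF d(1)]) (use d(2) collapse_down_fixed in auto)
  qed
qed

end

section \<open>Stability of the open cells\<close>

locale precubical_equivalence_system = loop_free_precubical K
  for K :: "'c precubical" +
  fixes F :: "'u family" and \<iota> :: "(real \<Rightarrow> ('c \<times> (nat \<Rightarrow> real)) set) \<Rightarrow> 'u"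
  assumes F: "equivalence_system F" and \<iota>: "inj \<iota>"
begin

abbreviation R :: "('c \<times> (nat \<Rightarrow> real)) set dspace" where "R \<equiv> realization K"

lemma path_ext_in_familyI:
  assumes \<Theta>: "directed_flow \<Theta>" "\<And>z. z \<in> points \<Longrightarrow> \<Theta> 0 z = z"
    and \<Psi>: "directed_flow \<Psi>" "\<And>z. z \<in> points \<Longrightarrow> \<Psi> 1 z = z"
    and \<alpha>: "\<alpha> \<in> dpaths R" "\<Theta> 1 (\<alpha> 0) = \<Theta> 1 (\<alpha> 1)" "\<And>s. \<lbrakk>0 \<le> s; s \<le> 1\<rbrakk> \<Longrightarrow> \<Psi> s (\<alpha> 0) = \<alpha> 0"
    and \<beta>: "\<beta> \<in> dpaths R" "\<Psi> 0 (\<beta> 0) = \<Psi> 0 (\<beta> 1)" "\<And>s. \<lbrakk>0 \<le> s; s \<le> 1\<rbrakk> \<Longrightarrow> \<Theta> s (\<beta> 0) = \<beta> 0"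
  shows "path_ext_in_family F R \<alpha> \<beta>"
  unfolding path_ext_in_family_def
  by (rule in_family_homotopy_equivalence[OF F \<iota> \<iota> path_ext_homotopy_equivalence[OF assms]])

text \<open>The flow \<open>collapse_up\<close> takes both ends of \<open>\<alpha>\<close> to the same diagonal point and fixes the start of \<open>\<beta>\<close>,
whose coordinates are at least \<open>M\<close>. Conversely \<open>collapse_down\<close> takes both ends of \<open>\<beta>\<close> to a diagonal
point and fixes the start of \<open>\<alpha>\<close>.\<close>

lemma path_ext_separated_cells:
  assumes c: "c \<in> cubes K" and \<alpha>: "\<alpha> \<in> dpaths_in R (open_cell K c)"
    and b: "b \<in> cubes K" and \<beta>: "\<beta> \<in> dpaths_in R (open_cell K b)" and M: "0 < M" "M < 1"
    and \<alpha>M: "\<And>x. x \<in> coords (\<alpha> 0) \<union> coords (\<alpha> 1) \<Longrightarrow> x \<le> M"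
    and \<beta>M: "\<And>x. x \<in> coords (\<beta> 0) \<union> coords (\<beta> 1) \<Longrightarrow> M \<le> x"
  shows "path_ext_in_family F R \<alpha> \<beta>"
proof -
  have p: "\<alpha> 0 \<in> points" "\<alpha> 1 \<in> points" "\<beta> 0 \<in> points" "\<beta> 1 \<in> points"
    and cell: "fst (canon (\<alpha> 0)) = c" "fst (canon (\<alpha> 1)) = c" "fst (canon (\<beta> 0)) = b" "fst (canon (\<beta> 1)) = b"
    using \<alpha> \<beta> open_cell_iff[OF c] open_cell_iff[OF b] by (auto simp: dpaths_in_def image_subset_iff)
  obtain m0 where m0: "0 < m0" "\<And>x. x \<in> coords (\<alpha> 0) \<union> coords (\<alpha> 1) \<Longrightarrow> m0 \<le> x"
    using coords_bounds[OF p(1,2)] by blast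
  define m where "m = min m0 M"
  have m: "0 < m" "m \<le> M" "\<And>x. x \<in> coords (\<alpha> 0) \<union> coords (\<alpha> 1) \<Longrightarrow> m \<le> x"
    using m0 M by (force simp: m_def)+
  obtain M1 where M1: "M1 < 1" "\<And>x. x \<in> coords (\<beta> 0) \<union> coords (\<beta> 1) \<Longrightarrow> x \<le> M1"
    using coords_bounds[OF p(3,4)] by blast
  define n where "n = min (1 - M1) (1 - M)"
  have n: "0 < n" "n \<le> 1 - M" "\<And>x. x \<in> coords (\<beta> 0) \<union> coords (\<beta> 1) \<Longrightarrow> x \<le> 1 - n"
    using M1 M by (force simp: n_def)+
  show ?thesis
  proof (rule path_ext_in_familyI)
    show "directed_flow (flow (collapse_up m M))" "directed_flow (flow (collapse_down n M))"
      using m n M by (auto intro!: directed_flow_coordinate_flow coordinate_flow_collapse_up coordinate_flow_collapse_down)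
    show "flow (collapse_up m M) 0 z = z" "flow (collapse_down n M) 1 z = z" if "z \<in> points" for z
      by (rule flow_fixed[OF that], rule collapse_up_0 collapse_down_1)+
    have "flow (collapse_up m M) 1 (\<alpha> 0) = diagonal c M" "flow (collapse_up m M) 1 (\<alpha> 1) = diagonal c M"
      using flow_diagonal[OF p(1), of "collapse_up m M" 1 M] flow_diagonal[OF p(2), of "collapse_up m M" 1 M]
        collapse_up_1[of m _ M] m \<alpha>M cell by auto
    then show "flow (collapse_up m M) 1 (\<alpha> 0) = flow (collapse_up m M) 1 (\<alpha> 1)" by simp
    have "flow (collapse_down n M) 0 (\<beta> 0) = diagonal b M" "flow (collapse_down n M) 0 (\<beta> 1) = diagonal b M"
      using flow_diagonal[OF p(3), of "collapse_down n M" 0 M] flow_diagonal[OF p(4), of "collapse_down n M" 0 M]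
        collapse_down_0[of n M] n \<beta>M cell by auto
    then show "flow (collapse_down n M) 0 (\<beta> 0) = flow (collapse_down n M) 0 (\<beta> 1)" by simp
    show "flow (collapse_down n M) s (\<alpha> 0) = \<alpha> 0" for s
      by (rule flow_fixed[OF p(1)], rule collapse_down_fixed) (use \<alpha>M in auto)
    show "flow (collapse_up m M) s (\<beta> 0) = \<beta> 0" for s
      by (rule flow_fixed[OF p(3)], rule collapse_up_fixed) (use \<beta>M in auto)
    show "\<alpha> \<in> dpaths R" "\<beta> \<in> dpaths R" using \<alpha> \<beta> by (auto simp: dpaths_in_def)
  qed
qed

lemma diagonal_in_open_cell: "\<lbrakk>c \<in> cubes K; 0 < M; M < 1\<rbrakk> \<Longrightarrow> diagonal c M \<in> open_cell K c"
  by (simp add: open_cell_iff canon_diagonal diagonal_in_points)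

text \<open>Inside a cell reachability is the order of the coordinates, so a d-path above the diagonal point has
coordinates at least \<open>M\<close>.\<close>

lemma diagonal_St_plus:
  assumes c: "c \<in> cubes K" and \<alpha>: "\<alpha> \<in> dpaths_in R (open_cell K c)" and b: "b \<in> cubes K" and M: "0 < M" "M < 1"
    and \<alpha>M: "\<And>x. x \<in> coords (\<alpha> 0) \<union> coords (\<alpha> 1) \<Longrightarrow> x \<le> M"
  shows "diagonal b M \<in> St_plus F R \<alpha> (open_cell K b)"
  unfolding St_plus_def
proof (intro CollectI conjI ballI diagonal_in_open_cell b M)
  fix \<beta> assume \<beta>: "\<beta> \<in> dpaths_in R (up_part R (open_cell K b) (diagonal b M))"
  then have r: "\<beta> u \<in> open_cell K b" "reachable R (diagonal b M) (\<beta> u)" if "u \<in> {0..1}" for u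
    using that by (auto simp: dpaths_in_def up_part_def image_subset_iff)
  show "path_ext_in_family F R \<alpha> \<beta>"
  proof (rule path_ext_separated_cells[OF c \<alpha> b _ M \<alpha>M])
    show "\<beta> \<in> dpaths_in R (open_cell K b)" using \<beta> by (auto simp: dpaths_in_def up_part_def)
    show "M \<le> x" if "x \<in> coords (\<beta> 0) \<union> coords (\<beta> 1)" for x
      using coords_mono_diagonal(1)[OF b M r(1) r(2), of 0 x] coords_mono_diagonal(1)[OF b M r(1) r(2), of 1 x] that
      by auto
  qed
qed

lemma diagonal_St_minus:
  assumes b: "b \<in> cubes K" and \<beta>: "\<beta> \<in> dpaths_in R (open_cell K b)" and c: "c \<in> cubes K" and M: "0 < M" "M < 1"
    and \<beta>M: "\<And>x. x \<in> coords (\<beta> 0) \<union> coords (\<beta> 1) \<Longrightarrow> M \<le> x"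
  shows "diagonal c M \<in> St_minus F R (open_cell K c) \<beta>"
  unfolding St_minus_def
proof (intro CollectI conjI ballI diagonal_in_open_cell c M)
  fix \<alpha> assume \<alpha>: "\<alpha> \<in> dpaths_in R (down_part R (open_cell K c) (diagonal c M))"
  then have r: "\<alpha> u \<in> open_cell K c" "reachable R (\<alpha> u) (diagonal c M)" if "u \<in> {0..1}" for u
    using that by (auto simp: dpaths_in_def down_part_def image_subset_iff)
  show "path_ext_in_family F R \<alpha> \<beta>"
  proof (rule path_ext_separated_cells[OF c _ b \<beta> M _ \<beta>M])
    show "\<alpha> \<in> dpaths_in R (open_cell K c)" using \<alpha> by (auto simp: dpaths_in_def down_part_def)
    show "x \<le> M" if "x \<in> coords (\<alpha> 0) \<union> coords (\<alpha> 1)" for x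
      using coords_mono_diagonal(2)[OF c M r(1) r(2), of 0 x] coords_mono_diagonal(2)[OF c M r(1) r(2), of 1 x] that
      by auto
  qed
qed

lemma open_cell_upper_bound:
  assumes c: "c \<in> cubes K" and xy: "x \<in> open_cell K c" "y \<in> open_cell K c"
  obtains M where "0 < M" "M < 1" "\<And>r. r \<in> coords x \<union> coords y \<Longrightarrow> r \<le> M"
    "dpaths_between R (open_cell K c) {x} {diagonal c M} \<noteq> {}"
    "dpaths_between R (open_cell K c) {y} {diagonal c M} \<noteq> {}"
proof -
  have p: "x \<in> points" "y \<in> points" "fst (canon x) = c" "fst (canon y) = c"
    using xy open_cell_iff[OF c] by auto
  obtain m M where M: "0 < m" "m \<le> M" "M < 1" "\<And>r. r \<in> coords x \<union> coords y \<Longrightarrow> r \<le> M"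
    using coords_bounds[OF p(1,2)] by blast
  have M0: "0 < M" using M by simp
  note conv = order_convex_path[OF order_convex_open_cell[OF c] _ _ diagonal_in_open_cell[OF c M0 M(3)]]
  obtain \<omega> where "\<omega> \<in> paths x (diagonal c M)" using path_to_diagonal[OF p(1), of M] M M0 p(3) by auto
  moreover obtain \<omega>' where "\<omega>' \<in> paths y (diagonal c M)" using path_to_diagonal[OF p(2), of M] M M0 p(4) by auto
  ultimately show thesis using that[OF M0 M(3,4)] conv xy by blast
qed

lemma open_cell_lower_bound:
  assumes c: "c \<in> cubes K" and xy: "x \<in> open_cell K c" "y \<in> open_cell K c"
  obtains M where "0 < M" "M < 1" "\<And>r. r \<in> coords x \<union> coords y \<Longrightarrow> M \<le> r"
    "dpaths_between R (open_cell K c) {diagonal c M} {x} \<noteq> {}"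
    "dpaths_between R (open_cell K c) {diagonal c M} {y} \<noteq> {}"
proof -
  have p: "x \<in> points" "y \<in> points" "fst (canon x) = c" "fst (canon y) = c"
    using xy open_cell_iff[OF c] by auto
  obtain m M where M: "0 < m" "m \<le> M" "M < 1" "\<And>r. r \<in> coords x \<union> coords y \<Longrightarrow> m \<le> r"
    using coords_bounds[OF p(1,2)] by blast
  have m1: "m < 1" using M by simp
  note conv = order_convex_path[OF order_convex_open_cell[OF c] _ diagonal_in_open_cell[OF c M(1) m1]]
  obtain \<omega> where "\<omega> \<in> paths (diagonal c m) x" using path_from_diagonal[OF p(1), of m] M m1 p(3) by auto
  moreover obtain \<omega>' where "\<omega>' \<in> paths (diagonal c m) y" using path_from_diagonal[OF p(2), of m] M m1 p(4) by auto
  ultimately show thesis using that[OF M(1) m1 M(4)] conv xy by blast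
qed

lemma future_connected_open_cell: "c \<in> cubes K \<Longrightarrow> future_connected R (open_cell K c)"
  unfolding future_connected_def by (metis open_cell_upper_bound diagonal_in_open_cell)

lemma past_connected_open_cell: "c \<in> cubes K \<Longrightarrow> past_connected R (open_cell K c)"
  unfolding past_connected_def by (metis open_cell_lower_bound diagonal_in_open_cell)

lemma future_stable_open_cells:
  assumes c: "c \<in> cubes K" and b: "b \<in> cubes K"
  shows "future_stable F R (open_cell K c) (open_cell K b)"
  unfolding future_stable_def
proof (intro conjI ballI future_connected_open_cell c b)
  fix \<alpha> assume \<alpha>: "\<alpha> \<in> dpaths_in R (open_cell K c)"
  then have "\<alpha> 0 \<in> open_cell K c" "\<alpha> 1 \<in> open_cell K c" by (auto simp: dpaths_in_def image_subset_iff)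
  then obtain M where "0 < M" "M < 1" "\<And>r. r \<in> coords (\<alpha> 0) \<union> coords (\<alpha> 1) \<Longrightarrow> r \<le> M"
    by (rule open_cell_upper_bound[OF c]) blast
  then show "St_plus F R \<alpha> (open_cell K b) \<noteq> {}" using diagonal_St_plus[OF c \<alpha> b] by blast
qed

lemma past_stable_open_cells:
  assumes c: "c \<in> cubes K" and b: "b \<in> cubes K"
  shows "past_stable F R (open_cell K c) (open_cell K b)"
  unfolding past_stable_def
proof (intro conjI ballI past_connected_open_cell c b)
  fix \<beta> assume \<beta>: "\<beta> \<in> dpaths_in R (open_cell K b)"
  then have "\<beta> 0 \<in> open_cell K b" "\<beta> 1 \<in> open_cell K b" by (auto simp: dpaths_in_def image_subset_iff)
  then obtain M where "0 < M" "M < 1" "\<And>r. r \<in> coords (\<beta> 0) \<union> coords (\<beta> 1) \<Longrightarrow> M \<le> r"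
    by (rule open_cell_lower_bound[OF b]) blast
  then show "St_minus F R (open_cell K c) \<beta> \<noteq> {}" using diagonal_St_minus[OF b \<beta> c] by blast
qed

lemma const_path_in_cell:
  assumes "x \<in> A" "A \<subseteq> points"
  shows "const_path x \<in> dpaths_in R A"
  using assms dpath_const[of x] by (auto simp: dpaths_in_def const_path_def)

lemma totally_stable_open_cells:
  assumes c: "c \<in> cubes K" and b: "b \<in> cubes K"
  shows "totally_stable F R (open_cell K c) (open_cell K b)"
  unfolding totally_stable_def
proof (intro conjI future_stable_open_cells past_stable_open_cells c b bexI)
  let ?a = "diagonal c (1/2)" and ?b = "diagonal b (1/2)"
  have sub: "open_cell K c \<subseteq> points" "open_cell K b \<subseteq> points"
    using open_cell_iff[OF c] open_cell_iff[OF b] by auto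
  show a: "?a \<in> open_cell K c" and b': "?b \<in> open_cell K b"
    using diagonal_in_open_cell[of _ "1/2"] c b by simp_all
  show "?b \<in> St_plus F R (const_path ?a) (open_cell K b)"
    by (rule diagonal_St_plus[OF c const_path_in_cell[OF a sub(1)] b])
      (use coords_diagonal[OF c, of "1/2"] in \<open>auto simp: const_path_def\<close>)
  show "?a \<in> St_minus F R (open_cell K c) (const_path ?b)"
    by (rule diagonal_St_minus[OF b const_path_in_cell[OF b' sub(2)] c])
      (use coords_diagonal[OF b, of "1/2"] in \<open>auto simp: const_path_def\<close>)
qed

lemma future_trivial_open_cell:
  assumes c: "c \<in> cubes K"
  shows "future_trivial F R (open_cell K c)"
proof (rule future_trivialI[OF F future_stable_open_cells[OF c c]])
  fix a z assume az: "a \<in> open_cell K c" "z \<in> open_cell K c"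
  then obtain M where M: "0 < M" "M < 1" "\<And>r. r \<in> coords a \<union> coords z \<Longrightarrow> r \<le> M"
    "dpaths_between R (open_cell K c) {z} {diagonal c M} \<noteq> {}"
    by (rule open_cell_upper_bound[OF c]) blast
  have a: "a \<in> points" "fst (canon a) = c" using az open_cell_iff[OF c] by auto
  have "F_contractible F (path_space R a (diagonal c M))"
    using paths_to_diagonal_contractible[OF F \<iota> a(1), of M] M a(2) by auto
  then show "\<exists>w\<in>open_cell K c. dpaths_between R (open_cell K c) {z} {w} \<noteq> {} \<and> F_contractible F (path_space R a w)"
    using M diagonal_in_open_cell[OF c] by blast
qed

lemma past_trivial_open_cell:
  assumes c: "c \<in> cubes K"
  shows "past_trivial F R (open_cell K c)"
proof (rule past_trivialI[OF F past_stable_open_cells[OF c c]])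
  fix b z assume bz: "b \<in> open_cell K c" "z \<in> open_cell K c"
  then obtain M where M: "0 < M" "M < 1" "\<And>r. r \<in> coords b \<union> coords z \<Longrightarrow> M \<le> r"
    "dpaths_between R (open_cell K c) {diagonal c M} {z} \<noteq> {}"
    by (rule open_cell_lower_bound[OF c]) blast
  have b: "b \<in> points" "fst (canon b) = c" using bz open_cell_iff[OF c] by auto
  have "F_contractible F (path_space R (diagonal c M) b)"
    using paths_from_diagonal_contractible[OF F \<iota> b(1), of M] M b(2) by auto
  then show "\<exists>w\<in>open_cell K c. dpaths_between R (open_cell K c) {w} {z} \<noteq> {} \<and> F_contractible F (path_space R w b)"
    using M diagonal_in_open_cell[OF c] by blast
qed

lemma disjoint_cover_open_cells: "disjoint_cover points (cubes K) (open_cell K)"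
  using open_cell_iff canon_cube by (auto simp: disjoint_cover_def disjoint_family_on_def)

lemma stable_total_open_cells: "stable_total_component_system F R (cubes K) (open_cell K)"
  unfolding stable_total_component_system_def stable_future_component_system_def stable_past_component_system_def
  using disjoint_cover_open_cells order_convex_d_convex[OF order_convex_open_cell]
    future_connected_open_cell past_connected_open_cell future_trivial_open_cell past_trivial_open_cell
    future_stable_open_cells past_stable_open_cells totally_stable_open_cells by blast

section \<open>Stability of the neighbourhoods of vertices\<close>

lemma vertex_corner:
  assumes v: "v \<in> cells K 0"
  shows "canon (diagonal v (of_bool \<epsilon>)) = (v, restrict (\<lambda>_. of_bool \<epsilon>) {1..0})"
    and "diagonal v (of_bool \<epsilon>) \<in> points" "hi (diagonal v (of_bool \<epsilon>)) = v" "lo (diagonal v (of_bool \<epsilon>)) = v"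
    and "coords (diagonal v (of_bool \<epsilon>)) = {}"
proof -
  show c: "canon (diagonal v (of_bool \<epsilon>)) = (v, restrict (\<lambda>_. of_bool \<epsilon>) {1..0})"
    using canon_corner[OF cells_cubes[OF v]] v by simp
  show "diagonal v (of_bool \<epsilon>) \<in> points" by (rule diagonal_in_points[OF cells_cubes[OF v]]) auto
  show "hi (diagonal v (of_bool \<epsilon>)) = v" "lo (diagonal v (of_bool \<epsilon>)) = v" "coords (diagonal v (of_bool \<epsilon>)) = {}"
    unfolding hi_def lo_def coords_def c using v by simp_all
qed

lemma V_plus_path_to_vertex:
  assumes v: "v \<in> cells K 0" and x: "x \<in> V_plus K v"
  shows "dpaths_between R (V_plus K v) {x} {diagonal v 1} \<noteq> {}"
    and "diagonal (fst (canon x)) 1 = diagonal v 1"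
proof -
  have p: "x \<in> points" "hi x = v" using x by (auto simp: V_plus_iff)
  show eq: "diagonal (fst (canon x)) 1 = diagonal v 1"
    using diagonal_corner[OF canon_cube[OF p(1)], of True] p(2) by (simp add: hi_def)
  have v1: "diagonal v 1 \<in> V_plus K v" using vertex_corner(2,3)[OF v, of True] by (simp add: V_plus_iff)
  have "x \<le> 1" if "x \<in> coords x'" "x' \<in> points" for x x'
    using coords_bounds[OF that(2,2)] that(1) by force
  then obtain \<omega> where "\<omega> \<in> paths x (diagonal v 1)" using path_to_diagonal[OF p(1), of 1] p(1) eq by auto
  then show "dpaths_between R (V_plus K v) {x} {diagonal v 1} \<noteq> {}"
    using order_convex_path[OF order_convex_V_plus _ x v1] by blast
qed

lemma V_minus_path_from_vertex:
  assumes v: "v \<in> cells K 0" and x: "x \<in> V_minus K v"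
  shows "dpaths_between R (V_minus K v) {diagonal v 0} {x} \<noteq> {}"
    and "diagonal (fst (canon x)) 0 = diagonal v 0"
proof -
  have p: "x \<in> points" "lo x = v" using x by (auto simp: V_minus_iff)
  show eq: "diagonal (fst (canon x)) 0 = diagonal v 0"
    using diagonal_corner[OF canon_cube[OF p(1)], of False] p(2) by (simp add: lo_def)
  have v0: "diagonal v 0 \<in> V_minus K v" using vertex_corner(2,4)[OF v, of False] by (simp add: V_minus_iff)
  have "0 \<le> x" if "x \<in> coords x'" "x' \<in> points" for x x'
    using coords_bounds[OF that(2,2)] that(1) by force
  then obtain \<omega> where "\<omega> \<in> paths (diagonal v 0) x" using path_from_diagonal[OF p(1), of 0] p(1) eq by auto
  then show "dpaths_between R (V_minus K v) {diagonal v 0} {x} \<noteq> {}"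
    using order_convex_path[OF order_convex_V_minus _ v0 x] by blast
qed

lemma vertex_in_V:
  assumes "v \<in> cells K 0"
  shows "diagonal v 1 \<in> V_plus K v" and "diagonal v 0 \<in> V_minus K v"
  using vertex_corner[OF assms, of True] vertex_corner[OF assms, of False]
  by (simp_all add: V_plus_iff V_minus_iff)

lemma future_connected_V_plus: "v \<in> cells K 0 \<Longrightarrow> future_connected R (V_plus K v)"
  unfolding future_connected_def using V_plus_path_to_vertex(1) vertex_in_V(1) by blast

lemma past_connected_V_minus: "v \<in> cells K 0 \<Longrightarrow> past_connected R (V_minus K v)"
  unfolding past_connected_def using V_minus_path_from_vertex(1) vertex_in_V(2) by blast

lemma dpaths_between_reachable: "dpaths_between R A {x} {y} \<noteq> {} \<Longrightarrow> A \<subseteq> points \<Longrightarrow> reachable R x y"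
  unfolding reachable_def dpaths_between_def dpaths_in_def by blast

text \<open>Every point of \<open>V_plus K v\<close> lies below \<open>v\<close>, so by antisymmetry only \<open>v\<close> itself lies above \<open>v\<close>.\<close>

lemma up_part_vertex:
  assumes v: "v \<in> cells K 0" and y: "y \<in> up_part R (V_plus K v) (diagonal v 1)"
  shows "y = diagonal v 1"
proof (rule point_le_antisym)
  have yV: "y \<in> V_plus K v" and r: "reachable R (diagonal v 1) y" using y by (auto simp: up_part_def)
  have sub: "V_plus K v \<subseteq> points" by (auto simp: V_plus_iff)
  show "y \<in> points" "diagonal v 1 \<in> points" using yV vertex_in_V(1)[OF v] sub by auto
  show "point_le (diagonal v 1) y" by (rule reachable_point_le[OF r])
  show "point_le y (diagonal v 1)"
    by (rule reachable_point_le[OF dpaths_between_reachable[OF V_plus_path_to_vertex(1)[OF v yV] sub]])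
qed

lemma down_part_vertex:
  assumes v: "v \<in> cells K 0" and y: "y \<in> down_part R (V_minus K v) (diagonal v 0)"
  shows "y = diagonal v 0"
proof (rule point_le_antisym)
  have yV: "y \<in> V_minus K v" and r: "reachable R y (diagonal v 0)" using y by (auto simp: down_part_def)
  have sub: "V_minus K v \<subseteq> points" by (auto simp: V_minus_iff)
  show "y \<in> points" "diagonal v 0 \<in> points" using yV vertex_in_V(2)[OF v] sub by auto
  show "point_le y (diagonal v 0)" by (rule reachable_point_le[OF r])
  show "point_le (diagonal v 0) y"
    by (rule reachable_point_le[OF dpaths_between_reachable[OF V_minus_path_from_vertex(1)[OF v yV] sub]])
qed

text \<open>The vertex \<open>w\<close> is a stable point: a d-path in the part above it is constant, so only the start has to be
pushed, and \<open>collapse_up m 1\<close> takes both ends of \<open>\<alpha>\<close> to \<open>v\<close> if \<open>m\<close> is a lower bound of their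
coordinates. The cells of the two ends may differ.\<close>

lemma future_stable_V_plus:
  assumes v: "v \<in> cells K 0" and w: "w \<in> cells K 0"
  shows "future_stable F R (V_plus K v) (V_plus K w)"
  unfolding future_stable_def
proof (intro conjI ballI future_connected_V_plus v w)
  fix \<alpha> assume \<alpha>: "\<alpha> \<in> dpaths_in R (V_plus K v)"
  have "diagonal w 1 \<in> St_plus F R \<alpha> (V_plus K w)"
    unfolding St_plus_def
  proof (intro CollectI conjI ballI vertex_in_V w)
    fix \<beta> assume \<beta>: "\<beta> \<in> dpaths_in R (up_part R (V_plus K w) (diagonal w 1))"
    then have \<beta>w: "\<beta> 0 = diagonal w 1" "\<beta> 1 = diagonal w 1"
      using up_part_vertex[OF w] by (auto simp: dpaths_in_def image_subset_iff)
    have \<alpha>V: "\<alpha> 0 \<in> V_plus K v" "\<alpha> 1 \<in> V_plus K v" using \<alpha> by (auto simp: dpaths_in_def image_subset_iff)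
    then have p: "\<alpha> 0 \<in> points" "\<alpha> 1 \<in> points" by (auto simp: V_plus_iff)
    obtain m M where m: "0 < m" "m \<le> M" "M < 1" "\<And>x. x \<in> coords (\<alpha> 0) \<union> coords (\<alpha> 1) \<Longrightarrow> m \<le> x \<and> x \<le> M"
      using coords_bounds[OF p] by blast
    show "path_ext_in_family F R \<alpha> \<beta>"
    proof (rule path_ext_in_familyI[where \<Theta> = "flow (collapse_up m 1)" and \<Psi> = "\<lambda>s z. z"])
      show "directed_flow (flow (collapse_up m 1))"
        using m by (auto intro!: directed_flow_coordinate_flow coordinate_flow_collapse_up)
      show "flow (collapse_up m 1) 0 z = z" if "z \<in> points" for z
        by (rule flow_fixed[OF that]) (rule collapse_up_0)
      show "directed_flow (\<lambda>s z. z)" by (rule directed_flow_trivial)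
      have "collapse_up m 1 1 x = 1" if "x \<in> coords (\<alpha> 0) \<union> coords (\<alpha> 1)" for x
        using collapse_up_1[of m x 1] m(1,3) m(4)[OF that] by simp
      then show "flow (collapse_up m 1) 1 (\<alpha> 0) = flow (collapse_up m 1) 1 (\<alpha> 1)"
        using flow_diagonal[OF p(1), of "collapse_up m 1" 1 1] flow_diagonal[OF p(2), of "collapse_up m 1" 1 1]
          V_plus_path_to_vertex(2)[OF v \<alpha>V(1)] V_plus_path_to_vertex(2)[OF v \<alpha>V(2)] by simp
      show "flow (collapse_up m 1) s (\<beta> 0) = \<beta> 0" for s
        unfolding \<beta>w using vertex_corner(2,5)[OF w, of True] by (intro flow_fixed) auto
      show "\<alpha> \<in> dpaths R" "\<beta> \<in> dpaths R" using \<alpha> \<beta> by (auto simp: dpaths_in_def)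
    qed (simp_all add: \<beta>w)
  qed
  then show "St_plus F R \<alpha> (V_plus K w) \<noteq> {}" by blast
qed

lemma past_stable_V_minus:
  assumes v: "v \<in> cells K 0" and w: "w \<in> cells K 0"
  shows "past_stable F R (V_minus K v) (V_minus K w)"
  unfolding past_stable_def
proof (intro conjI ballI past_connected_V_minus v w)
  fix \<beta> assume \<beta>: "\<beta> \<in> dpaths_in R (V_minus K w)"
  have "diagonal v 0 \<in> St_minus F R (V_minus K v) \<beta>"
    unfolding St_minus_def
  proof (intro CollectI conjI ballI vertex_in_V v)
    fix \<alpha> assume \<alpha>: "\<alpha> \<in> dpaths_in R (down_part R (V_minus K v) (diagonal v 0))"
    then have \<alpha>v: "\<alpha> 0 = diagonal v 0" "\<alpha> 1 = diagonal v 0"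
      using down_part_vertex[OF v] by (auto simp: dpaths_in_def image_subset_iff)
    have \<beta>V: "\<beta> 0 \<in> V_minus K w" "\<beta> 1 \<in> V_minus K w" using \<beta> by (auto simp: dpaths_in_def image_subset_iff)
    then have p: "\<beta> 0 \<in> points" "\<beta> 1 \<in> points" by (auto simp: V_minus_iff)
    obtain m M where m: "0 < m" "m \<le> M" "M < 1" "\<And>x. x \<in> coords (\<beta> 0) \<union> coords (\<beta> 1) \<Longrightarrow> m \<le> x \<and> x \<le> M"
      using coords_bounds[OF p] by blast
    show "path_ext_in_family F R \<alpha> \<beta>"
    proof (rule path_ext_in_familyI[where \<Theta> = "\<lambda>s z. z" and \<Psi> = "flow (collapse_down (1 - M) 0)"])
      show "directed_flow (flow (collapse_down (1 - M) 0))"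
        using m by (auto intro!: directed_flow_coordinate_flow coordinate_flow_collapse_down)
      show "flow (collapse_down (1 - M) 0) 1 z = z" if "z \<in> points" for z
        by (rule flow_fixed[OF that]) (rule collapse_down_1)
      show "directed_flow (\<lambda>s z. z)" by (rule directed_flow_trivial)
      have "collapse_down (1 - M) 0 0 x = 0" if "x \<in> coords (\<beta> 0) \<union> coords (\<beta> 1)" for x
        using collapse_down_0[of "1 - M" 0 x] m(1,3) m(4)[OF that] by simp
      then show "flow (collapse_down (1 - M) 0) 0 (\<beta> 0) = flow (collapse_down (1 - M) 0) 0 (\<beta> 1)"
        using flow_diagonal[OF p(1), of "collapse_down (1 - M) 0" 0 0] flow_diagonal[OF p(2), of "collapse_down (1 - M) 0" 0 0]
          V_minus_path_from_vertex(2)[OF w \<beta>V(1)] V_minus_path_from_vertex(2)[OF w \<beta>V(2)] by simp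
      show "flow (collapse_down (1 - M) 0) s (\<alpha> 0) = \<alpha> 0" for s
        unfolding \<alpha>v using vertex_corner(2,5)[OF v, of False] by (intro flow_fixed) auto
      show "\<alpha> \<in> dpaths R" "\<beta> \<in> dpaths R" using \<alpha> \<beta> by (auto simp: dpaths_in_def)
    qed (simp_all add: \<alpha>v)
  qed
  then show "St_minus F R (V_minus K v) \<beta> \<noteq> {}" by blast
qed

lemma future_trivial_V_plus:
  assumes v: "v \<in> cells K 0"
  shows "future_trivial F R (V_plus K v)"
proof (rule future_trivialI[OF F future_stable_V_plus[OF v v]])
  fix a z assume az: "a \<in> V_plus K v" "z \<in> V_plus K v"
  have a: "a \<in> points" using az by (simp add: V_plus_iff)
  have "x \<le> 1" if "x \<in> coords a" for x using coords_bounds[OF a a] that by force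
  then have "F_contractible F (path_space R a (diagonal v 1))"
    using paths_to_diagonal_contractible[OF F \<iota> a, of 1] V_plus_path_to_vertex(2)[OF v az(1)] by simp
  then show "\<exists>w\<in>V_plus K v. dpaths_between R (V_plus K v) {z} {w} \<noteq> {} \<and> F_contractible F (path_space R a w)"
    using V_plus_path_to_vertex(1)[OF v az(2)] vertex_in_V(1)[OF v] by blast
qed

lemma past_trivial_V_minus:
  assumes v: "v \<in> cells K 0"
  shows "past_trivial F R (V_minus K v)"
proof (rule past_trivialI[OF F past_stable_V_minus[OF v v]])
  fix b z assume bz: "b \<in> V_minus K v" "z \<in> V_minus K v"
  have b: "b \<in> points" using bz by (simp add: V_minus_iff)
  have "0 \<le> x" if "x \<in> coords b" for x using coords_bounds[OF b b] that by force
  then have "F_contractible F (path_space R (diagonal v 0) b)"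
    using paths_from_diagonal_contractible[OF F \<iota> b, of 0] V_minus_path_from_vertex(2)[OF v bz(1)] by simp
  then show "\<exists>w\<in>V_minus K v. dpaths_between R (V_minus K v) {w} {z} \<noteq> {} \<and> F_contractible F (path_space R w b)"
    using V_minus_path_from_vertex(1)[OF v bz(2)] vertex_in_V(2)[OF v] by blast
qed

lemma disjoint_cover_V:
  "disjoint_cover points (cells K 0) (V_plus K)" "disjoint_cover points (cells K 0) (V_minus K)"
  using extreme_vertex_in_cells[OF canon_cube]
  by (auto simp: disjoint_cover_def disjoint_family_on_def V_plus_iff V_minus_iff hi_def lo_def)

lemma stable_future_V_plus: "stable_future_component_system F R (cells K 0) (V_plus K)"
  unfolding stable_future_component_system_def
  using disjoint_cover_V(1) order_convex_d_convex[OF order_convex_V_plus]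
    future_connected_V_plus future_trivial_V_plus future_stable_V_plus by blast

lemma stable_past_V_minus: "stable_past_component_system F R (cells K 0) (V_minus K)"
  unfolding stable_past_component_system_def
  using disjoint_cover_V(2) order_convex_d_convex[OF order_convex_V_minus]
    past_connected_V_minus past_trivial_V_minus past_stable_V_minus by blast

end

theorem theorem5p4:
  fixes K :: "'c precubical" and F :: "'u family"
  assumes "precubical_set K" and "precubical_no_loops K"
    and "equivalence_system F"
    and universe: "\<exists>\<iota> :: (real \<Rightarrow> ('c \<times> (nat \<Rightarrow> real)) set) \<Rightarrow> 'u. inj \<iota>"
  shows "stable_total_component_system F (realization K) (cubes K) (open_cell K) \<and>
         stable_future_component_system F (realization K) (cells K 0) (V_plus K) \<and>
         stable_past_component_system F (realization K) (cells K 0) (V_minus K)"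
proof -
  obtain \<iota> :: "(real \<Rightarrow> ('c \<times> (nat \<Rightarrow> real)) set) \<Rightarrow> 'u" where \<iota>: "inj \<iota>" using universe by blast
  interpret precubical_equivalence_system K F \<iota>
    by unfold_locales (rule assms(1-3) \<iota>)+
  show ?thesis using stable_total_open_cells stable_future_V_plus stable_past_V_minus by blast
qed

end
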